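(* Let $t$ be a fixed positive integer. There exist functions $p_1(x),\dots,p_{t-1}(x),q(x)$ of a real variable $x$, each bounded in absolute value by a polynomial in $x$, with the following property. Let $d=d(n)$ be a non-negative integer-valued function of $n$ with $d=O(\log n)$, and let $\pi\in\mathfrak{S}_n$ be chosen uniformly at random. Then \[ \Pr{\mathrm{mj}(\pi)\geq d+1}=\Big(1+\sum_{i=1}^{t-1}\frac{p_i(d)}{n^{i}}\Big)e^{-2d}+O\!\left(\frac{q(d)e^{2d}}{n^t}\right). \]
   Context: $\mathfrak{S}_n$ is the set of permutations of $[n]=\{1,\dots,n\}$. The minimum jump of $\pi\in\mathfrak{S}_n$ is $\mathrm{mj}(\pi)=\min_{1\le i\le n-1}|\pi(i+1)-\pi(i)|$. *)

theory Defs
  imports "HOL-Combinatorics.Permutations" "HOL-Library.Landau_Symbols"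
          "HOL-Computational_Algebra.Polynomial"
begin

text \<open>Minimum jump of a permutation pi of {1..n}:
  min over 1 <= i <= n-1 of |pi(i+1) - pi(i)|  (meaningful for n >= 2).\<close>
definition min_jump :: "nat \<Rightarrow> (nat \<Rightarrow> nat) \<Rightarrow> nat" where
  "min_jump n \<pi> = Min {nat \<bar>int (\<pi> (i+1)) - int (\<pi> i)\<bar> | i. 1 \<le> i \<and> i \<le> n - 1}"

definition prob_mj_ge :: "nat \<Rightarrow> nat \<Rightarrow> real" where
  "prob_mj_ge n k = real (card {\<pi>. \<pi> permutes {1..n} \<and> min_jump n \<pi> \<ge> k}) / fact n"

definition poly_bounded :: "(real \<Rightarrow> real) \<Rightarrow> bool" where
  "poly_bounded f \<longleftrightarrow> (\<exists>P :: real poly. \<forall>x. \<bar>f x\<bar> \<le> poly P x)"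

end

theory Submission
  imports Defs "HOL-Combinatorics.Multiset_Permutations"
    "HOL-Computational_Algebra.Formal_Power_Series" "HOL-Real_Asymp.Real_Asymp"
begin

text \<open>
  Let \<open>X\<close> be the number of pairs \<open>(x, y)\<close> with \<open>0 < \<bar>x - y\<bar> \<le> d\<close> such that \<open>y\<close> directly follows
  \<open>x\<close> in the permutation; the probability in question is that of \<open>X = 0\<close>. The binomial moment
  of order \<open>k\<close> of \<open>X\<close> is \<open>l k * fact (n - k) / fact n\<close>, where \<open>l k\<close> counts the sets of \<open>k\<close> such pairs
  forming a directed linear forest, and Bonferroni's inequalities reduce the theorem to moments
  of order \<open>k = O(log n)\<close>. With \<open>M\<close> the number of all pairs, \<open>fact k * l k / M ^ k\<close> is the
  probability that \<open>k\<close> random pairs are distinct and form a linear forest. Its Moebius transform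
  (the cumulants) of order \<open>m\<close> is of size \<open>n powr (- m / 2)\<close> up to factors polynomial in \<open>k\<close> and
  \<open>d\<close>, since it only sees tuples in which every pair meets another one, and such a tuple is
  dominated by half of its members. Cumulants of bounded order have expansions in \<open>1 / n\<close>
  because, for fixed \<open>k\<close>, the number \<open>l k\<close> is a polynomial in \<open>n\<close> for \<open>n \<ge> 2 * k * (d + 1)\<close>. Hence the
  \<open>k\<close>-th binomial moment is \<open>(2 * d) ^ k / fact k\<close> times an expansion in \<open>1 / n\<close> whose coefficients are
  polynomials in \<open>k\<close>, and the alternating sum over \<open>k\<close> turns these into polynomials in \<open>d\<close> times
  \<open>exp (- 2 * d)\<close>, while the error terms sum to a polynomial in \<open>d\<close> times \<open>exp (2 * d)\<close>.
\<close>

section \<open>Polynomially bounded coefficients and Newton polynomials\<close>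

text \<open>The obstacle is uniformity. The alternating series may be cut only at an order
  \<open>K\<close> that exceeds a multiple of \<open>d + ln n\<close>, so the moments must be
  expanded with errors polynomial in \<open>k\<close> while \<open>k\<close> grows with
  \<open>n\<close>. The polynomial formula for \<open>l k\<close> cannot serve this directly, as its
  degree grows with \<open>k\<close>; it is applied only to the cumulants of order below
  \<open>2 * t\<close>, and the size estimate disposes of all others.

  As functions of \<open>d\<close> the coefficients are controlled only in size, since a polynomial
  bound is all that is claimed; this spares any analysis of how the finite differences depend on
  \<open>d\<close>. The error carries \<open>exp (2 * d)\<close> because the errors of the single
  moments are added in absolute value, which loses the cancellation behind
  \<open>exp (- 2 * d)\<close>. The expansions exclude \<open>d = 0\<close>, as the moments are
  normalised by powers of \<open>2 * d\<close>; in that case the probability is exactly 1.\<close>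

definition poly_growth :: "(nat \<Rightarrow> real) \<Rightarrow> bool" where
  "poly_growth c \<longleftrightarrow> (\<exists>C K. \<forall>d. \<bar>c d\<bar> \<le> C * (1 + real d) ^ K)"

lemma poly_growthI: "(\<And>d. \<bar>c d\<bar> \<le> C * (1 + real d) ^ K) \<Longrightarrow> poly_growth c"
  unfolding poly_growth_def by blast

lemma poly_growthE:
  assumes "poly_growth c"
  obtains C K where "C \<ge> 0" "\<And>d. \<bar>c d\<bar> \<le> C * (1 + real d) ^ K"
proof -
  obtain C K where CK: "\<And>d. \<bar>c d\<bar> \<le> C * (1 + real d) ^ K"
    using assms unfolding poly_growth_def by blast
  from CK[of 0] have "C \<ge> 0" by simp
  with CK show thesis using that by blast
qed

lemma poly_growth_const [simp, intro]: "poly_growth (\<lambda>d. a)"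
  by (rule poly_growthI[of _ "\<bar>a\<bar>" 0]) simp

lemma poly_growth_of_nat [simp, intro]: "poly_growth (\<lambda>d. real d)"
  by (rule poly_growthI[of _ 1 1]) simp

lemma poly_growth_add [intro]:
  assumes "poly_growth f" "poly_growth g"
  shows "poly_growth (\<lambda>d. f d + g d)"
proof -
  obtain C K where C: "C \<ge> 0" "\<And>d. \<bar>f d\<bar> \<le> C * (1 + real d) ^ K" by (rule poly_growthE[OF assms(1)]) blast
  obtain C' K' where C': "C' \<ge> 0" "\<And>d. \<bar>g d\<bar> \<le> C' * (1 + real d) ^ K'" by (rule poly_growthE[OF assms(2)]) blast
  show ?thesis
  proof (rule poly_growthI[of _ "C + C'" "K + K'"])
    fix d
    have "C * (1 + real d) ^ K \<le> C * (1 + real d) ^ (K + K')"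
      using C(1) by (intro mult_left_mono power_increasing) auto
    moreover have "C' * (1 + real d) ^ K' \<le> C' * (1 + real d) ^ (K + K')"
      using C'(1) by (intro mult_left_mono power_increasing) auto
    ultimately show "\<bar>f d + g d\<bar> \<le> (C + C') * (1 + real d) ^ (K + K')"
      using C(2)[of d] C'(2)[of d] by (simp add: distrib_right)
  qed
qed

lemma poly_growth_mult [intro]:
  assumes "poly_growth f" "poly_growth g"
  shows "poly_growth (\<lambda>d. f d * g d)"
proof -
  obtain C K where C: "C \<ge> 0" "\<And>d. \<bar>f d\<bar> \<le> C * (1 + real d) ^ K" by (rule poly_growthE[OF assms(1)]) blast
  obtain C' K' where C': "C' \<ge> 0" "\<And>d. \<bar>g d\<bar> \<le> C' * (1 + real d) ^ K'" by (rule poly_growthE[OF assms(2)]) blast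
  show ?thesis
  proof (rule poly_growthI[of _ "C * C'" "K + K'"])
    fix d
    have "\<bar>f d\<bar> * \<bar>g d\<bar> \<le> (C * (1 + real d) ^ K) * (C' * (1 + real d) ^ K')"
      using C C' by (intro mult_mono) auto
    then show "\<bar>f d * g d\<bar> \<le> C * C' * (1 + real d) ^ (K + K')"
      by (simp add: abs_mult power_add mult_ac)
  qed
qed

lemma poly_growth_power [intro]: "poly_growth f \<Longrightarrow> poly_growth (\<lambda>d. f d ^ m)"
  by (induction m) auto

lemma poly_growth_minus [intro]: "poly_growth f \<Longrightarrow> poly_growth (\<lambda>d. - f d)"
  unfolding poly_growth_def by simp

lemma poly_growth_sum [intro]:
  "(\<And>i. i \<in> A \<Longrightarrow> poly_growth (f i)) \<Longrightarrow> poly_growth (\<lambda>d. \<Sum>i\<in>A. f i d)"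
  by (induction A rule: infinite_finite_induct) auto

lemma poly_growth_mono:
  assumes "poly_growth g" "\<And>d. \<bar>f d\<bar> \<le> g d"
  shows "poly_growth f"
proof -
  obtain C K where "\<And>d. \<bar>g d\<bar> \<le> C * (1 + real d) ^ K" by (rule poly_growthE[OF assms(1)]) blast
  then show ?thesis
    by (intro poly_growthI[of f C K]) (meson abs_ge_self assms(2) order_trans)
qed

text \<open>The binomial basis is the one adapted both to summation over \<open>k\<close> and to Poisson weights.\<close>

definition newton_poly :: "(nat \<Rightarrow> nat \<Rightarrow> real) \<Rightarrow> bool" where
  "newton_poly f \<longleftrightarrow> (\<exists>J c. (\<forall>j. poly_growth (c j)) \<and>
     (\<forall>k d. f k d = (\<Sum>j\<le>J. c j d * real (k choose j))))"

lemma newton_polyI: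
  assumes "\<And>j. poly_growth (c j)" "\<And>k d. f k d = (\<Sum>j\<le>J. c j d * real (k choose j))"
  shows "newton_poly f"
  using assms unfolding newton_poly_def by blast

lemma newton_polyE:
  assumes "newton_poly f"
  obtains J c where "\<And>j. poly_growth (c j)" "\<And>k d. f k d = (\<Sum>j\<le>J. c j d * real (k choose j))"
  using assms unfolding newton_poly_def by blast

lemma newton_poly_binomial:
  assumes "poly_growth c"
  shows "newton_poly (\<lambda>k d. c d * real (k choose j))"
proof (rule newton_polyI[of "\<lambda>i. if i = j then c else (\<lambda>_. 0)" _ j])
  fix k d
  have "(\<Sum>i\<le>j. (if i = j then c else (\<lambda>_. 0)) d * real (k choose i)) =
        (\<Sum>i\<le>j. if i = j then c d * real (k choose i) else 0)"
    by (rule sum.cong) auto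
  then show "c d * real (k choose j) = (\<Sum>i\<le>j. (if i = j then c else (\<lambda>_. 0)) d * real (k choose i))"
    by simp
qed (use assms in auto)

lemma newton_poly_coeff [intro]: "poly_growth c \<Longrightarrow> newton_poly (\<lambda>k d. c d)"
  using newton_poly_binomial[of c 0] by simp

lemma newton_poly_arg [simp, intro]: "newton_poly (\<lambda>k d. real k)"
  using newton_poly_binomial[of "\<lambda>_. 1" 1] by simp

lemma newton_poly_add [intro]:
  assumes "newton_poly f" "newton_poly g"
  shows "newton_poly (\<lambda>k d. f k d + g k d)"
proof -
  obtain J c where c: "\<And>j. poly_growth (c j)" "\<And>k d. f k d = (\<Sum>j\<le>J. c j d * real (k choose j))"
    by (rule newton_polyE[OF assms(1)]) blast
  obtain J' c' where c': "\<And>j. poly_growth (c' j)" "\<And>k d. g k d = (\<Sum>j\<le>J'. c' j d * real (k choose j))"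
    by (rule newton_polyE[OF assms(2)]) blast
  let ?a = "\<lambda>j. if j \<le> J then c j else (\<lambda>_. 0)"
  let ?b = "\<lambda>j. if j \<le> J' then c' j else (\<lambda>_. 0)"
  have 1: "(\<Sum>j\<le>J. c j d * real (k choose j)) = (\<Sum>j\<le>J+J'. ?a j d * real (k choose j))" for k d
    by (rule sum.mono_neutral_cong_left) auto
  have 2: "(\<Sum>j\<le>J'. c' j d * real (k choose j)) = (\<Sum>j\<le>J+J'. ?b j d * real (k choose j))" for k d
    by (rule sum.mono_neutral_cong_left) auto
  show ?thesis
  proof (rule newton_polyI[of "\<lambda>j d. ?a j d + ?b j d" _ "J + J'"])
    show "poly_growth (\<lambda>d. ?a j d + ?b j d)" for j
      by (rule poly_growth_add) (auto simp: c(1) c'(1))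
  qed (simp add: c(2) c'(2) 1 2 distrib_right sum.distrib)
qed

lemma newton_poly_sum [intro]:
  "(\<And>i. i \<in> A \<Longrightarrow> newton_poly (f i)) \<Longrightarrow> newton_poly (\<lambda>k d. \<Sum>i\<in>A. f i k d)"
  by (induction A rule: infinite_finite_induct) auto

text \<open>Multiplication by \<open>k\<close> moves a binomial coefficient only to itself and its
  successor, because \<open>(j + 1) * (k choose (j + 1)) = (k - j) * (k choose j)\<close>. All
  products in the binomial basis are reduced to this.\<close>

lemma arg_times_binomial:
  "real k * real (k choose j) = real (j + 1) * real (k choose (j + 1)) + real j * real (k choose j)"
proof (induction k arbitrary: j)
  case (Suc k)
  show ?case
  proof (cases j)
    case 0
    then show ?thesis by simp
  next
    case (Suc i)
    then show ?thesis
      using Suc.IH[of i] Suc.IH[of "Suc i"] by (simp add: algebra_simps)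
  qed
qed auto

lemma newton_poly_arg_times:
  assumes "newton_poly f"
  shows "newton_poly (\<lambda>k d. real k * f k d)"
proof -
  obtain J c where c: "\<And>j. poly_growth (c j)" "\<And>k d. f k d = (\<Sum>j\<le>J. c j d * real (k choose j))"
    by (rule newton_polyE[OF assms(1)]) blast
  have "(\<lambda>k d. real k * f k d) =
    (\<lambda>k d. \<Sum>j\<le>J. (c j d * real (j+1)) * real (k choose (j+1)) + (c j d * real j) * real (k choose j))"
  proof (intro ext)
    fix k d
    have "real k * f k d = (\<Sum>j\<le>J. c j d * (real k * real (k choose j)))"
      by (simp add: c(2) sum_distrib_left mult_ac)
    also have "\<dots> = (\<Sum>j\<le>J. (c j d * real (j+1)) * real (k choose (j+1)) + (c j d * real j) * real (k choose j))"
      unfolding arg_times_binomial by (simp add: algebra_simps)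
    finally show "real k * f k d = \<dots>" .
  qed
  moreover have "newton_poly \<dots>"
    by (intro newton_poly_sum newton_poly_add newton_poly_binomial poly_growth_mult c(1) poly_growth_const)
  ultimately show ?thesis by simp
qed

lemma newton_poly_coeff_times:
  assumes "poly_growth a" "newton_poly f"
  shows "newton_poly (\<lambda>k d. a d * f k d)"
proof -
  obtain J c where c: "\<And>j. poly_growth (c j)" "\<And>k d. f k d = (\<Sum>j\<le>J. c j d * real (k choose j))"
    by (rule newton_polyE[OF assms(2)]) blast
  show ?thesis
    by (rule newton_polyI[of "\<lambda>j d. a d * c j d" _ J])
      (auto simp: c sum_distrib_left mult_ac intro: assms(1))
qed

lemma newton_poly_mult [intro]:
  assumes "newton_poly f" "newton_poly g"
  shows "newton_poly (\<lambda>k d. f k d * g k d)"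
proof -
  \<comment> \<open>Induction on \<open>j\<close> replaces a product formula for two binomials: each
    step is one multiplication by \<open>k\<close>.\<close>
  have binom: "newton_poly (\<lambda>k d. real (k choose j) * g k d)" for j
  proof (induction j)
    case 0
    then show ?case using assms by simp
  next
    case (Suc j)
    have "(\<lambda>k d. real (k choose Suc j) * g k d) =
      (\<lambda>k d. (1 / real (j+1)) * (real k * (real (k choose j) * g k d) + (- real j) * (real (k choose j) * g k d)))"
    proof (intro ext)
      fix k d
      have "real (j+1) * real (k choose Suc j) = real k * real (k choose j) - real j * real (k choose j)"
        using arg_times_binomial[of k j] by simp
      then have "real (j+1) * (real (k choose Suc j) * g k d) =
          real k * (real (k choose j) * g k d) + (- real j) * (real (k choose j) * g k d)"
        by (metis (no_types, opaque_lifting) left_diff_distrib mult.assoc mult_minus_left uminus_add_conv_diff add.commute)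
      then show "real (k choose Suc j) * g k d =
        (1 / real (j+1)) * (real k * (real (k choose j) * g k d) + (- real j) * (real (k choose j) * g k d))"
        by (metis nonzero_mult_div_cancel_left mult_1 times_divide_eq_left of_nat_eq_0_iff add_is_0 one_neq_zero)
    qed
    moreover have "newton_poly \<dots>"
      by (intro newton_poly_coeff_times newton_poly_add newton_poly_arg_times poly_growth_const Suc)
    ultimately show ?case by simp
  qed
  obtain J c where c: "\<And>j. poly_growth (c j)" "\<And>k d. f k d = (\<Sum>j\<le>J. c j d * real (k choose j))"
    by (rule newton_polyE[OF assms(1)]) blast
  have "(\<lambda>k d. f k d * g k d) = (\<lambda>k d. \<Sum>j\<le>J. c j d * (real (k choose j) * g k d))"
    by (simp add: c(2) sum_distrib_right mult.assoc)
  moreover have "newton_poly \<dots>"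
    by (intro newton_poly_sum newton_poly_coeff_times c(1) binom)
  ultimately show ?thesis by simp
qed

lemma newton_poly_power [intro]: "newton_poly f \<Longrightarrow> newton_poly (\<lambda>k d. f k d ^ m)"
  by (induction m) auto

lemma newton_poly_cumsum:
  assumes "newton_poly f"
  shows "newton_poly (\<lambda>k d. \<Sum>i<k. f i d)"
proof -
  obtain J c where c: "\<And>j. poly_growth (c j)" "\<And>k d. f k d = (\<Sum>j\<le>J. c j d * real (k choose j))"
    by (rule newton_polyE[OF assms(1)]) blast
  have hockey: "(\<Sum>i<k. real (i choose j)) = real (k choose Suc j)" for k j
    by (induction k) auto
  have "(\<lambda>k d. \<Sum>i<k. f i d) = (\<lambda>k d. \<Sum>j\<le>J. c j d * real (k choose Suc j))"
  proof (intro ext)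
    fix k d
    have "(\<Sum>i<k. f i d) = (\<Sum>j\<le>J. \<Sum>i<k. c j d * real (i choose j))"
      unfolding c(2) by (rule sum.swap)
    also have "\<dots> = (\<Sum>j\<le>J. c j d * real (k choose Suc j))"
      by (simp flip: sum_distrib_left add: hockey)
    finally show "(\<Sum>i<k. f i d) = \<dots>" .
  qed
  moreover have "newton_poly \<dots>"
    by (intro newton_poly_sum newton_poly_binomial c(1))
  ultimately show ?thesis by simp
qed

lemma newton_poly_bound:
  assumes "newton_poly f"
  obtains C K where "C \<ge> 0" "\<And>k d. \<bar>f k d\<bar> \<le> C * real (k + d + 1) ^ K"
proof -
  have "\<exists>C K. C \<ge> 0 \<and> (\<forall>k d. \<bar>\<Sum>j\<le>J. c j d * real (k choose j)\<bar> \<le> C * real (k + d + 1) ^ K)"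
    if c: "\<And>j. poly_growth (c j)" for c J
  proof (induction J)
    case 0
    obtain C K where C: "C \<ge> 0" "\<And>d. \<bar>c 0 d\<bar> \<le> C * (1 + real d) ^ K" by (rule poly_growthE[OF c[of 0]]) blast
    have "\<bar>c 0 d\<bar> \<le> C * real (k + d + 1) ^ K" for k d
      by (rule order_trans[OF C(2)]) (use C(1) in \<open>intro mult_left_mono power_mono; simp\<close>)
    then show ?case using C(1) by (intro exI[of _ C] exI[of _ K]) simp
  next
    case (Suc J)
    then obtain C K where C: "C \<ge> 0" "\<And>k d. \<bar>\<Sum>j\<le>J. c j d * real (k choose j)\<bar> \<le> C * real (k + d + 1) ^ K"
      by blast
    obtain C' K' where C': "C' \<ge> 0" "\<And>d. \<bar>c (Suc J) d\<bar> \<le> C' * (1 + real d) ^ K'"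
      by (rule poly_growthE[OF c[of "Suc J"]]) blast
    show ?case
    proof (intro exI[of _ "C + C'"] exI[of _ "K + (K' + Suc J)"] conjI allI)
      fix k d
      have ge1: "1 \<le> real (k + d + 1)" by simp
      have "\<bar>c (Suc J) d\<bar> \<le> C' * real (k + d + 1) ^ K'"
        by (rule order_trans[OF C'(2)]) (use C'(1) in \<open>intro mult_left_mono power_mono; simp\<close>)
      moreover have "real (k choose Suc J) \<le> real (k + d + 1) ^ Suc J"
      proof -
        have "k choose Suc J \<le> k ^ Suc J" 
          by (cases "Suc J \<le> k") (auto intro: binomial_le_pow simp: binomial_eq_0 simp del: power_Suc)
        also have "\<dots> \<le> (k + d + 1) ^ Suc J" by (intro power_mono) auto
        finally show ?thesis by (metis of_nat_le_iff of_nat_power)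
      qed
      ultimately have "\<bar>c (Suc J) d * real (k choose Suc J)\<bar> \<le> (C' * real (k + d + 1) ^ K') * real (k + d + 1) ^ Suc J"
        unfolding abs_mult by (intro mult_mono) (use C'(1) in auto)
      also have "\<dots> = C' * real (k + d + 1) ^ (K' + Suc J)"
        by (simp only: power_add mult.assoc)
      also have "\<dots> \<le> C' * real (k + d + 1) ^ (K + (K' + Suc J))"
        by (intro mult_left_mono power_increasing C'(1) ge1) simp
      finally have 1: "\<bar>c (Suc J) d * real (k choose Suc J)\<bar> \<le> C' * real (k + d + 1) ^ (K + (K' + Suc J))" .
      have 2: "C * real (k + d + 1) ^ K \<le> C * real (k + d + 1) ^ (K + (K' + Suc J))"
        by (intro mult_left_mono power_increasing C(1) ge1) simp
      show "\<bar>\<Sum>j\<le>Suc J. c j d * real (k choose j)\<bar> \<le> (C + C') * real (k + d + 1) ^ (K + (K' + Suc J))"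
        using C(2)[of d k] 1 2 by (simp add: distrib_right)
    qed (use C C' in simp)
  qed
  then show thesis using that assms unfolding newton_poly_def by metis
qed

text \<open>These are the factorial moments of a Poisson law up to normalisation: the summand is
  \<open>x ^ j / fact j\<close> times the exponential term of index \<open>k - j\<close>, so the
  series is a shifted exponential series. A negative \<open>x\<close> is allowed, and this is how
  the signs of inclusion-exclusion enter.\<close>

lemma exp_binomial_sums: "(\<lambda>k. x ^ k / fact k * real (k choose j)) sums (x ^ j / fact j * exp (x::real))"
proof -
  have "(\<lambda>k. x ^ k / fact k) sums exp x"
    using exp_converges[of x] by (simp add: divide_inverse mult.commute)
  then have "(\<lambda>k. x ^ j / fact j * (x ^ k / fact k)) sums (x ^ j / fact j * exp x)"
    by (rule sums_mult)
  moreover have "(\<lambda>k. x ^ j / fact j * (x ^ k / fact k)) =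
      (\<lambda>k. x ^ (k + j) / fact (k + j) * real ((k + j) choose j))"
    by (auto simp: binomial_fact power_add field_simps)
  ultimately show ?thesis
    using sums_zero_iff_shift[of j "\<lambda>k. x ^ k / fact k * real (k choose j)"] by simp
qed

lemma newton_poly_exp_sums:
  assumes "newton_poly f"
  obtains J c where "\<And>j. poly_growth (c j)"
    "\<And>d x. (\<lambda>k. x ^ k / fact k * f k d) sums ((\<Sum>j\<le>J. c j d * x ^ j) * exp (x::real))"
proof -
  obtain J c where c: "\<And>j. poly_growth (c j)" "\<And>k d. f k d = (\<Sum>j\<le>J. c j d * real (k choose j))"
    by (rule newton_polyE[OF assms(1)]) blast
  show thesis
  proof (rule that[of "\<lambda>j d. c j d / fact j" J])
    show "poly_growth (\<lambda>d. c j d / fact j)" for j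
      using poly_growth_mult[OF c(1)[of j] poly_growth_const[of "1 / fact j"]] by simp
    fix d and x :: real
    have "(\<lambda>k. \<Sum>j\<le>J. c j d * (x ^ k / fact k * real (k choose j))) sums
          (\<Sum>j\<le>J. c j d * (x ^ j / fact j * exp x))"
      by (intro sums_sum sums_mult exp_binomial_sums)
    then show "(\<lambda>k. x ^ k / fact k * f k d) sums ((\<Sum>j\<le>J. c j d / fact j * x ^ j) * exp x)"
      by (simp add: c(2) sum_distrib_left sum_distrib_right mult_ac)
  qed
qed

section \<open>Uniform asymptotic expansions\<close>

text \<open>Expansions in powers of \<open>1/n\<close> are uniform in \<open>k\<close> and \<open>d\<close> as long as both stay below a
  small power of \<open>n\<close>; the exponent 5 is what the tail estimate for the cumulants needs.\<close>

definition in_range :: "nat \<Rightarrow> nat \<Rightarrow> nat \<Rightarrow> nat \<Rightarrow> bool" where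
  "in_range D k d n \<longleftrightarrow> 1 \<le> d \<and> D * (k + d + 1) ^ 5 \<le> n"

lemma in_range_mono: "in_range D k d n \<Longrightarrow> D' \<le> D \<Longrightarrow> k' \<le> k \<Longrightarrow> in_range D' k' d n"
  unfolding in_range_def by (meson add_le_mono1 le_trans mult_le_mono power_mono zero_le)

lemma in_range_imp_ge:
  assumes "in_range D k d n" "D > 0"
  shows "k + d + 1 \<le> n" "D * (k + d + 1) \<le> n" "n > 0"
proof -
  have "(k + d + 1) \<le> (k + d + 1) ^ 5" by (rule self_le_power) auto
  then have "D * (k + d + 1) \<le> D * (k + d + 1) ^ 5" by (rule mult_le_mono2)
  then show 1: "D * (k + d + 1) \<le> n" using assms unfolding in_range_def by linarith
  have "1 * (k + d + 1) \<le> D * (k + d + 1)" using assms by (intro mult_le_mono1) auto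
  then show "k + d + 1 \<le> n" using 1 by simp
  then show "n > 0" by linarith
qed

text \<open>The recursion peels off one term of the expansion at a time. This makes closure under
  products immediate, and lets a recurrence of the form \<open>f = r + F f / n\<close> bootstrap an
  expansion of any order from mere boundedness of \<open>f\<close>.\<close>

fun expandable :: "nat \<Rightarrow> (nat \<Rightarrow> nat \<Rightarrow> nat \<Rightarrow> real) \<Rightarrow> bool" where
  "expandable 0 f \<longleftrightarrow> (\<exists>C K D. C \<ge> 0 \<and> D > 0 \<and>
     (\<forall>k d n. in_range D k d n \<longrightarrow> \<bar>f k d n\<bar> \<le> C * real (k + d + 1) ^ K))"
| "expandable (Suc t) f \<longleftrightarrow> (\<exists>r g D. D > 0 \<and> newton_poly r \<and> expandable t g \<and>
     (\<forall>k d n. in_range D k d n \<longrightarrow> f k d n = r k d + g k d n / real n))"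

lemma expandable_0I:
  assumes "C \<ge> 0" "D > 0" "\<And>k d n. in_range D k d n \<Longrightarrow> \<bar>f k d n\<bar> \<le> C * real (k + d + 1) ^ K"
  shows "expandable 0 f"
  using assms unfolding expandable.simps by blast

lemma expandable_0E:
  assumes "expandable 0 f"
  obtains C D K where "C \<ge> 0" "D > 0"
    "\<And>k d n. in_range D k d n \<Longrightarrow> \<bar>f k d n\<bar> \<le> C * real (k + d + 1) ^ K"
  using assms unfolding expandable.simps by blast

lemma expandable_SucI:
  assumes "newton_poly r" "expandable t g" "D > 0"
    "\<And>k d n. in_range D k d n \<Longrightarrow> f k d n = r k d + g k d n / real n"
  shows "expandable (Suc t) f"
  using assms by auto

lemma expandable_cong:
  assumes "expandable t f" "D > 0" "\<And>k d n. in_range D k d n \<Longrightarrow> g k d n = f k d n"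
  shows "expandable t g"
proof (cases t)
  case 0
  then obtain C K D' where D': "C \<ge> 0" "D' > 0"
    "\<And>k d n. in_range D' k d n \<Longrightarrow> \<bar>f k d n\<bar> \<le> C * real (k + d + 1) ^ K" using assms(1) by auto
  have "\<bar>g k d n\<bar> \<le> C * real (k + d + 1) ^ K" if "in_range (D + D') k d n" for k d n
    using D'(3)[of k d n] assms(3)[of k d n] in_range_mono[OF that, of D k] in_range_mono[OF that, of D' k] by simp
  then show ?thesis unfolding 0 using D' by (intro expandable_0I[of C "D + D'"]) auto
next
  case (Suc s)
  then obtain r h D' where D': "D' > 0" "newton_poly r" "expandable s h"
    "\<And>k d n. in_range D' k d n \<Longrightarrow> f k d n = r k d + h k d n / real n" using assms(1) by auto
  have "g k d n = r k d + h k d n / real n" if "in_range (D + D') k d n" for k d n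
    using D'(4)[of k d n] assms(3)[of k d n] in_range_mono[OF that, of D k] in_range_mono[OF that, of D' k] by simp
  then show ?thesis unfolding Suc using D' by (intro expandable_SucI[where D = "D + D'"]) auto
qed


text \<open>All coefficients of the expansion can be taken to be zero. Estimates that come without a
  formula enter in this way, notably the tail of the cumulant sum.\<close>

lemma expandable_small:
  assumes "C \<ge> 0" "D > 0"
    "\<And>k d n. in_range D k d n \<Longrightarrow> \<bar>f k d n\<bar> \<le> C * real (k + d + 1) ^ K / real n ^ t"
  shows "expandable t f"
  using assms(3)
proof (induction t arbitrary: f)
  case 0
  then show ?case using assms(1,2) by auto
next
  case (Suc t)
  show ?case
  proof (rule expandable_SucI[where D = D and r = "\<lambda>_ _. 0" and g = "\<lambda>k d n. real n * f k d n"])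
    show "expandable t (\<lambda>k d n. real n * f k d n)"
    proof (rule Suc.IH)
      fix k d n assume *: "in_range D k d n"
      then have "n > 0" using in_range_imp_ge assms(2) by blast
      then show "\<bar>real n * f k d n\<bar> \<le> C * real (k + d + 1) ^ K / real n ^ t"
        using Suc.prems[OF *] by (simp add: abs_mult field_simps)
    qed
  qed (use assms(2) in_range_imp_ge in \<open>auto intro!: newton_poly_coeff\<close>)
qed

lemma expandable_newton_poly [intro]:
  assumes "newton_poly r" shows "expandable t (\<lambda>k d n. r k d)"
proof (cases t)
  case 0
  obtain C K where "C \<ge> 0" "\<And>k d. \<bar>r k d\<bar> \<le> C * real (k + d + 1) ^ K"
    by (rule newton_poly_bound[OF assms]) blast
  then show ?thesis unfolding 0 by (intro expandable_0I[of C 1]) auto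
next
  case (Suc s)
  have "expandable s (\<lambda>k d n. 0)" by (rule expandable_small[of 0 1]) auto
  then show ?thesis unfolding Suc
    by (rule expandable_SucI[OF assms, where D = 1]) auto
qed

lemma expandable_const [simp, intro]: "expandable t (\<lambda>k d n. a)"
  by (intro expandable_newton_poly newton_poly_coeff) simp

lemma expandable_divide_n [intro]:
  assumes "expandable t f"
  shows "expandable (Suc t) (\<lambda>k d n. f k d n / real n)"
  by (rule expandable_SucI[where r = "\<lambda>_ _. 0", OF _ assms, where D = 1]) (auto intro!: newton_poly_coeff)

lemma expandable_inverse_n [intro]: "expandable t (\<lambda>k d n. 1 / real n)"
proof (cases t)
  case 0
  have "\<bar>1 / real n\<bar> \<le> 1 * real (k + d + 1) ^ 0" for k d n :: nat
    by (cases n) auto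
  then show ?thesis unfolding 0 using expandable_small[of 1 1 "\<lambda>k d n. 1 / real n" 0 0]
    by (metis One_nat_def div_by_1 power_0 zero_le_one zero_less_one)
qed (use expandable_divide_n[OF expandable_const] in auto)

lemma expandable_add [intro]:
  "expandable t f \<Longrightarrow> expandable t g \<Longrightarrow> expandable t (\<lambda>k d n. f k d n + g k d n)"
proof (induction t arbitrary: f g)
  case 0
  obtain C D K where f: "C \<ge> 0" "D > 0"
    "\<And>k d n. in_range D k d n \<Longrightarrow> \<bar>f k d n\<bar> \<le> C * real (k + d + 1) ^ K"
    by (rule expandable_0E[OF 0(1)]) blast
  obtain C' D' K' where g: "C' \<ge> 0" "D' > 0"
    "\<And>k d n. in_range D' k d n \<Longrightarrow> \<bar>g k d n\<bar> \<le> C' * real (k + d + 1) ^ K'"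
    by (rule expandable_0E[OF 0(2)]) blast
  note D = f g
  have "\<bar>f k d n + g k d n\<bar> \<le> (C + C') * real (k + d + 1) ^ (K + K')" if *: "in_range (D + D') k d n" for k d n
  proof -
    have "C * real (k + d + 1) ^ K \<le> C * real (k + d + 1) ^ (K + K')"
      using D by (intro mult_left_mono power_increasing) auto
    moreover have "C' * real (k + d + 1) ^ K' \<le> C' * real (k + d + 1) ^ (K + K')"
      using D by (intro mult_left_mono power_increasing) auto
    moreover have "\<bar>f k d n\<bar> \<le> C * real (k + d + 1) ^ K" "\<bar>g k d n\<bar> \<le> C' * real (k + d + 1) ^ K'"
      using in_range_mono[OF *] D by auto
    ultimately show ?thesis unfolding distrib_right by linarith
  qed
  then show ?case using D
    by (intro expandable_0I[of "C + C'" "D + D'"]) auto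
next
  case (Suc t)
  obtain r h D where D: "D > 0" "newton_poly r" "expandable t h"
    "\<And>k d n. in_range D k d n \<Longrightarrow> f k d n = r k d + h k d n / real n" using Suc.prems(1) by auto
  obtain r' h' D' where D': "D' > 0" "newton_poly r'" "expandable t h'"
    "\<And>k d n. in_range D' k d n \<Longrightarrow> g k d n = r' k d + h' k d n / real n" using Suc.prems(2) by auto
  show ?case
  proof (rule expandable_SucI[where D = "D + D'"])
    show "newton_poly (\<lambda>k d. r k d + r' k d)" using D D' by blast
    show "expandable t (\<lambda>k d n. h k d n + h' k d n)" using D D' Suc.IH by blast
    fix k d n assume *: "in_range (D + D') k d n"
    show "f k d n + g k d n = (r k d + r' k d) + (h k d n + h' k d n) / real n"
      using D(4) D'(4) in_range_mono[OF *, of D k] in_range_mono[OF *, of D' k] by (simp add: add_divide_distrib)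
  qed (use D in simp)
qed

lemma expandable_mult [intro]:
  "expandable t f \<Longrightarrow> expandable t g \<Longrightarrow> expandable t (\<lambda>k d n. f k d n * g k d n)"
proof (induction t arbitrary: f g)
  case 0
  obtain C D K where f: "C \<ge> 0" "D > 0"
    "\<And>k d n. in_range D k d n \<Longrightarrow> \<bar>f k d n\<bar> \<le> C * real (k + d + 1) ^ K"
    by (rule expandable_0E[OF 0(1)]) blast
  obtain C' D' K' where g: "C' \<ge> 0" "D' > 0"
    "\<And>k d n. in_range D' k d n \<Longrightarrow> \<bar>g k d n\<bar> \<le> C' * real (k + d + 1) ^ K'"
    by (rule expandable_0E[OF 0(2)]) blast
  note D = f g
  have "\<bar>f k d n * g k d n\<bar> \<le> (C * C') * real (k + d + 1) ^ (K + K')" if *: "in_range (D + D') k d n" for k d n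
  proof -
    have "\<bar>f k d n\<bar> \<le> C * real (k + d + 1) ^ K" "\<bar>g k d n\<bar> \<le> C' * real (k + d + 1) ^ K'"
      using in_range_mono[OF *] D by auto
    then have "\<bar>f k d n\<bar> * \<bar>g k d n\<bar> \<le> (C * real (k + d + 1) ^ K) * (C' * real (k + d + 1) ^ K')"
      using D by (intro mult_mono) auto
    then show ?thesis by (simp only: abs_mult power_add mult_ac)
  qed
  then show ?case using D
    by (intro expandable_0I[of "C * C'" "D + D'"]) auto
next
  case (Suc t)
  obtain r h D where D: "D > 0" "newton_poly r" "expandable t h"
    "\<And>k d n. in_range D k d n \<Longrightarrow> f k d n = r k d + h k d n / real n" using Suc.prems(1) by auto
  obtain r' h' D' where D': "D' > 0" "newton_poly r'" "expandable t h'"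
    "\<And>k d n. in_range D' k d n \<Longrightarrow> g k d n = r' k d + h' k d n / real n" using Suc.prems(2) by auto
  show ?case
  proof (rule expandable_SucI[where D = "D + D'"])
    show "newton_poly (\<lambda>k d. r k d * r' k d)" using D D' by blast
    \<comment> \<open>The product of the two remainders keeps a factor \<open>1 / n\<close>, which
      is itself expandable of every order, so the induction hypothesis applies to the whole
      bracket.\<close>
    show "expandable t (\<lambda>k d n. (r k d * h' k d n + r' k d * h k d n) + (h k d n * h' k d n) * (1 / real n))" 
      by (intro expandable_add Suc.IH expandable_newton_poly expandable_inverse_n D D')
    fix k d n assume *: "in_range (D + D') k d n"
    show "f k d n * g k d n = (r k d * r' k d) +
      ((r k d * h' k d n + r' k d * h k d n) + (h k d n * h' k d n) * (1 / real n)) / real n"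
      using D(4) D'(4) in_range_mono[OF *, of D k] in_range_mono[OF *, of D' k] 
      by (simp add: algebra_simps add_divide_distrib)
  qed (use D in simp)
qed

lemma expandable_sum [intro]:
  "(\<And>i. i \<in> A \<Longrightarrow> expandable t (f i)) \<Longrightarrow> expandable t (\<lambda>k d n. \<Sum>i\<in>A. f i k d n)"
  by (induction A rule: infinite_finite_induct) auto

lemma expandable_power [intro]: "expandable t f \<Longrightarrow> expandable t (\<lambda>k d n. f k d n ^ m)"
  by (induction m) auto

lemma expandable_coeff [intro]: "poly_growth c \<Longrightarrow> expandable t (\<lambda>k d n. c d)"
  by (intro expandable_newton_poly newton_poly_coeff)

text \<open>Needed for recurrences that sum over all smaller \<open>k\<close>. It works because the
  range condition passes to smaller \<open>k\<close> and Newton polynomials are closed under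
  summation over \<open>i < k\<close>.\<close>

lemma expandable_cumsum:
  "expandable t f \<Longrightarrow> expandable t (\<lambda>k d n. \<Sum>i<k. f i d n)"
proof (induction t arbitrary: f)
  case 0
  then obtain C K D where D: "C \<ge> 0" "D > 0"
    "\<And>k d n. in_range D k d n \<Longrightarrow> \<bar>f k d n\<bar> \<le> C * real (k + d + 1) ^ K"
    by auto
  have "\<bar>\<Sum>i<k. f i d n\<bar> \<le> C * real (k + d + 1) ^ Suc K" if *: "in_range D k d n" for k d n
  proof -
    have "\<bar>\<Sum>i<k. f i d n\<bar> \<le> (\<Sum>i<k. \<bar>f i d n\<bar>)" by (rule sum_abs)
    also have "\<dots> \<le> (\<Sum>i<k. C * real (k + d + 1) ^ K)"
    proof (rule sum_mono)
      fix i assume "i \<in> {..<k}"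
      then have "\<bar>f i d n\<bar> \<le> C * real (i + d + 1) ^ K" using D(3) in_range_mono[OF *, of D i] by simp
      also have "\<dots> \<le> C * real (k + d + 1) ^ K" using D(1) \<open>i \<in> {..<k}\<close>
        by (intro mult_left_mono power_mono) auto
      finally show "\<bar>f i d n\<bar> \<le> C * real (k + d + 1) ^ K" .
    qed
    also have "\<dots> = real k * (C * real (k + d + 1) ^ K)" by simp
    also have "\<dots> \<le> real (k + d + 1) * (C * real (k + d + 1) ^ K)" using D(1)
      by (intro mult_right_mono) auto
    finally show ?thesis by (simp add: mult_ac)
  qed
  then show ?case using D by (intro expandable_0I[of C D])
next
  case (Suc t)
  obtain r h D where D: "D > 0" "newton_poly r" "expandable t h"
    "\<And>k d n. in_range D k d n \<Longrightarrow> f k d n = r k d + h k d n / real n" using Suc.prems(1) by auto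
  show ?case
  proof (rule expandable_SucI[where D = D])
    show "newton_poly (\<lambda>k d. \<Sum>i<k. r i d)" using D newton_poly_cumsum by blast
    show "expandable t (\<lambda>k d n. \<Sum>i<k. h i d n)" using D Suc.IH by blast
    fix k d n assume *: "in_range D k d n"
    have "(\<Sum>i<k. f i d n) = (\<Sum>i<k. r i d + h i d n / real n)"
      using in_range_mono[OF *, of D] by (intro sum.cong) (auto simp: D(4))
    then show "(\<Sum>i<k. f i d n) = (\<Sum>i<k. r i d) + (\<Sum>i<k. h i d n) / real n"
      by (simp add: sum.distrib sum_divide_distrib)
  qed (use D in simp)
qed

lemma expandable_expansion:
  assumes "expandable t f"
  obtains r C K D where "\<And>i. newton_poly (r i)" "C \<ge> 0" "D > 0"
    "\<And>k d n. in_range D k d n \<Longrightarrow>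
       \<bar>f k d n - (\<Sum>i<t. r i k d / real n ^ i)\<bar> \<le> C * real (k + d + 1) ^ K / real n ^ t"
proof -
  have "\<exists>r C K D. (\<forall>i. newton_poly (r i)) \<and> C \<ge> 0 \<and> D > 0 \<and>
    (\<forall>k d n. in_range D k d n \<longrightarrow>
       \<bar>f k d n - (\<Sum>i<t. r i k d / real n ^ i)\<bar> \<le> C * real (k + d + 1) ^ K / real n ^ t)"
    using assms
  proof (induction t arbitrary: f)
    case 0
    then obtain C K D where D: "C \<ge> 0" "D > 0"
      "\<And>k d n. in_range D k d n \<Longrightarrow> \<bar>f k d n\<bar> \<le> C * real (k + d + 1) ^ K"
      by auto
    show ?case
      by (rule exI[of _ "\<lambda>_ _ _. 0"], rule exI[of _ C], rule exI[of _ K], rule exI[of _ D])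
        (use D in \<open>auto intro: newton_poly_coeff\<close>)
  next
    case (Suc t)
    obtain r0 h D' where D': "D' > 0" "newton_poly r0" "expandable t h"
      "\<And>k d n. in_range D' k d n \<Longrightarrow> f k d n = r0 k d + h k d n / real n" using Suc.prems(1) by auto
    obtain r C K D where D: "\<And>i. newton_poly (r i)" "C \<ge> 0" "D > 0"
      "\<And>k d n. in_range D k d n \<Longrightarrow>
         \<bar>h k d n - (\<Sum>i<t. r i k d / real n ^ i)\<bar> \<le> C * real (k + d + 1) ^ K / real n ^ t"
      using Suc.IH[OF D'(3)] by blast
    let ?r = "\<lambda>i. case i of 0 \<Rightarrow> r0 | Suc j \<Rightarrow> r j"
    show ?case
    proof (rule exI[of _ ?r], rule exI[of _ C], rule exI[of _ K], rule exI[of _ "D + D'"], intro conjI allI impI)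
      show "newton_poly (?r i)" for i using D D' by (cases i) auto
      fix k d n assume *: "in_range (D + D') k d n"
      have n: "n > 0" using in_range_imp_ge(3)[OF *] D by simp
      have "f k d n - (\<Sum>i<Suc t. ?r i k d / real n ^ i) =
        (h k d n - (\<Sum>i<t. r i k d / real n ^ i)) / real n"
        unfolding sum.lessThan_Suc_shift using D'(4)[OF in_range_mono[OF *]] 
        by (simp add: diff_divide_distrib sum_divide_distrib mult.commute)
      then have "\<bar>f k d n - (\<Sum>i<Suc t. ?r i k d / real n ^ i)\<bar> =
        \<bar>h k d n - (\<Sum>i<t. r i k d / real n ^ i)\<bar> / real n" by simp
      also have "\<dots> \<le> (C * real (k + d + 1) ^ K / real n ^ t) / real n"
        using in_range_mono[OF *, of D k] by (intro divide_right_mono D(4)) auto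
      finally show "\<bar>f k d n - (\<Sum>i<Suc t. ?r i k d / real n ^ i)\<bar> \<le> C * real (k + d + 1) ^ K / real n ^ Suc t"
        by (simp add: mult.commute)
    qed (use D in auto)
  qed
  then show thesis using that by blast
qed

section \<open>Permutations with prescribed successions\<close>

text \<open>A disjoint union of directed paths, given by its arcs. On a finite vertex set these are
  exactly the arc sets that can occur among the successions of a permutation.\<close>

definition linear_forest :: "('a \<times> 'a) set \<Rightarrow> bool" where
  "linear_forest R \<longleftrightarrow> single_valued R \<and> single_valued (R\<inverse>) \<and> acyclic R"

definition successions :: "'a list \<Rightarrow> ('a \<times> 'a) set" where
  "successions xs = set (zip xs (tl xs))"

lemma linear_forest_subset: "linear_forest R \<Longrightarrow> S \<subseteq> R \<Longrightarrow> linear_forest S"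
  unfolding linear_forest_def
  using acyclic_subset[of R S] single_valued_subset[of S R] single_valued_subset[of "S\<inverse>" "R\<inverse>"]
  by simp

lemma in_successions_iff:
  "(x, y) \<in> successions xs \<longleftrightarrow> (\<exists>i. Suc i < length xs \<and> x = xs ! i \<and> y = xs ! Suc i)"
  unfolding successions_def in_set_zip by (auto simp: nth_tl less_diff_conv)

lemma successions_simps [simp]:
  "successions [] = {}" "successions [x] = {}"
  "successions (x # y # xs) = insert (x, y) (successions (y # xs))"
  by (auto simp: successions_def)

lemma successions_append_Cons:
  "successions (us @ x # vs) = successions (us @ [x]) \<union> successions (x # vs)"
proof (induction us)
  case (Cons u us)
  then show ?case by (cases us) auto
qed simp

lemma successions_subset_set: "successions xs \<subseteq> set xs \<times> set xs"
  by (auto simp: in_successions_iff)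

lemma linear_forest_successions:
  assumes "distinct xs" shows "linear_forest (successions xs)"
proof -
  have "single_valued (successions xs)" "single_valued ((successions xs)\<inverse>)"
    using assms by (auto simp: single_valued_def in_successions_iff nth_eq_iff_index_eq)
  moreover have "acyclic (successions xs)"
    using assms
  proof (induction xs rule: induct_list012)
    case (3 x y zs)
    have "(y, x) \<notin> (successions (y # zs))\<^sup>*"
    proof
      assume "(y, x) \<in> (successions (y # zs))\<^sup>*"
      then have "x = y \<or> x \<in> Range (successions (y # zs))"
        by (auto elim: rtranclE)
      then show False using 3(3) successions_subset_set[of "y # zs"] by auto
    qed
    then show ?case using 3 by simp
  qed (auto simp: acyclic_def)
  ultimately show ?thesis by (simp add: linear_forest_def)
qed

text \<open>The vertex is chosen minimal for the converse relation within \<open>Range R\<close>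
  rather than within the whole field, so that it comes with a predecessor; a successor of it would
  again lie in the range and contradict minimality.\<close>

lemma linear_forest_obtain_leaf:
  assumes "linear_forest R" "finite R" "R \<noteq> {}"
  obtains x y where "(x, y) \<in> R" "y \<notin> Domain R"
proof -
  have wf: "wf (R\<inverse>)" using assms finite_acyclic_wf_converse linear_forest_def by blast
  obtain y0 where "y0 \<in> Range R" using assms(3) by auto
  then obtain y where y: "y \<in> Range R" "\<And>z. (z, y) \<in> R\<inverse> \<Longrightarrow> z \<notin> Range R"
    using wfE_min[OF wf] by metis
  then show thesis using that by blast
qed

text \<open>Deleting a leaf \<open>y\<close> of the forest from the list is a bijection, because the position
  of \<open>y\<close> is forced to be the one right after its predecessor.\<close>

lemma card_permutations_with_successions:
  assumes "finite V" "R \<subseteq> V \<times> V" "linear_forest R"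
  shows "card {xs \<in> permutations_of_set V. R \<subseteq> successions xs} = fact (card V - card R)"
  using assms
proof (induction "card R" arbitrary: R V)
  case 0
  then have "R = {}" using finite_subset by fastforce
  then show ?case using 0 by simp
next
  case (Suc k)
  have finR: "finite R" using Suc.prems by (meson finite_SigmaI finite_subset)
  then obtain x y where xy: "(x, y) \<in> R" "y \<notin> Domain R"
    using linear_forest_obtain_leaf Suc.prems(3) Suc.hyps(2) by (metis card.empty nat.distinct(1))
  have sv: "\<And>a b c. (a, b) \<in> R \<Longrightarrow> (a, c) \<in> R \<Longrightarrow> b = c"
      "\<And>a b c. (b, a) \<in> R \<Longrightarrow> (c, a) \<in> R \<Longrightarrow> b = c"
    using Suc.prems(3) unfolding linear_forest_def single_valued_def by blast+
  have "x \<noteq> y" using xy by blast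
  define R' V' where "R' = R - {(x, y)}" and "V' = V - {y}"
  have yV: "y \<in> V" and xV': "x \<in> V'" using xy Suc.prems(2) \<open>x \<noteq> y\<close> by (auto simp: V'_def)
  have R'V': "R' \<subseteq> V' \<times> V'"
    using Suc.prems(2) xy sv by (auto simp: R'_def V'_def)
  have xR': "x \<notin> Domain R'" using xy sv by (auto simp: R'_def)
  have yR': "y \<notin> Domain R'" "y \<notin> Range R'" using R'V' by (auto simp: V'_def)
  have cR': "card R' = k" using Suc.hyps(2) xy finR by (simp add: R'_def)
  have cV': "card V' = card V - 1" using yV Suc.prems(1) by (simp add: V'_def)
  have "finite V'" "linear_forest R'"
    using Suc.prems linear_forest_subset[of R R'] by (auto simp: R'_def V'_def)
  then have IH: "card {xs \<in> permutations_of_set V'. R' \<subseteq> successions xs} = fact (card V' - card R')"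
    using Suc.hyps(1)[OF cR'[symmetric]] R'V' by blast
  let ?A = "{xs \<in> permutations_of_set V. R \<subseteq> successions xs}"
  let ?A' = "{xs \<in> permutations_of_set V'. R' \<subseteq> successions xs}"
  have split: "\<exists>us vs. xs = us @ x # y # vs" if "xs \<in> ?A" for xs
  proof -
    have "(x, y) \<in> successions xs" using that xy by blast
    then obtain i where "Suc i < length xs" "x = xs ! i" "y = xs ! Suc i"
      by (auto simp: in_successions_iff)
    then have "xs = take i xs @ x # y # drop (Suc (Suc i)) xs"
      by (metis Cons_nth_drop_Suc Suc_lessD append_take_drop_id)
    then show ?thesis by blast
  qed
  have "bij_betw (remove1 y) ?A ?A'"
  proof (rule bij_betwI')
    fix xs xs' assume "xs \<in> ?A" "xs' \<in> ?A"
    then obtain us vs us' vs' where *: "xs = us @ x # y # vs" "xs' = us' @ x # y # vs'"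
      using split by meson
    have d: "distinct xs" "distinct xs'"
      using \<open>xs \<in> ?A\<close> \<open>xs' \<in> ?A\<close> by (auto dest: permutations_of_setD)
    then show "(remove1 y xs = remove1 y xs') = (xs = xs')"
      using * by (auto simp: remove1_append append_Cons_eq_iff)
  next
    fix xs assume xs: "xs \<in> ?A"
    then obtain us vs where *: "xs = us @ x # y # vs" using split by blast
    have d: "distinct xs" and s: "set xs = V" and R: "R \<subseteq> successions xs"
      using xs by (auto dest: permutations_of_setD)
    have rem: "remove1 y xs = us @ x # vs" using d * by (auto simp: remove1_append)
    have "set (remove1 y xs) = V'" using d s by (simp add: V'_def)
    moreover have "R' \<subseteq> successions (us @ x # vs)"
    proof
      fix e assume e: "e \<in> R'"
      then have "e \<in> successions (us @ x # y # vs)" using R * by (auto simp: R'_def)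
      then have "e \<in> successions (us @ [x]) \<or> e \<in> successions (y # vs)"
        using e by (subst (asm) successions_append_Cons) (auto simp: R'_def)
      then show "e \<in> successions (us @ x # vs)"
        using e yR' by (subst successions_append_Cons) (cases vs; auto)
    qed
    moreover have "distinct (remove1 y xs)" using d by simp
    ultimately show "remove1 y xs \<in> ?A'"
      using permutations_of_setI[of "remove1 y xs" V'] by (simp only: rem mem_Collect_eq simp_thms)
  next
    fix ys assume ys: "ys \<in> ?A'"
    have d: "distinct ys" and s: "set ys = V'" and R: "R' \<subseteq> successions ys"
      using ys by (auto dest: permutations_of_setD)
    obtain us vs where *: "ys = us @ x # vs" using split_list[of x ys] xV' s by blast
    let ?xs = "us @ x # y # vs"
    have y: "y \<notin> set ys" using s by (simp add: V'_def)
    have "distinct ?xs" using d * y by auto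
    moreover have "set ?xs = V" using s * yV by (auto simp: V'_def)
    moreover have "R \<subseteq> successions ?xs"
    proof
      fix e assume e: "e \<in> R"
      show "e \<in> successions ?xs"
      proof (cases "e = (x, y)")
        case False
        then have "e \<in> R'" using e by (simp add: R'_def)
        then have "e \<in> successions (us @ [x]) \<or> e \<in> successions (x # vs)" "fst e \<noteq> x"
          using R * xR' by (auto simp: successions_append_Cons[of us x vs] Domain_fst)
        then show ?thesis
          unfolding successions_append_Cons[of us x "y # vs"] by (cases vs) auto
      next
        case True
        then show ?thesis unfolding successions_append_Cons[of us x "y # vs"] by simp
      qed
    qed
    moreover have "ys = remove1 y ?xs" using y * by (auto simp: remove1_append)
    ultimately show "\<exists>xs\<in>?A. ys = remove1 y xs"
      by (intro bexI[of _ ?xs]) (simp_all add: permutations_of_setI)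
  qed
  then have "card ?A = card ?A'" by (rule bij_betw_same_card)
  also have "\<dots> = fact (card V - card R)"
    unfolding IH cV' cR' by (metis Suc.hyps(2) diff_diff_left plus_1_eq_Suc)
  finally show ?case .
qed

text \<open>Double counting of pairs of a list and a \<open>k\<close>-set \<open>R\<close> of its
  successions in \<open>E\<close>. A set that is not a linear forest is contained in no list,
  because the successions of a distinct list form a single directed path; each linear forest
  contributes the same factorial.\<close>

lemma sum_choose_successions:
  assumes "finite V" "E \<subseteq> V \<times> V"
  shows "(\<Sum>xs\<in>permutations_of_set V. card (successions xs \<inter> E) choose k) =
    card {R. R \<subseteq> E \<and> card R = k \<and> linear_forest R} * fact (card V - k)"
proof -
  let ?P = "permutations_of_set V" and ?Q = "{R. R \<subseteq> E \<and> card R = k}"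
  have finE: "finite E" using assms by (meson finite_SigmaI finite_subset)
  then have finQ: "finite ?Q" by simp
  have "(\<Sum>xs\<in>?P. card (successions xs \<inter> E) choose k) =
        (\<Sum>xs\<in>?P. card {R \<in> ?Q. R \<subseteq> successions xs})"
  proof (rule sum.cong)
    fix xs
    have "{R \<in> ?Q. R \<subseteq> successions xs} = {R. R \<subseteq> successions xs \<inter> E \<and> card R = k}" by auto
    then show "card (successions xs \<inter> E) choose k = card {R \<in> ?Q. R \<subseteq> successions xs}"
      using n_subsets[of "successions xs \<inter> E" k] finE by simp
  qed simp
  also have "\<dots> = (\<Sum>xs\<in>?P. \<Sum>R\<in>?Q. if R \<subseteq> successions xs then 1 else 0)"
    by (simp add: finQ sum.If_cases Int_def conj_commute)
  also have "\<dots> = (\<Sum>R\<in>?Q. \<Sum>xs\<in>?P. if R \<subseteq> successions xs then 1 else 0)"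
    by (rule sum.swap)
  also have "\<dots> = (\<Sum>R\<in>?Q. card {xs \<in> ?P. R \<subseteq> successions xs})"
    by (simp add: sum.If_cases Int_def)
  also have "\<dots> = (\<Sum>R\<in>?Q. if linear_forest R then fact (card V - k) else 0)"
  proof (rule sum.cong)
    fix R assume R: "R \<in> ?Q"
    show "card {xs \<in> ?P. R \<subseteq> successions xs} = (if linear_forest R then fact (card V - k) else 0)"
    proof (cases "linear_forest R")
      case True
      then show ?thesis using card_permutations_with_successions[of V R] assms R by auto
    next
      case False
      then have "{xs \<in> ?P. R \<subseteq> successions xs} = {}"
        using linear_forest_subset linear_forest_successions permutations_of_setD(2) by blast
      then show ?thesis using False by (metis card.empty)
    qed
  qed simp
  also have "\<dots> = card {R. R \<subseteq> E \<and> card R = k \<and> linear_forest R} * fact (card V - k)"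
    using finQ by (simp add: sum.If_cases Int_def conj_assoc)
  finally show ?thesis .
qed

text \<open>For \<open>x = Suc y\<close> the truncated sum telescopes by Pascal's rule to
  \<open>(-1) ^ J * (y choose J)\<close> with \<open>K = Suc J\<close>, and
  \<open>y choose J\<close> is at most \<open>Suc y choose Suc J\<close>. So the first omitted term
  bounds the error for either parity of \<open>K\<close>.\<close>

lemma bonferroni_binomial:
  "\<bar>of_bool (x = 0) - (\<Sum>k<K. (-1) ^ k * real (x choose k))\<bar> \<le> real (x choose K)"
proof (cases x)
  case 0
  have "(\<Sum>k<K. (-1) ^ k * real (0 choose k)) = (\<Sum>k<K. if k = 0 then 1 else 0)"
    by (intro sum.cong) auto
  then show ?thesis using 0 by (cases K) auto
next
  case (Suc y)
  have alt: "(\<Sum>k<Suc J. (-1) ^ k * real (Suc y choose k)) = (-1) ^ J * real (y choose J)" for J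
    by (induction J) (auto simp: algebra_simps)
  show ?thesis
  proof (cases K)
    case (Suc J)
    show ?thesis unfolding Suc \<open>x = Suc y\<close> alt by (simp add: abs_mult)
  qed simp
qed

section \<open>From the minimum jump to counts of forests of short edges\<close>

definition short_edges :: "nat \<Rightarrow> nat set \<Rightarrow> (nat \<times> nat) set" where
  "short_edges d V = {(x, y). x \<in> V \<and> y \<in> V \<and> x \<noteq> y \<and> \<bar>int x - int y\<bar> \<le> int d}"

definition forests :: "nat \<Rightarrow> nat \<Rightarrow> nat set \<Rightarrow> (nat \<times> nat) set set" where
  "forests d k V = {R. R \<subseteq> short_edges d V \<and> card R = k \<and> linear_forest R}"

lemma short_edges_subset: "short_edges d V \<subseteq> V \<times> V"
  by (auto simp: short_edges_def)

lemma finite_short_edges [simp, intro]: "finite V \<Longrightarrow> finite (short_edges d V)"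
  using short_edges_subset by (meson finite_SigmaI finite_subset)

lemma finite_forests [simp, intro]: "finite V \<Longrightarrow> finite (forests d k V)"
  unfolding forests_def by (rule finite_subset[of _ "Pow (short_edges d V)"]) auto

lemma permutations_of_set_atLeastAtMost:
  "bij_betw (\<lambda>p. map p [1..<Suc n]) {p. p permutes {1..n}} (permutations_of_set {1..n})"
proof -
  let ?f = "\<lambda>p :: nat \<Rightarrow> nat. map p [1..<Suc n]" and ?P = "{p. p permutes {1..n}}"
  have inj: "inj_on ?f ?P"
  proof (rule inj_onI)
    fix p q assume p: "p \<in> ?P" "q \<in> ?P" "?f p = ?f q"
    then have "\<forall>i\<in>{1..n}. p i = q i" by (simp add: atLeastLessThanSuc_atLeastAtMost del: upt_Suc)
    then show "p = q" using p by (metis ext mem_Collect_eq permutes_def)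
  qed
  have "?f ` ?P \<subseteq> permutations_of_set {1..n}"
  proof (clarify, rule permutations_of_setI)
    fix p assume p: "p permutes {1..n}"
    show "set (?f p) = {1..n}" using permutes_image[OF p]
      by (simp add: atLeastLessThanSuc_atLeastAtMost del: upt_Suc)
    show "distinct (?f p)" using permutes_inj_on[OF p]
      by (simp add: distinct_map del: upt_Suc)
  qed
  moreover have "card (?f ` ?P) = card (permutations_of_set {1..n})"
    using card_image[OF inj] card_permutations[of "{1..n}" n] by simp
  ultimately have "?f ` ?P = permutations_of_set {1..n}"
    by (intro card_subset_eq) auto
  with inj show ?thesis by (simp add: bij_betw_def)
qed

lemma min_jump_ge_iff:
  assumes "n \<ge> 2" "p permutes {1..n}"
  shows "min_jump n p \<ge> d + 1 \<longleftrightarrow> successions (map p [1..<Suc n]) \<inter> short_edges d {1..n} = {}"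
proof -
  let ?J = "{nat \<bar>int (p (i+1)) - int (p i)\<bar> | i. 1 \<le> i \<and> i \<le> n - 1}"
  have "?J = (\<lambda>i. nat \<bar>int (p (i+1)) - int (p i)\<bar>) ` {1..n-1}" by auto
  then have J: "finite ?J" "?J \<noteq> {}" using assms(1) by auto
  have nth: "map p [1..<Suc n] ! j = p (Suc j)" if "j < n" for j
    using that by (simp del: upt_Suc)
  have len: "length (map p [1..<Suc n]) = n" by simp
  have succ: "(x, y) \<in> successions (map p [1..<Suc n]) \<longleftrightarrow> (\<exists>i. 1 \<le> i \<and> i \<le> n - 1 \<and> x = p i \<and> y = p (i + 1))" for x y
  proof
    assume "(x, y) \<in> successions (map p [1..<Suc n])"
    then obtain j where "Suc j < n" "x = p (Suc j)" "y = p (Suc (Suc j))"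
      unfolding in_successions_iff len using nth by (metis Suc_lessD)
    then show "\<exists>i. 1 \<le> i \<and> i \<le> n - 1 \<and> x = p i \<and> y = p (i + 1)"
      by (intro exI[of _ "Suc j"]) auto
  next
    assume "\<exists>i. 1 \<le> i \<and> i \<le> n - 1 \<and> x = p i \<and> y = p (i + 1)"
    then obtain i where i: "1 \<le> i" "i \<le> n - 1" "x = p i" "y = p (i + 1)" by blast
    then have "Suc (i - 1) < n" using assms(1) by linarith
    then show "(x, y) \<in> successions (map p [1..<Suc n])"
      unfolding in_successions_iff len using i nth[of "i - 1"] nth[of i]
      by (intro exI[of _ "i - 1"]) simp
  qed
  have in_V: "p i \<in> {1..n}" "p (i + 1) \<in> {1..n}" "p i \<noteq> p (i + 1)" if "1 \<le> i" "i \<le> n - 1" for i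
  proof -
    show "p i \<in> {1..n}" "p (i + 1) \<in> {1..n}" 
      using that assms(1) permutes_in_image[OF assms(2)] by auto
    show "p i \<noteq> p (i + 1)" using permutes_inj[OF assms(2)] by (metis injD n_not_Suc_n Suc_eq_plus1)
  qed
  have "min_jump n p \<ge> d + 1 \<longleftrightarrow> (\<forall>i. 1 \<le> i \<and> i \<le> n - 1 \<longrightarrow> d + 1 \<le> nat \<bar>int (p (i+1)) - int (p i)\<bar>)"
    unfolding min_jump_def using J by (subst Min_ge_iff) auto
  also have "\<dots> \<longleftrightarrow> (\<forall>i. 1 \<le> i \<and> i \<le> n - 1 \<longrightarrow> (p i, p (i + 1)) \<notin> short_edges d {1..n})"
    using in_V by (auto simp: short_edges_def)
  also have "\<dots> \<longleftrightarrow> successions (map p [1..<Suc n]) \<inter> short_edges d {1..n} = {}"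
    using succ by (auto simp del: upt_Suc)
  finally show ?thesis .
qed

text \<open>The pointwise Bonferroni bound, averaged over all permutations: the average of each
  binomial coefficient is a binomial moment, known from the double counting.\<close>

lemma prob_mj_ge_bonferroni:
  assumes "n \<ge> 2"
  shows "\<bar>prob_mj_ge n (d + 1) - (\<Sum>k<K. (-1) ^ k * (real (card (forests d k {1..n})) * fact (n - k) / fact n))\<bar>
    \<le> real (card (forests d K {1..n})) * fact (n - K) / fact n"
proof -
  let ?P = "permutations_of_set {1..n}"
  let ?X = "\<lambda>xs. card (successions xs \<inter> short_edges d {1..n})"
  have moment: "(\<Sum>xs\<in>?P. real (?X xs choose k)) = real (card (forests d k {1..n})) * fact (n - k)" for k
  proof -
    have "(\<Sum>xs\<in>?P. ?X xs choose k) = card (forests d k {1..n}) * fact (n - k)"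
      using sum_choose_successions[of "{1..n}" "short_edges d {1..n}" k] short_edges_subset
      by (simp add: forests_def)
    then have "real (\<Sum>xs\<in>?P. ?X xs choose k) = real (card (forests d k {1..n}) * fact (n - k))" by (rule arg_cong)
    then show ?thesis by simp
  qed
  have "bij_betw (\<lambda>p. map p [1..<Suc n]) {p \<in> {p. p permutes {1..n}}. min_jump n p \<ge> d + 1} {xs \<in> ?P. ?X xs = 0}"
  proof (rule bij_betw_Collect[OF permutations_of_set_atLeastAtMost])
    fix p assume "p \<in> {p. p permutes {1..n}}"
    then show "(?X (map p [1..<Suc n]) = 0) = (min_jump n p \<ge> d + 1)"
      using min_jump_ge_iff[OF assms, of p d] by (simp del: upt_Suc)
  qed
  then have "card {p. p permutes {1..n} \<and> min_jump n p \<ge> d + 1} = card {xs \<in> ?P. ?X xs = 0}"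
    using bij_betw_same_card by fastforce
  then have prob: "prob_mj_ge n (d + 1) = (\<Sum>xs\<in>?P. of_bool (?X xs = 0)) / fact n"
    unfolding prob_mj_ge_def by (simp add: Int_def)
  have "(\<Sum>k<K. (-1) ^ k * (real (card (forests d k {1..n})) * fact (n - k) / fact n)) =
    (\<Sum>k<K. (-1) ^ k * (\<Sum>xs\<in>?P. real (?X xs choose k))) / fact n"
    by (simp only: moment sum_divide_distrib times_divide_eq_right)
  also have "(\<Sum>k<K. (-1) ^ k * (\<Sum>xs\<in>?P. real (?X xs choose k))) =
    (\<Sum>xs\<in>?P. \<Sum>k<K. (-1) ^ k * real (?X xs choose k))"
    unfolding sum_distrib_left by (rule sum.swap)
  finally have "prob_mj_ge n (d + 1) - (\<Sum>k<K. (-1) ^ k * (real (card (forests d k {1..n})) * fact (n - k) / fact n)) =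
    (\<Sum>xs\<in>?P. of_bool (?X xs = 0) - (\<Sum>k<K. (-1) ^ k * real (?X xs choose k))) / fact n"
    unfolding prob by (simp add: sum_subtractf diff_divide_distrib)
  also have "\<bar>\<dots>\<bar> \<le> (\<Sum>xs\<in>?P. real (?X xs choose K)) / fact n"
    by (simp only: abs_divide fact_gt_zero abs_of_pos)
      (intro divide_right_mono order_trans[OF sum_abs] sum_mono bonferroni_binomial; simp)
  finally show ?thesis by (simp only: moment)
qed

section \<open>Invariance of forests under relabelling of the vertices\<close>

lemma acyclic_map_prod_image:
  assumes "acyclic R" "inj_on f (Field R)"
  shows "acyclic (map_prod f f ` R)"
proof (rule acyclicI, rule allI, rule notI)
  fix a assume a: "(a, a) \<in> (map_prod f f ` R)\<^sup>+"
  have "\<exists>x y. a = f x \<and> b = f y \<and> (x, y) \<in> R\<^sup>+" if "(a, b) \<in> (map_prod f f ` R)\<^sup>+" for a b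
    using that
  proof (induction rule: trancl_induct)
    case (base b)
    then show ?case by auto
  next
    case (step b c)
    then obtain x y u v where *: "a = f x" "b = f y" "(x, y) \<in> R\<^sup>+" "b = f u" "c = f v" "(u, v) \<in> R"
      by auto
    have "y \<in> Field R" "u \<in> Field R"
      using *(3,6) trancl_subset_Field2[of R] by (auto simp: Field_def elim: tranclE)
    then have "y = u" using assms(2) * by (metis inj_onD)
    then show ?case using * by (metis trancl.trancl_into_trancl)
  qed
  from this[OF a] obtain x y where *: "f x = f y" "(x, y) \<in> R\<^sup>+" by metis
  have "x \<in> Field R" "y \<in> Field R"
    using *(2) by (auto simp: Field_def elim: tranclE dest: tranclD)
  then have "x = y" using assms(2) * by (metis inj_onD)
  then show False using assms(1) * by (auto simp: acyclic_def)
qed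

lemma linear_forest_map_prod_image:
  assumes "linear_forest R" "inj_on f (Field R)"
  shows "linear_forest (map_prod f f ` R)"
proof -
  have "single_valued (map_prod f f ` R)" "single_valued ((map_prod f f ` R)\<inverse>)"
    using assms unfolding linear_forest_def single_valued_def
    by (auto simp: Field_def inj_on_def) (metis DomainI RangeI UnI1 UnI2)+
  then show ?thesis using assms acyclic_map_prod_image by (auto simp: linear_forest_def)
qed

text \<open>Forests of short edges depend only on which pairs of vertices are within distance
  \<open>d\<close>. This serves both to translate \<open>{..<n}\<close> to \<open>{1..n}\<close> and
  to widen a gap that no short edge can bridge.\<close>

lemma forests_relabel:
  assumes inj: "inj_on f V"
    and close: "\<And>x y. x \<in> V \<Longrightarrow> y \<in> V \<Longrightarrow> \<bar>int (f x) - int (f y)\<bar> \<le> int d \<longleftrightarrow> \<bar>int x - int y\<bar> \<le> int d"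
  shows "bij_betw (\<lambda>R. map_prod f f ` R) (forests d k V) (forests d k (f ` V))"
proof -
  define g where "g = inv_into V f"
  have g: "\<And>x. x \<in> V \<Longrightarrow> g (f x) = x" using inj by (simp add: g_def)
  have injg: "inj_on g (f ` V)" using g by (auto simp: inj_on_def)
  have sub: "R \<subseteq> V \<times> V" if "R \<in> forests d k V" for R V
    using that short_edges_subset[of d V] by (auto simp: forests_def)
  \<comment> \<open>Proved for arbitrary \<open>f\<close> and \<open>V\<close> since it is applied
    both to \<open>f\<close> and to its inverse \<open>g\<close>.\<close>
  have fwd: "map_prod f f ` R \<in> forests d k (f ` V)" 
    if inj: "inj_on f V" and close: "\<And>x y. x \<in> V \<Longrightarrow> y \<in> V \<Longrightarrow> \<bar>int (f x) - int (f y)\<bar> \<le> int d \<longleftrightarrow> \<bar>int x - int y\<bar> \<le> int d"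
      and R: "R \<in> forests d k V" for f V R
  proof -
    have "inj_on (map_prod f f) R"
      using map_prod_inj_on[OF inj inj] sub[OF R] by (rule inj_on_subset)
    then have "card (map_prod f f ` R) = k" using R by (simp add: card_image forests_def)
    moreover have "linear_forest (map_prod f f ` R)"
      using linear_forest_map_prod_image[of R f] R inj sub[OF R]
      by (auto simp: forests_def Field_def inj_on_def)
    moreover have "map_prod f f ` R \<subseteq> short_edges d (f ` V)"
      using R close inj by (auto simp: forests_def short_edges_def inj_on_def)
    ultimately show ?thesis by (simp add: forests_def)
  qed
  have gfV: "g ` f ` V = V" using g by force
  have closeg: "\<bar>int (g x) - int (g y)\<bar> \<le> int d \<longleftrightarrow> \<bar>int x - int y\<bar> \<le> int d"
    if "x \<in> f ` V" "y \<in> f ` V" for x y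
    using that close g by auto
  show ?thesis
  proof (rule bij_betw_byWitness[where f' = "\<lambda>R. map_prod g g ` R"])
    show "\<forall>R\<in>forests d k V. map_prod g g ` map_prod f f ` R = R"
    proof
      fix R assume "R \<in> forests d k V"
      then have "R \<subseteq> V \<times> V" by (rule sub)
      then have "\<And>e. e \<in> R \<Longrightarrow> map_prod g g (map_prod f f e) = e" using g by force
      then show "map_prod g g ` map_prod f f ` R = R" by (simp add: image_image)
    qed
    show "\<forall>R\<in>forests d k (f ` V). map_prod f f ` map_prod g g ` R = R"
    proof
      fix R assume "R \<in> forests d k (f ` V)"
      then have "R \<subseteq> f ` V \<times> f ` V" by (rule sub)
      then have "\<And>e. e \<in> R \<Longrightarrow> map_prod f f (map_prod g g e) = e" using g by force
      then show "map_prod f f ` map_prod g g ` R = R" by (simp add: image_image)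
    qed
    show "(\<lambda>R. map_prod f f ` R) ` forests d k V \<subseteq> forests d k (f ` V)"
      using fwd[OF inj close] by auto
    show "(\<lambda>R. map_prod g g ` R) ` forests d k (f ` V) \<subseteq> forests d k V"
      using fwd[OF injg closeg] gfV by auto
  qed
qed

section \<open>The number of forests is eventually polynomial in n\<close>

text \<open>The \<open>r\<close>-th forward difference vanishes from \<open>N\<close> on, that is,
  \<open>f\<close> agrees there with a polynomial of degree below \<open>r\<close>. In terms of
  differences, shifts and cumulative sums are immediate: the difference of a cumulative sum is its
  summand.\<close>

fun eventually_fdiff_zero :: "nat \<Rightarrow> nat \<Rightarrow> (nat \<Rightarrow> real) \<Rightarrow> bool" where
  "eventually_fdiff_zero 0 N f \<longleftrightarrow> (\<forall>n\<ge>N. f n = 0)"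
| "eventually_fdiff_zero (Suc r) N f \<longleftrightarrow> eventually_fdiff_zero r N (\<lambda>n. f (Suc n) - f n)"

lemma eventually_fdiff_zero_cong:
  "eventually_fdiff_zero r N f \<Longrightarrow> (\<And>n. n \<ge> N \<Longrightarrow> g n = f n) \<Longrightarrow> eventually_fdiff_zero r N g"
proof (induction r arbitrary: f g)
  case (Suc r)
  show ?case using Suc.IH[of "\<lambda>n. f (Suc n) - f n" "\<lambda>n. g (Suc n) - g n"] Suc.prems by simp
qed simp

lemma eventually_fdiff_zero_mono:
  "eventually_fdiff_zero r N f \<Longrightarrow> N \<le> N' \<Longrightarrow> eventually_fdiff_zero r N' f"
  by (induction r arbitrary: f) auto

lemma eventually_fdiff_zero_Suc:
  "eventually_fdiff_zero r N f \<Longrightarrow> eventually_fdiff_zero (Suc r) N f"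
proof (induction r arbitrary: f)
  case (Suc r)
  from Suc.IH[OF Suc.prems[unfolded eventually_fdiff_zero.simps(2)]]
  show ?case by (rule eventually_fdiff_zero.simps(2)[THEN iffD2])
qed simp

lemma eventually_fdiff_zero_mono_order:
  "eventually_fdiff_zero r N f \<Longrightarrow> r \<le> r' \<Longrightarrow> eventually_fdiff_zero r' N f"
  by (rule dec_induct[where P = "\<lambda>i. eventually_fdiff_zero i N f"]) (auto intro: eventually_fdiff_zero_Suc simp del: eventually_fdiff_zero.simps)

lemma eventually_fdiff_zero_add:
  "eventually_fdiff_zero r N f \<Longrightarrow> eventually_fdiff_zero r N g \<Longrightarrow> eventually_fdiff_zero r N (\<lambda>n. f n + g n)"
proof (induction r arbitrary: f g)
  case (Suc r)
  then have "eventually_fdiff_zero r N (\<lambda>n. (f (Suc n) - f n) + (g (Suc n) - g n))" by simp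
  then show ?case by (simp add: algebra_simps)
qed simp

lemma eventually_fdiff_zero_0 [simp]: "eventually_fdiff_zero r N (\<lambda>n. 0)"
  by (induction r) auto

lemma eventually_fdiff_zero_sum:
  "(\<And>i. i \<in> A \<Longrightarrow> eventually_fdiff_zero r N (f i)) \<Longrightarrow> eventually_fdiff_zero r N (\<lambda>n. \<Sum>i\<in>A. f i n)"
  by (induction A rule: infinite_finite_induct) (auto intro: eventually_fdiff_zero_add)

lemma eventually_fdiff_zero_shift:
  "eventually_fdiff_zero r N f \<Longrightarrow> eventually_fdiff_zero r (N + m) (\<lambda>n. f (n - m))"
proof (induction r arbitrary: f)
  case 0
  then show ?case by auto
next
  case (Suc r)
  then have "eventually_fdiff_zero r (N + m) (\<lambda>n. f (Suc (n - m)) - f (n - m))" by simp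
  then have "eventually_fdiff_zero r (N + m) (\<lambda>n. f (Suc n - m) - f (n - m))"
    by (rule eventually_fdiff_zero_cong) (simp add: Suc_diff_le)
  then show ?case by simp
qed

lemma eventually_fdiff_zero_cumsum:
  "eventually_fdiff_zero r N f \<Longrightarrow> eventually_fdiff_zero (Suc r) N (\<lambda>n. \<Sum>j<n. f j)"
  by simp

text \<open>Newton's forward difference formula based at \<open>N\<close>. The bound is the reason
  for redoing it here: each difference at most doubles a bound valid at \<open>r + 1\<close>
  consecutive points, and this later makes the coefficients polynomially bounded in
  \<open>d\<close>.\<close>

lemma newton_forward:
  assumes "eventually_fdiff_zero r N f" "\<And>n. N \<le> n \<Longrightarrow> n \<le> N + r \<Longrightarrow> \<bar>f n\<bar> \<le> B"
  shows "\<exists>c. (\<forall>j. \<bar>c j\<bar> \<le> 2 ^ r * B) \<and> (\<forall>m. f (N + m) = (\<Sum>j<r. c j * real (m choose j)))"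
  using assms
proof (induction r arbitrary: f B)
  case 0
  then have "B \<ge> 0" by (metis abs_ge_zero add.right_neutral le_refl order_trans)
  then show ?case using 0 by (intro exI[of _ "\<lambda>_. 0"]) auto
next
  case (Suc r)
  have bound: "\<bar>f (Suc n) - f n\<bar> \<le> 2 * B" if "N \<le> n" "n \<le> N + r" for n
    using Suc.prems(2)[of n] Suc.prems(2)[of "Suc n"] that by linarith
  from Suc.prems(1) have "eventually_fdiff_zero r N (\<lambda>n. f (Suc n) - f n)" by simp
  from Suc.IH[OF this bound] obtain c where c: "\<And>j. \<bar>c j\<bar> \<le> 2 ^ r * (2 * B)"
    "\<And>m. f (Suc (N + m)) - f (N + m) = (\<Sum>j<r. c j * real (m choose j))" by blast
  have B0: "B \<ge> 0" using Suc.prems(2)[of N] by linarith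
  let ?c = "\<lambda>j. case j of 0 \<Rightarrow> f N | Suc i \<Rightarrow> c i"
  show ?case
  proof (rule exI[of _ ?c], intro conjI allI)
    fix j
    have "\<bar>f N\<bar> \<le> 1 * B" using Suc.prems(2)[of N] by simp
    also have "\<dots> \<le> 2 ^ Suc r * B" using B0 by (intro mult_right_mono) (auto simp del: power_Suc)
    finally show "\<bar>?c j\<bar> \<le> 2 ^ Suc r * B" using c(1) by (cases j) (auto simp: mult_ac)
  next
    fix m
    show "f (N + m) = (\<Sum>j<Suc r. ?c j * real (m choose j))"
    proof (induction m)
      case 0
      then show ?case unfolding sum.lessThan_Suc_shift by simp
    next
      case (Suc m)
      have "f (N + Suc m) = f (N + m) + (\<Sum>j<r. c j * real (m choose j))" using c(2)[of m] by simp
      then show ?case unfolding Suc sum.lessThan_Suc_shift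
        by (simp add: algebra_simps sum.distrib)
    qed
  qed
qed

text \<open>A nonzero top coefficient with index \<open>Suc J > a\<close> would contribute at least
  a constant times \<open>m ^ Suc J\<close>, whereas the lower binomials and the bound
  \<open>K * m ^ a\<close> are only of order \<open>m ^ J\<close>. Top terms are removed one after
  another.\<close>

lemma newton_coeff_zero:
  assumes "\<And>m. m \<ge> 1 \<Longrightarrow> \<bar>\<Sum>j\<le>J. c j * real (m choose j)\<bar> \<le> K * real m ^ a" "j \<le> J" "j > a"
  shows "c j = 0"
  using assms
proof (induction J)
  case (Suc J)
  have K0: "K \<ge> 0" using Suc.prems(1)[of 1] by simp
  have top: "c (Suc J) = 0"
  proof (rule ccontr)
    assume nz: "c (Suc J) \<noteq> 0"
    have aJ: "a \<le> J" using Suc.prems by simp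
    let ?K = "K + (\<Sum>j\<le>J. \<bar>c j\<bar>)"
    have main: "\<bar>c (Suc J)\<bar> * real m \<le> ?K * real (Suc J) ^ Suc J" if m: "m \<ge> Suc J" for m
    proof -
      have m1: "real m \<ge> 1" using m by simp
      have "\<bar>c (Suc J)\<bar> * (real m / real (Suc J)) ^ Suc J \<le> \<bar>c (Suc J)\<bar> * real (m choose Suc J)"
        using binomial_ge_n_over_k_pow_k[OF m, where 'a = real] by (intro mult_left_mono) auto
      also have "\<dots> = \<bar>(\<Sum>j\<le>Suc J. c j * real (m choose j)) - (\<Sum>j\<le>J. c j * real (m choose j))\<bar>"
        by (simp add: abs_mult)
      also have "\<dots> \<le> K * real m ^ a + (\<Sum>j\<le>J. \<bar>c j\<bar> * real (m choose j))"
      proof -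
        have "\<bar>\<Sum>j\<le>J. c j * real (m choose j)\<bar> \<le> (\<Sum>j\<le>J. \<bar>c j\<bar> * real (m choose j))"
          by (rule order_trans[OF sum_abs]) (simp add: abs_mult)
        then show ?thesis using Suc.prems(1)[of m] m1 by linarith
      qed
      also have "\<dots> \<le> K * real m ^ J + (\<Sum>j\<le>J. \<bar>c j\<bar> * real m ^ J)"
      proof (intro add_mono mult_left_mono sum_mono)
        show "real m ^ a \<le> real m ^ J" using m1 aJ by (rule power_increasing[rotated])
        fix j assume "j \<in> {..J}"
        then have "j \<le> m" "j \<le> J" using m by auto
        then have "real (m choose j) \<le> real m ^ j"
          by (metis binomial_le_pow of_nat_le_iff of_nat_power)
        also have "\<dots> \<le> real m ^ J" using m1 \<open>j \<le> J\<close> by (intro power_increasing)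
        finally show "real (m choose j) \<le> real m ^ J" .
      qed (use K0 in auto)
      also have "\<dots> = ?K * real m ^ J" by (simp add: distrib_right sum_distrib_right)
      finally have "\<bar>c (Suc J)\<bar> * (real m / real (Suc J)) ^ Suc J \<le> ?K * real m ^ J" .
      then have "\<bar>c (Suc J)\<bar> * real m * real m ^ J \<le> (?K * real (Suc J) ^ Suc J) * real m ^ J"
        unfolding power_divide times_divide_eq_right
        by (subst (asm) pos_divide_le_eq) (auto simp: mult_ac)
      then show ?thesis using m1 by (simp only: mult_le_cancel_right) auto
    qed
    obtain m0 :: nat where "real m0 > ?K * real (Suc J) ^ Suc J / \<bar>c (Suc J)\<bar>"
      using reals_Archimedean2 by blast
    then have "real (m0 + Suc J) > ?K * real (Suc J) ^ Suc J / \<bar>c (Suc J)\<bar>" by linarith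
    then have "?K * real (Suc J) ^ Suc J < \<bar>c (Suc J)\<bar> * real (m0 + Suc J)"
      using nz by (simp add: pos_divide_less_eq mult.commute)
    with main[of "m0 + Suc J"] show False by simp
  qed
  show ?case
  proof (cases "j = Suc J")
    case False
    then show ?thesis using Suc.IH Suc.prems top by simp
  qed (simp add: top)
qed simp

text \<open>Widening a gap of length more than \<open>D\<close> in the argument of \<open>h\<close>
  by one leaves the value unchanged. As \<open>A\<close> may be empty, this includes invariance
  under translation for finite sets contained in \<open>{D..}\<close>.\<close>

definition gap_local :: "nat \<Rightarrow> (nat set \<Rightarrow> real) \<Rightarrow> bool" where
  "gap_local D h \<longleftrightarrow> (\<forall>A B m. finite B \<longrightarrow> A \<subseteq> {..<m} \<longrightarrow> B \<subseteq> {m + D..} \<longrightarrow> h (A \<union> Suc ` B) = h (A \<union> B))"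

lemma gap_localD:
  "gap_local D h \<Longrightarrow> finite B \<Longrightarrow> A \<subseteq> {..<m} \<Longrightarrow> B \<subseteq> {m + D..} \<Longrightarrow> h (A \<union> Suc ` B) = h (A \<union> B)"
  unfolding gap_local_def by simp

definition subset_sum :: "nat \<Rightarrow> (nat set \<Rightarrow> real) \<Rightarrow> nat \<Rightarrow> real" where
  "subset_sum s h n = (\<Sum>S | S \<subseteq> {..<n} \<and> card S = s. h S)"

text \<open>The least element \<open>m\<close> is split off and the others are recorded relative to
  \<open>m + 1\<close>, so that the rest of a sum over subsets is again one over subsets of an
  initial segment.\<close>

definition after :: "nat \<Rightarrow> (nat set \<Rightarrow> real) \<Rightarrow> nat set \<Rightarrow> real" where
  "after m h S = h (insert m ((\<lambda>x. x + Suc m) ` S))"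

lemma subset_sum_split:
  "subset_sum (Suc s) h n = (\<Sum>m<n. subset_sum s (after m h) (n - Suc m))"
proof -
  let ?T = "SIGMA m:{..<n}. {S. S \<subseteq> {..<n - Suc m} \<and> card S = s}"
  let ?f = "\<lambda>(m, S). insert m ((\<lambda>x. x + Suc m) ` S)"
  let ?g = "\<lambda>S. (Min S, (\<lambda>x. x - Suc (Min S)) ` (S - {Min S}))"
  have "(\<Sum>m<n. subset_sum s (after m h) (n - Suc m)) = (\<Sum>(m, S)\<in>?T. after m h S)"
    unfolding subset_sum_def by (rule sum.Sigma) auto
  also have "\<dots> = (\<Sum>S | S \<subseteq> {..<n} \<and> card S = Suc s. h S)"
  proof (rule sum.reindex_bij_witness[where i = ?g and j = ?f])
    fix p assume "p \<in> ?T"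
    then obtain m S where p: "p = (m, S)" "m < n" "S \<subseteq> {..<n - Suc m}" "card S = s" by auto
    have fin: "finite S" using p(3) finite_subset by blast
    have min: "Min (insert m ((\<lambda>x. x + Suc m) ` S)) = m"
      by (rule Min_eqI) (use fin in auto)
    have "insert m ((\<lambda>x. x + Suc m) ` S) - {m} = (\<lambda>x. x + Suc m) ` S" by auto
    then show "?g (?f p) = p" unfolding p(1) by (simp only: case_prod_conv min) (simp add: image_image)
    have "card ((\<lambda>x. x + Suc m) ` S) = s" using p(4) by (subst card_image) (auto simp: inj_on_def)
    moreover have "m \<notin> (\<lambda>x. x + Suc m) ` S" by auto
    ultimately show "?f p \<in> {S. S \<subseteq> {..<n} \<and> card S = Suc s}"
      using p fin by auto
    show "h (?f p) = (case p of (m, S) \<Rightarrow> after m h S)" by (simp add: p(1) after_def)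
  next
    fix S assume "S \<in> {S. S \<subseteq> {..<n} \<and> card S = Suc s}"
    then have S: "S \<subseteq> {..<n}" "card S = Suc s" by auto
    have fin: "finite S" and ne: "S \<noteq> {}" using S by (auto simp: finite_subset)
    define m where "m = Min S"
    have mS: "m \<in> S" "\<And>x. x \<in> S \<Longrightarrow> m \<le> x" using fin ne by (auto simp: m_def)
    have "(\<lambda>x. x + Suc m) ` (\<lambda>x. x - Suc m) ` (S - {m}) = S - {m}"
    proof -
      have "x - Suc m + Suc m = x" if "x \<in> S - {m}" for x using mS(2)[of x] that by auto
      then show ?thesis unfolding image_image by force
    qed
    then show "?f (?g S) = S" using mS(1) by (auto simp flip: m_def)
    have "inj_on (\<lambda>x. x - Suc m) (S - {m})"
    proof (rule inj_onI)
      fix x y assume "x \<in> S - {m}" "y \<in> S - {m}" "x - Suc m = y - Suc m"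
      then show "x = y" using mS(2)[of x] mS(2)[of y] by auto
    qed
    then have "card ((\<lambda>x. x - Suc m) ` (S - {m})) = s"
      using card_image fin mS(1) S(2) by (metis card_Diff_singleton diff_Suc_1)
    moreover have "(\<lambda>x. x - Suc m) ` (S - {m}) \<subseteq> {..<n - Suc m}"
    proof
      fix z assume "z \<in> (\<lambda>x. x - Suc m) ` (S - {m})"
      then obtain x where "x \<in> S" "x \<noteq> m" "z = x - Suc m" by auto
      moreover from this have "m < x" "x < n" using mS(2)[of x] S(1) by auto
      ultimately show "z \<in> {..<n - Suc m}" by simp
    qed
    moreover have "m < n" using mS(1) S(1) by auto
    ultimately show "?g S \<in> ?T" by (simp flip: m_def)
  qed
  finally show ?thesis by (simp add: subset_sum_def)
qed

lemma gap_local_after: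
  assumes "gap_local D h" shows "gap_local D (after i h)"
  unfolding gap_local_def
proof (intro allI impI)
  fix A B and m :: nat
  assume AB: "finite B" "A \<subseteq> {..<m}" "B \<subseteq> {m + D..}"
  let ?s = "\<lambda>x. x + Suc i"
  have "h (insert i (?s ` A) \<union> Suc ` (?s ` B)) = h (insert i (?s ` A) \<union> (?s ` B))"
  proof -
    have "insert i (?s ` A) \<subseteq> {..<m + Suc i}" "?s ` B \<subseteq> {m + Suc i + D..}" using AB by auto
    then show ?thesis using AB(1) by (intro gap_localD[OF assms, where m = "m + Suc i"]) auto
  qed
  moreover have "Suc ` (?s ` B) = ?s ` Suc ` B" by (simp add: image_image)
  ultimately show "after i h (A \<union> Suc ` B) = after i h (A \<union> B)"
    by (simp add: after_def image_Un)
qed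

text \<open>If the least element is at least \<open>D\<close>, the whole set can be translated
  upwards without changing \<open>h\<close>; all such positions of the minimum are therefore
  equivalent.\<close>

lemma after_gap_local:
  assumes "gap_local D h" "D \<le> m" "finite S" shows "after m h S = after D h S"
  using assms(2)
proof (induction rule: dec_induct)
  case (step m)
  let ?B = "insert m ((\<lambda>x. x + Suc m) ` S)"
  have "h ({} \<union> Suc ` ?B) = h ({} \<union> ?B)"
    using step(1) assms(3) by (intro gap_localD[OF assms(1), where m = 0]) auto
  moreover have "Suc ` ?B = insert (Suc m) ((\<lambda>x. x + Suc (Suc m)) ` S)"
    by (simp add: image_image)
  ultimately show ?case using step by (simp add: after_def)
qed simp

text \<open>Splitting off the least element \<open>m\<close> leaves \<open>D\<close> boundary
  positions, each a shifted sum over sets with one element less, and the positions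
  \<open>m \<ge> D\<close>, which share one summand and form a cumulative sum. The summation raises
  the degree by one, and the shifts raise the threshold by at most \<open>D\<close>.\<close>

lemma subset_sum_eventually_poly:
  "gap_local D h \<Longrightarrow> eventually_fdiff_zero (Suc s) (s * (D + 1)) (subset_sum s h)"
proof (induction s arbitrary: h)
  case 0
  have "subset_sum 0 h n = h {}" for n
  proof -
    have "{S. S \<subseteq> {..<n} \<and> card S = 0} = {{}}" by (auto simp: finite_subset)
    then show ?thesis by (simp add: subset_sum_def)
  qed
  then show ?case by simp
next
  case (Suc s)
  let ?N = "Suc s * (D + 1)"
  have eq: "subset_sum (Suc s) h n =
    (\<Sum>m<D. subset_sum s (after m h) (n - Suc m)) + (\<Sum>j<n - D. subset_sum s (after D h) j)"
    if "n \<ge> ?N" for n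
  proof -
    have nD: "D \<le> n" using that by simp
    have far: "subset_sum s (after m h) = subset_sum s (after D h)" if "D \<le> m" for m
      unfolding subset_sum_def
      by (intro ext sum.cong refl after_gap_local[OF Suc.prems that]) (auto simp: finite_subset)
    have "{..<n} = {..<D} \<union> {D..<n}" using nD by auto
    then have "subset_sum (Suc s) h n = (\<Sum>m<D. subset_sum s (after m h) (n - Suc m)) +
      (\<Sum>m=D..<n. subset_sum s (after m h) (n - Suc m))"
      unfolding subset_sum_split by (simp add: sum.union_disjoint ivl_disj_int)
    also have "(\<Sum>m=D..<n. subset_sum s (after m h) (n - Suc m)) = (\<Sum>m=D..<n. subset_sum s (after D h) (n - Suc m))"
      by (intro sum.cong refl) (metis far atLeastLessThan_iff)
    also have "\<dots> = (\<Sum>j<n - D. subset_sum s (after D h) j)"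
      by (rule sum.reindex_bij_witness[where i = "\<lambda>j. n - Suc j" and j = "\<lambda>m. n - Suc m"]) (use nD in auto)
    finally show ?thesis .
  qed
  have "eventually_fdiff_zero (Suc (Suc s)) ?N (\<lambda>n. subset_sum s (after m h) (n - Suc m))" if "m < D" for m
  proof (rule eventually_fdiff_zero_mono[OF eventually_fdiff_zero_Suc])
    show "eventually_fdiff_zero (Suc s) (s * (D + 1) + Suc m) (\<lambda>n. subset_sum s (after m h) (n - Suc m))"
      by (rule eventually_fdiff_zero_shift[OF Suc.IH[OF gap_local_after[OF Suc.prems]]])
  qed (use that in simp)
  moreover have "eventually_fdiff_zero (Suc (Suc s)) ?N (\<lambda>n. \<Sum>j<n - D. subset_sum s (after D h) j)"
  proof (rule eventually_fdiff_zero_mono)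
    show "eventually_fdiff_zero (Suc (Suc s)) (s * (D + 1) + D) (\<lambda>n. \<Sum>j<n - D. subset_sum s (after D h) j)"
      by (rule eventually_fdiff_zero_shift[OF eventually_fdiff_zero_cumsum[OF Suc.IH[OF gap_local_after[OF Suc.prems]]]])
  qed simp
  ultimately have "eventually_fdiff_zero (Suc (Suc s)) ?N (\<lambda>n.
    (\<Sum>m<D. subset_sum s (after m h) (n - Suc m)) + (\<Sum>j<n - D. subset_sum s (after D h) j))"
    by (intro eventually_fdiff_zero_add eventually_fdiff_zero_sum) auto
  then show ?case by (rule eventually_fdiff_zero_cong) (rule eq)
qed

text \<open>Once the set of touched vertices is prescribed, the count no longer depends on
  \<open>n\<close> and is a gap-local function of that set.\<close>

definition spanning_forests :: "nat \<Rightarrow> nat \<Rightarrow> nat set \<Rightarrow> (nat \<times> nat) set set" where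
  "spanning_forests d a S = {R \<in> forests d a S. Field R = S}"

lemma Field_map_prod_image: "Field (map_prod f f ` R) = f ` Field R"
  by (force simp: Field_def)

lemma Field_forests: "R \<in> forests d a V \<Longrightarrow> Field R \<subseteq> V"
  using short_edges_subset[of d V] by (auto simp: forests_def Field_def)

text \<open>Elements of \<open>A\<close> and of \<open>B\<close> are more than \<open>d\<close>
  apart both before and after \<open>B\<close> is moved, so no short edge joins the two parts and
  the map that moves only \<open>B\<close> preserves closeness.\<close>

lemma gap_local_spanning_forests: "gap_local d (\<lambda>S. real (card (spanning_forests d a S)))"
  unfolding gap_local_def
proof (intro allI impI)
  fix A B and m :: nat
  assume AB: "finite B" "A \<subseteq> {..<m}" "B \<subseteq> {m + d..}"
  define f where "f = (\<lambda>v. if v < m then v else Suc v)"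
  have inj: "inj_on f (A \<union> B)" by (auto simp: inj_on_def f_def split: if_splits)
  have fA: "f ` A = A" using AB(2) by (force simp: f_def)
  have "f x = Suc x" if "x \<in> B" for x using AB(3) that by (auto simp: f_def)
  then have fB: "f ` B = Suc ` B" by (rule image_cong[OF refl])
  have im: "f ` (A \<union> B) = A \<union> Suc ` B" by (simp only: image_Un fA fB)
  have close: "\<bar>int (f x) - int (f y)\<bar> \<le> int d \<longleftrightarrow> \<bar>int x - int y\<bar> \<le> int d"
    if "x \<in> A \<union> B" "y \<in> A \<union> B" for x y
  proof -
    have "x < m \<or> m + d \<le> x" "y < m \<or> m + d \<le> y" using that AB by auto
    then show ?thesis by (auto simp: f_def)
  qed
  have "bij_betw (\<lambda>R. map_prod f f ` R) {R \<in> forests d a (A \<union> B). Field R = A \<union> B}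
    {R \<in> forests d a (f ` (A \<union> B)). Field R = f ` (A \<union> B)}"
  proof (rule bij_betw_Collect[OF forests_relabel[OF inj close]])
    fix R assume R: "R \<in> forests d a (A \<union> B)"
    show "(Field (map_prod f f ` R) = f ` (A \<union> B)) = (Field R = A \<union> B)"
      unfolding Field_map_prod_image
      by (rule inj_on_image_eq_iff[OF inj Field_forests[OF R]]) simp
  qed
  then have "card (spanning_forests d a (A \<union> B)) = card (spanning_forests d a (A \<union> Suc ` B))"
    unfolding im spanning_forests_def by (rule bij_betw_same_card)
  then show "real (card (spanning_forests d a (A \<union> Suc ` B))) = real (card (spanning_forests d a (A \<union> B)))"
    by simp
qed

text \<open>The forests are classified by the set of vertices they touch; \<open>a\<close> arcs
  touch at most \<open>2 * a\<close> vertices.\<close>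

lemma card_forests_eq_subset_sums:
  "real (card (forests d a {..<n})) = (\<Sum>s\<le>2*a. subset_sum s (\<lambda>S. real (card (spanning_forests d a S))) n)"
proof -
  let ?T = "SIGMA s:{..2*a}. {S. S \<subseteq> {..<n} \<and> card S = s}"
  have sp: "spanning_forests d a S = {R \<in> forests d a {..<n}. Field R = S}" if "S \<subseteq> {..<n}" for S
  proof -
    have "R \<subseteq> short_edges d (Field R)" if "R \<subseteq> short_edges d {..<n}" for R
      using that by (fastforce simp: short_edges_def Field_def)
    moreover have "short_edges d S \<subseteq> short_edges d {..<n}" using that by (auto simp: short_edges_def)
    ultimately show ?thesis unfolding spanning_forests_def forests_def by auto
  qed
  have card_Field: "card (Field R) \<le> 2 * a" if "R \<in> forests d a {..<n}" for R
  proof -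
    have "finite R" "card R = a" using that finite_subset[OF _ finite_short_edges[of "{..<n}" d]]
      by (auto simp: forests_def)
    then have "card (fst ` R) \<le> a" "card (snd ` R) \<le> a" using card_image_le by metis+
    then show ?thesis using card_Un_le[of "fst ` R" "snd ` R"]
      by (simp add: Field_def Domain_fst Range_snd)
  qed
  have "card (forests d a {..<n}) = (\<Sum>S | S \<subseteq> {..<n} \<and> card S \<le> 2 * a. card {R \<in> forests d a {..<n}. Field R = S})"
    unfolding card_eq_sum using Field_forests[of _ d a "{..<n}"] card_Field
    by (intro sum.group[symmetric]) auto
  also have "\<dots> = (\<Sum>S | S \<subseteq> {..<n} \<and> card S \<le> 2 * a. card (spanning_forests d a S))"
    by (intro sum.cong) (auto simp: sp)
  also have "\<dots> = (\<Sum>(s, S)\<in>?T. card (spanning_forests d a S))"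
    by (rule sum.reindex_bij_witness[where i = snd and j = "\<lambda>S. (card S, S)"]) auto
  also have "\<dots> = (\<Sum>s\<le>2*a. \<Sum>S | S \<subseteq> {..<n} \<and> card S = s. card (spanning_forests d a S))"
    by (rule sum.Sigma[symmetric]) auto
  finally show ?thesis by (simp add: subset_sum_def)
qed

section \<open>The number of short edges and the degree of the forest polynomial\<close>

lemma card_short_edges: "card (short_edges d {..<n}) = 2 * (\<Sum>j<n. min j d)"
proof (induction n)
  case 0
  then show ?case by (simp add: short_edges_def)
next
  case (Suc n)
  let ?I = "{n - min n d..<n}"
  have "short_edges d {..<Suc n} = short_edges d {..<n} \<union> ({n} \<times> ?I \<union> ?I \<times> {n})"
    by (auto simp: short_edges_def)
  moreover have "short_edges d {..<n} \<inter> ({n} \<times> ?I \<union> ?I \<times> {n}) = {}" by (auto simp: short_edges_def)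
  moreover have "card ({n} \<times> ?I \<union> ?I \<times> {n}) = 2 * min n d"
    by (subst card_Un_disjoint) (auto simp: card_cartesian_product)
  ultimately show ?case using Suc by (simp add: card_Un_disjoint)
qed

lemma card_short_edges_le: "card (short_edges d {..<n}) \<le> 2 * d * n"
proof -
  have "(\<Sum>j<n. min j d) \<le> (\<Sum>j<n. d)" by (rule sum_mono) simp
  then show ?thesis unfolding card_short_edges by (simp add: mult.commute)
qed

lemma card_short_edges_real:
  assumes "d \<le> n" shows "real (card (short_edges d {..<n})) = real d * (2 * real n - real d - 1)"
proof -
  have "real (2 * (\<Sum>j<n. min j d)) = real d * (2 * real n - real d - 1)"
    using assms
  proof (induction rule: dec_induct)
    case base
    have "2 * (\<Sum>j<d. min j d) = 2 * (\<Sum>j<d. j)" by (intro arg_cong[of _ _ "(*) 2"] sum.cong) auto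
    moreover have "real (2 * (\<Sum>j<d. j)) = real d * (real d - 1)"
      by (induction d) (auto simp: algebra_simps)
    ultimately show ?case by (simp only:) simp
  next
    case (step n)
    then show ?case by (simp add: algebra_simps)
  qed
  then show ?thesis unfolding card_short_edges .
qed

lemma card_forests_le: "finite V \<Longrightarrow> card (forests d a V) \<le> card (short_edges d V) ^ a"
proof -
  assume V: "finite V"
  let ?E = "short_edges d V"
  have "card (forests d a V) \<le> card {R. R \<subseteq> ?E \<and> card R = a}"
    using V by (intro card_mono) (auto simp: forests_def)
  also have "\<dots> = card ?E choose a" using V by (simp add: n_subsets)
  also have "\<dots> \<le> card ?E ^ a" by (cases "a \<le> card ?E") (auto intro: binomial_le_pow simp: binomial_eq_0)
  finally show ?thesis .
qed

text \<open>The subset sums alone give degree \<open>2 * a\<close>; comparison with the crude bound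
  \<open>(2 * d * n) ^ a\<close> removes the coefficients above \<open>a\<close>. The cut matters
  because the count will be divided by the \<open>a\<close>-th power of the number of edges, which
  grows only like \<open>n ^ a\<close>.\<close>

lemma card_forests_newton:
  obtains c where "\<And>j. poly_growth (c j)"
    "\<And>d m. real (card (forests d a {..<2 * a * (d + 1) + m})) = (\<Sum>j\<le>a. c j d * real (m choose j))"
proof -
  let ?N = "\<lambda>d. 2 * a * (d + 1)" and ?f = "\<lambda>d n. real (card (forests d a {..<n}))"
  let ?r = "Suc (2 * a)"
  have le: "?f d n \<le> real (2 * d * n) ^ a" for d n
  proof -
    have "card (forests d a {..<n}) \<le> (2 * d * n) ^ a"
      by (rule order_trans[OF card_forests_le]) (auto intro: power_mono card_short_edges_le)
    then show ?thesis by (metis of_nat_le_iff of_nat_power)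
  qed
  \<comment> \<open>Bounds the count at the \<open>2 * a + 2\<close> points from which the
    difference formula reads off its coefficients, and is polynomial in \<open>d\<close>.\<close>
  define B where "B = (\<lambda>d. real (2 * d * (?N d + ?r)) ^ a)"
  have "\<exists>c. (\<forall>j. \<bar>c j\<bar> \<le> 2 ^ ?r * B d) \<and> (\<forall>m. ?f d (?N d + m) = (\<Sum>j<?r. c j * real (m choose j)))" for d
  proof (rule newton_forward)
    show "eventually_fdiff_zero ?r (?N d) (?f d)"
      unfolding card_forests_eq_subset_sums
    proof (rule eventually_fdiff_zero_sum)
      fix s assume "s \<in> {..2 * a}"
      then show "eventually_fdiff_zero ?r (?N d) (subset_sum s (\<lambda>S. real (card (spanning_forests d a S))))"
        by (intro eventually_fdiff_zero_mono_order[OF eventually_fdiff_zero_mono[OF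
            subset_sum_eventually_poly[OF gap_local_spanning_forests]]] mult_right_mono) auto
    qed
    fix n assume n: "n \<le> ?N d + ?r"
    have "real (2 * d * n) ^ a \<le> B d" unfolding B_def using n by (intro power_mono of_nat_mono mult_le_mono2) auto
    then show "\<bar>?f d n\<bar> \<le> B d" using le[of d n] by simp
  qed
  then obtain c where c: "\<And>d j. \<bar>c d j\<bar> \<le> 2 ^ ?r * B d"
    "\<And>d m. ?f d (?N d + m) = (\<Sum>j<?r. c d j * real (m choose j))" by metis
  have zero: "c d j = 0" if "j \<le> 2 * a" "a < j" for d j
  proof (rule newton_coeff_zero[OF _ that])
    fix m :: nat assume m: "m \<ge> 1"
    have "\<bar>\<Sum>j\<le>2 * a. c d j * real (m choose j)\<bar> = ?f d (?N d + m)"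
      using c(2)[of d m] by (simp add: lessThan_Suc_atMost)
    also have "\<dots> \<le> real (2 * d * (?N d + m)) ^ a" by (rule le)
    \<comment> \<open>Replacing \<open>?N d + m\<close> by a product, which is legitimate for
      \<open>m \<ge> 1\<close>, separates a pure power of \<open>m\<close>.\<close>
    also have "\<dots> \<le> real (2 * d * ((?N d + 1) * m)) ^ a"
    proof (rule power_mono)
      have "?N d * 1 \<le> ?N d * m" using m by (rule mult_le_mono2)
      then have "?N d + m \<le> (?N d + 1) * m" by (simp only: distrib_right)
      then show "real (2 * d * (?N d + m)) \<le> real (2 * d * ((?N d + 1) * m))"
        unfolding of_nat_le_iff by (rule mult_le_mono2)
    qed simp
    also have "\<dots> = real (2 * d * (?N d + 1)) ^ a * real m ^ a"
      by (simp only: of_nat_mult power_mult_distrib mult.assoc)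
    finally show "\<bar>\<Sum>j\<le>2 * a. c d j * real (m choose j)\<bar> \<le> real (2 * d * (?N d + 1)) ^ a * real m ^ a" .
  qed
  show thesis
  proof (rule that[of "\<lambda>j d. c d j"])
    show "poly_growth (\<lambda>d. c d j)" for j
    proof (rule poly_growth_mono[OF _ c(1)])
      show "poly_growth (\<lambda>d. 2 ^ ?r * B d)" unfolding B_def of_nat_mult of_nat_add
        by (intro poly_growth_mult poly_growth_power poly_growth_add poly_growth_const poly_growth_of_nat)
    qed
    fix d m
    have "?f d (?N d + m) = (\<Sum>j\<le>2*a. c d j * real (m choose j))"
      using c(2) by (simp add: lessThan_Suc_atMost)
    also have "\<dots> = (\<Sum>j\<le>a. c d j * real (m choose j))"
      by (rule sum.mono_neutral_right) (auto simp: zero)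
    finally show "?f d (?N d + m) = (\<Sum>j\<le>a. c d j * real (m choose j))" .
  qed
qed

section \<open>Cumulants of the forest condition\<close>

text \<open>Ore's argument: in a graph without isolated vertices the complement of a minimal
  dominating set is dominating as well, and one of the two has at most half of the vertices.\<close>

lemma half_dominating_set:
  assumes fin: "finite I" and sym: "\<And>i j. adj i j \<Longrightarrow> adj j i"
    and nbr: "\<And>i. i \<in> I \<Longrightarrow> \<exists>j\<in>I. j \<noteq> i \<and> adj i j"
  shows "\<exists>D\<subseteq>I. 2 * card D \<le> card I \<and> (\<forall>i\<in>I - D. \<exists>j\<in>D. adj i j)"
proof -
  let ?dom = "\<lambda>D. D \<subseteq> I \<and> (\<forall>i\<in>I - D. \<exists>j\<in>D. adj i j)"
  have "?dom I" by simp
  then obtain D where D: "?dom D" and min: "\<And>D'. ?dom D' \<Longrightarrow> card D \<le> card D'"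
    using ex_has_least_nat[of ?dom I card] by blast
  have finD: "finite D" using D fin finite_subset by blast
  have "\<exists>j\<in>I - D. adj i j" if i: "i \<in> D" for i
  proof (rule ccontr)
    assume no: "\<not> (\<exists>j\<in>I - D. adj i j)"
    obtain j where j: "j \<in> I" "j \<noteq> i" "adj i j" using nbr i D by blast
    have "?dom (D - {i})"
    proof (intro conjI ballI)
      fix u assume u: "u \<in> I - (D - {i})"
      show "\<exists>v\<in>D - {i}. adj u v"
      proof (cases "u = i")
        case True
        then show ?thesis using j no by blast
      next
        case False
        then obtain v where "v \<in> D" "adj u v" using u D by blast
        then show ?thesis using no u False sym by blast
      qed
    qed (use D in blast)
    then have "card D \<le> card (D - {i})" by (rule min)
    then show False using card_Diff1_less[OF finD i] by linarith
  qed
  then have dom': "?dom (I - D)" using D by auto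
  show ?thesis
  proof (cases "2 * card D \<le> card I")
    case False
    have "card (I - D) = card I - card D" using finD D by (intro card_Diff_subset) auto
    then have "2 * card (I - D) \<le> card I" using False by linarith
    then show ?thesis using dom' by blast
  qed (use D in blast)
qed

section \<open>Good tuples of arcs and their Moebius transform\<close>

definition ends :: "'a \<times> 'a \<Rightarrow> 'a set" where "ends p = {fst p, snd p}"

definition good :: "('i \<Rightarrow> 'a \<times> 'a) \<Rightarrow> 'i set \<Rightarrow> bool" where
  "good e A \<longleftrightarrow> inj_on e A \<and> linear_forest (e ` A)"

lemma linear_forest_insert_isolated:
  assumes "x \<noteq> y" "x \<notin> Field R" "y \<notin> Field R"
  shows "linear_forest (insert (x, y) R) \<longleftrightarrow> linear_forest R"
proof
  assume R: "linear_forest R"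
  have "single_valued (insert (x, y) R)" "single_valued ((insert (x, y) R)\<inverse>)"
    using R assms by (auto simp: linear_forest_def single_valued_def Field_def)
  moreover have "(y, x) \<notin> R\<^sup>*"
  proof
    assume "(y, x) \<in> R\<^sup>*"
    then show False using assms by (auto simp: Field_def elim: rtranclE)
  qed
  ultimately show "linear_forest (insert (x, y) R)" using R by (auto simp: linear_forest_def)
qed (auto intro: linear_forest_subset)

lemma good_insert_isolated:
  assumes "i \<notin> A" "fst (e i) \<noteq> snd (e i)" "\<And>j. j \<in> A \<Longrightarrow> ends (e i) \<inter> ends (e j) = {}"
  shows "good e (insert i A) \<longleftrightarrow> good e A"
proof -
  have "fst (e i) \<notin> Field (e ` A)" "snd (e i) \<notin> Field (e ` A)"
  proof -
    have "v \<notin> Field (e ` A)" if "v \<in> ends (e i)" for v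
    proof
      assume "v \<in> Field (e ` A)"
      then obtain j where "j \<in> A" "v \<in> ends (e j)"
        unfolding Field_def Domain_fst Range_snd ends_def by blast
      then show False using assms(3) that by blast
    qed
    then show "fst (e i) \<notin> Field (e ` A)" "snd (e i) \<notin> Field (e ` A)" by (auto simp: ends_def)
  qed
  then have "linear_forest (insert (e i) (e ` A)) \<longleftrightarrow> linear_forest (e ` A)"
    using linear_forest_insert_isolated[of "fst (e i)" "snd (e i)" "e ` A"] assms(2) by simp
  moreover have "e i \<notin> e ` A"
  proof
    assume "e i \<in> e ` A"
    then obtain j where "j \<in> A" "e i = e j" by blast
    then show False using assms(3)[of j] by (simp add: ends_def)
  qed
  ultimately show ?thesis using assms(1) by (auto simp: good_def)
qed

text \<open>Adding or removing an isolated arc does not affect goodness, so toggling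
  \<open>i\<close> pairs the subsets of \<open>B\<close> with opposite signs. This is the
  cancellation that makes the cumulants small.\<close>

lemma moebius_good_isolated:
  assumes "finite B" "i \<in> B" "fst (e i) \<noteq> snd (e i)"
    "\<And>j. j \<in> B \<Longrightarrow> j \<noteq> i \<Longrightarrow> ends (e i) \<inter> ends (e j) = {}"
  shows "(\<Sum>A\<in>Pow B. (-1) ^ (card B - card A) * of_bool (good e A)) = (0::real)"
proof -
  define C where "C = B - {i}"
  have B: "B = insert i C" and iC: "i \<notin> C" and finC: "finite C" using assms by (auto simp: C_def)
  let ?f = "\<lambda>A. (-1) ^ (card B - card A) * of_bool (good e A) :: real"
  have "Pow B = Pow C \<union> insert i ` Pow C" unfolding B by (rule Pow_insert)
  moreover have "Pow C \<inter> insert i ` Pow C = {}" using iC by auto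
  ultimately have "(\<Sum>A\<in>Pow B. ?f A) = (\<Sum>A\<in>Pow C. ?f A) + (\<Sum>A\<in>insert i ` Pow C. ?f A)"
    using finC by (simp only:) (rule sum.union_disjoint; simp)
  also have "(\<Sum>A\<in>insert i ` Pow C. ?f A) = (\<Sum>A\<in>Pow C. ?f (insert i A))"
    using iC by (subst sum.reindex) (auto simp: inj_on_def)
  also have "\<dots> = (\<Sum>A\<in>Pow C. - ?f A)"
  proof (rule sum.cong[OF refl])
    fix A assume "A \<in> Pow C"
    then have A: "A \<subseteq> C" "finite A" using finC finite_subset by auto
    have "good e (insert i A) \<longleftrightarrow> good e A"
      using assms A iC B by (intro good_insert_isolated) auto
    moreover have "card (insert i A) = Suc (card A)" "card B = Suc (card C)"
      using A iC finC B by (auto simp: card_insert_if)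
    moreover have "card A \<le> card C" using A finC card_mono by blast
    ultimately show "?f (insert i A) = - ?f A" by (simp add: Suc_diff_le)
  qed
  finally show ?thesis by (simp add: sum_negf)
qed

lemma bij_betw_PiE_split:
  assumes "A \<subseteq> I"
  shows "bij_betw (\<lambda>e. (restrict e A, restrict e (I - A))) (I \<rightarrow>\<^sub>E E) ((A \<rightarrow>\<^sub>E E) \<times> ((I - A) \<rightarrow>\<^sub>E E))"
proof (rule bij_betwI'[where f = "\<lambda>e. (restrict e A, restrict e (I - A))"])
  fix e e' assume "e \<in> I \<rightarrow>\<^sub>E E" "e' \<in> I \<rightarrow>\<^sub>E E"
  then show "((restrict e A, restrict e (I - A)) = (restrict e' A, restrict e' (I - A))) = (e = e')"
  proof (intro iffI)
    assume eq: "(restrict e A, restrict e (I - A)) = (restrict e' A, restrict e' (I - A))"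
    have "e i = e' i" if "i \<in> I" for i
      using eq that by (cases "i \<in> A") (auto dest: fun_cong[of _ _ i])
    then show "e = e'" using \<open>e \<in> I \<rightarrow>\<^sub>E E\<close> \<open>e' \<in> I \<rightarrow>\<^sub>E E\<close> by (intro PiE_ext)
  qed simp
next
  fix e assume "e \<in> I \<rightarrow>\<^sub>E E"
  then show "(restrict e A, restrict e (I - A)) \<in> (A \<rightarrow>\<^sub>E E) \<times> ((I - A) \<rightarrow>\<^sub>E E)" using assms by auto
next
  fix p assume "p \<in> (A \<rightarrow>\<^sub>E E) \<times> ((I - A) \<rightarrow>\<^sub>E E)"
  then obtain f g where p: "p = (f, g)" "f \<in> A \<rightarrow>\<^sub>E E" "g \<in> (I - A) \<rightarrow>\<^sub>E E" by auto
  let ?e = "\<lambda>i. if i \<in> A then f i else g i"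
  have "restrict ?e A = f" using p(2) by (intro ext) (auto simp: restrict_def PiE_def extensional_def)
  moreover have "restrict ?e (I - A) = g" using p(3) by (intro ext) (auto simp: restrict_def PiE_def extensional_def)
  moreover have "?e \<in> I \<rightarrow>\<^sub>E E" using p assms by (auto simp: PiE_def extensional_def)
  ultimately show "\<exists>e\<in>I \<rightarrow>\<^sub>E E. p = (restrict e A, restrict e (I - A))"
    using p(1) by (intro bexI[of _ ?e]) simp_all
qed

lemma good_restrict [simp]: "good (restrict e A) A \<longleftrightarrow> good e A"
  by (simp add: good_def cong: inj_on_cong)

text \<open>The factor \<open>fact a\<close> passes from sets of arcs to ordered tuples, which can
  be compared with the \<open>card E ^ a\<close> free choices.\<close>

definition good_tuples :: "('a \<times> 'a) set \<Rightarrow> nat \<Rightarrow> nat" where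
  "good_tuples E a = fact a * card {R. R \<subseteq> E \<and> card R = a \<and> linear_forest R}"

lemma card_good_functions:
  assumes "finite E" "finite A"
  shows "card {f \<in> A \<rightarrow>\<^sub>E E. good f A} = good_tuples E (card A)"
proof -
  let ?Q = "{R. R \<subseteq> E \<and> card R = card A \<and> linear_forest R}"
  let ?F = "{f \<in> A \<rightarrow>\<^sub>E E. good f A}"
  have finF: "finite ?F" using assms by (simp add: finite_PiE)
  have finQ: "finite ?Q" using assms by simp
  have "card ?F = (\<Sum>R\<in>?Q. card {f \<in> ?F. f ` A = R})"
    unfolding card_eq_sum using assms finF finQ
    by (intro sum.group[symmetric]) (auto simp: good_def card_image)
  also have "\<dots> = (\<Sum>R\<in>?Q. fact (card A))"
  proof (rule sum.cong[OF refl])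
    fix R assume R: "R \<in> ?Q"
    then have finR: "finite R" using assms finite_subset by auto
    have "{f \<in> ?F. f ` A = R} = {f \<in> A \<rightarrow>\<^sub>E R. inj_on f A}"
    proof (intro equalityI subsetI)
      fix f assume "f \<in> {f \<in> A \<rightarrow>\<^sub>E R. inj_on f A}"
      then have f: "f \<in> A \<rightarrow>\<^sub>E R" "inj_on f A" by auto
      have "f ` A = R" using f R finR by (intro card_subset_eq) (auto simp: card_image)
      then show "f \<in> {f \<in> ?F. f ` A = R}" using f R by (auto simp: good_def)
    qed (auto simp: good_def)
    then have "card {f \<in> ?F. f ` A = R} = card {f \<in> A \<rightarrow>\<^sub>E R. inj_on f A}" by simp
    also have "\<dots> = (\<Prod>i = 0..<card A. card R - i)"
      using card_inj_on_subset_funcset[OF assms(2) finR] by simp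
    also have "\<dots> = fact (card A)" using R by (simp add: fact_prod_rev)
    finally show "card {f \<in> ?F. f ` A = R} = fact (card A)" .
  qed
  finally show ?thesis by (simp add: good_tuples_def)
qed

lemma card_good_on:
  assumes "finite E" "finite I" "A \<subseteq> I"
  shows "card {e \<in> I \<rightarrow>\<^sub>E E. good e A} = card E ^ (card I - card A) * good_tuples E (card A)"
proof -
  have finA: "finite A" using assms finite_subset by blast
  have "bij_betw (\<lambda>e. (restrict e A, restrict e (I - A))) {e \<in> I \<rightarrow>\<^sub>E E. good e A}
    {p \<in> (A \<rightarrow>\<^sub>E E) \<times> ((I - A) \<rightarrow>\<^sub>E E). good (fst p) A}"
    by (rule bij_betw_Collect[OF bij_betw_PiE_split[OF assms(3)]]) simp
  also have "{p \<in> (A \<rightarrow>\<^sub>E E) \<times> ((I - A) \<rightarrow>\<^sub>E E). good (fst p) A} =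
      {f \<in> A \<rightarrow>\<^sub>E E. good f A} \<times> ((I - A) \<rightarrow>\<^sub>E E)" by auto
  finally have "card {e \<in> I \<rightarrow>\<^sub>E E. good e A} = card ({f \<in> A \<rightarrow>\<^sub>E E. good f A} \<times> ((I - A) \<rightarrow>\<^sub>E E))"
    by (rule bij_betw_same_card)
  then show ?thesis
    using assms finA by (simp add: card_cartesian_product card_good_functions card_funcsetE card_Diff_subset)
qed

text \<open>The cumulants are the Moebius transform of the indicator of goodness, summed over all
  tuples of edges. They are small because the transform vanishes on tuples with an isolated
  edge, so that only about half of the edges can be chosen freely.\<close>

definition good_cumulant :: "('a \<times> 'a) set \<Rightarrow> nat \<Rightarrow> real" where
  "good_cumulant E m = (\<Sum>a\<le>m. real (m choose a) * (- real (card E)) ^ (m - a) * real (good_tuples E a))"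

lemma sum_Pow_card:
  assumes "finite B"
  shows "(\<Sum>A\<in>Pow B. f (card A)) = (\<Sum>a\<le>card B. real (card B choose a) * f a)"
proof -
  have "(\<Sum>A\<in>Pow B. f (card A)) = (\<Sum>a\<le>card B. \<Sum>A | A \<in> Pow B \<and> card A = a. f (card A))"
    using assms by (intro sum.group[symmetric]) (auto intro: card_mono)
  also have "\<dots> = (\<Sum>a\<le>card B. real (card B choose a) * f a)"
    using n_subsets[OF assms] by (intro sum.cong) auto
  finally show ?thesis .
qed

text \<open>The power of \<open>card E\<close> in the definition counts the free choices of the arcs
  outside \<open>A\<close>. Written as a sum over whole tuples, the cumulant shows its cancellation
  tuple by tuple.\<close>

lemma good_cumulant_eq:
  assumes "finite E"
  shows "good_cumulant E m =
    (\<Sum>e\<in>{..<m} \<rightarrow>\<^sub>E E. \<Sum>A\<in>Pow {..<m}. (-1) ^ (m - card A) * of_bool (good e A))"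
proof -
  have fin: "finite ({..<m} \<rightarrow>\<^sub>E E)" using assms by (simp add: finite_PiE)
  have "(\<Sum>e\<in>{..<m} \<rightarrow>\<^sub>E E. \<Sum>A\<in>Pow {..<m}. (-1) ^ (m - card A) * of_bool (good e A) :: real) =
    (\<Sum>A\<in>Pow {..<m}. (-1) ^ (m - card A) * (\<Sum>e\<in>{..<m} \<rightarrow>\<^sub>E E. of_bool (good e A)))"
    unfolding sum_distrib_left by (rule sum.swap)
  also have "\<dots> = (\<Sum>A\<in>Pow {..<m}. (- real (card E)) ^ (m - card A) * real (good_tuples E (card A)))"
  proof (rule sum.cong[OF refl])
    fix A assume A: "A \<in> Pow {..<m}"
    have "(\<Sum>e\<in>{..<m} \<rightarrow>\<^sub>E E. of_bool (good e A) :: real) = real (card {e \<in> {..<m} \<rightarrow>\<^sub>E E. good e A})"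
      using fin by (simp add: Int_def)
    also have "\<dots> = real (card E) ^ (m - card A) * real (good_tuples E (card A))"
      using card_good_on[OF assms, of "{..<m}" A] A by simp
    finally show "(-1) ^ (m - card A) * (\<Sum>e\<in>{..<m} \<rightarrow>\<^sub>E E. of_bool (good e A)) =
        (- real (card E)) ^ (m - card A) * real (good_tuples E (card A))"
      by (simp add: power_minus[of "real (card E)"])
  qed
  also have "\<dots> = good_cumulant E m"
    using sum_Pow_card[of "{..<m}" "\<lambda>a. (- real (card E)) ^ (m - a) * real (good_tuples E a)"]
    by (simp add: good_cumulant_def mult.assoc)
  finally show ?thesis by simp
qed

text \<open>Binomial inversion by exponential generating functions: passing to cumulants multiplies
  by \<open>fps_exp (- M)\<close>, which \<open>fps_exp M\<close> undoes.\<close>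

lemma good_tuples_eq_cumulants:
  "real (good_tuples E k) = (\<Sum>m\<le>k. real (k choose m) * real (card E) ^ (k - m) * good_cumulant E m)"
proof -
  define M where "M = real (card E)"
  define F where "F = Abs_fps (\<lambda>a. real (good_tuples E a) / fact a)"
  define H where "H = F * fps_exp (- M)"
  have H: "fps_nth H m = good_cumulant E m / fact m" for m
    unfolding H_def F_def good_cumulant_def fps_mult_nth sum_divide_distrib atLeast0AtMost M_def
    by (rule sum.cong) (auto simp: binomial_fact field_simps)
  have "F = H * fps_exp M"
    unfolding H_def mult.assoc fps_exp_add_mult[symmetric] by simp
  then have "fps_nth F k = (\<Sum>m\<le>k. fps_nth H m * (M ^ (k - m) / fact (k - m)))"
    by (simp add: fps_mult_nth atLeast0AtMost)
  then have "real (good_tuples E k) = fact k * (\<Sum>m\<le>k. good_cumulant E m / fact m * (M ^ (k - m) / fact (k - m)))"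
    by (simp add: F_def H field_simps)
  also have "\<dots> = (\<Sum>m\<le>k. real (k choose m) * M ^ (k - m) * good_cumulant E m)"
    unfolding sum_distrib_left by (rule sum.cong) (auto simp: binomial_fact field_simps)
  finally show ?thesis unfolding M_def .
qed

text \<open>The arcs indexed by \<open>D\<close> are free; every other arc passes through one of
  their at most \<open>2 * card D\<close> end points, each of which lies on at most
  \<open>\<Delta>\<close> arcs.\<close>

lemma card_dominated_tuples:
  fixes E :: "('a \<times> 'a) set" and \<Delta> :: nat
  assumes fin: "finite E" "finite I" and D: "D \<subseteq> I"
    and deg: "\<And>v. card {p \<in> E. v \<in> ends p} \<le> \<Delta>"
  shows "card {e \<in> I \<rightarrow>\<^sub>E E. \<forall>i\<in>I - D. \<exists>j\<in>D. ends (e i) \<inter> ends (e j) \<noteq> {}}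
    \<le> card E ^ card D * (2 * card D * \<Delta>) ^ (card I - card D)"
proof -
  let ?X = "{e \<in> I \<rightarrow>\<^sub>E E. \<forall>i\<in>I - D. \<exists>j\<in>D. ends (e i) \<inter> ends (e j) \<noteq> {}}"
  let ?T = "\<lambda>f. {p \<in> E. \<exists>j\<in>D. ends p \<inter> ends (f j) \<noteq> {}}"
  let ?r = "\<lambda>e. (restrict e D, restrict e (I - D))"
  let ?S = "SIGMA f:(D \<rightarrow>\<^sub>E E). ((I - D) \<rightarrow>\<^sub>E ?T f)"
  have finD: "finite D" using fin D finite_subset by blast
  have T: "card (?T f) \<le> 2 * card D * \<Delta>" for f
  proof -
    have "?T f \<subseteq> (\<Union>j\<in>D. {p \<in> E. fst (f j) \<in> ends p} \<union> {p \<in> E. snd (f j) \<in> ends p})"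
      by (auto simp: ends_def)
    then have "card (?T f) \<le> card (\<Union>j\<in>D. {p \<in> E. fst (f j) \<in> ends p} \<union> {p \<in> E. snd (f j) \<in> ends p})"
      using finD fin by (intro card_mono) auto
    also have "\<dots> \<le> (\<Sum>j\<in>D. card ({p \<in> E. fst (f j) \<in> ends p} \<union> {p \<in> E. snd (f j) \<in> ends p}))"
      by (rule card_UN_le[OF finD])
    also have "\<dots> \<le> (\<Sum>j\<in>D. \<Delta> + \<Delta>)"
      by (intro sum_mono order_trans[OF card_Un_le] add_mono deg)
    also have "\<dots> = 2 * card D * \<Delta>" by simp
    finally show ?thesis .
  qed
  have finS: "finite ?S"
    using fin finD by (intro finite_SigmaI finite_PiE) auto
  have "inj_on ?r ?X"
    using bij_betw_imp_inj_on[OF bij_betw_PiE_split[OF D, of E]] by (rule inj_on_subset) auto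
  moreover have "?r ` ?X \<subseteq> ?S" using D by auto
  ultimately have "card ?X \<le> card ?S" using finS by (rule card_inj_on_le)
  also have "\<dots> = (\<Sum>f\<in>D \<rightarrow>\<^sub>E E. card ((I - D) \<rightarrow>\<^sub>E ?T f))"
    using fin finD by (intro card_SigmaI) (auto intro!: finite_PiE)
  also have "\<dots> \<le> (\<Sum>f\<in>D \<rightarrow>\<^sub>E E. (2 * card D * \<Delta>) ^ (card I - card D))"
  proof (rule sum_mono)
    fix f
    have "card ((I - D) \<rightarrow>\<^sub>E ?T f) = card (?T f) ^ (card I - card D)"
      using fin D finD by (simp add: card_funcsetE card_Diff_subset)
    also have "\<dots> \<le> (2 * card D * \<Delta>) ^ (card I - card D)" using T by (intro power_mono) auto
    finally show "card ((I - D) \<rightarrow>\<^sub>E ?T f) \<le> (2 * card D * \<Delta>) ^ (card I - card D)" .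
  qed
  also have "\<dots> = card E ^ card D * (2 * card D * \<Delta>) ^ (card I - card D)"
    using fin finD by (simp add: card_funcsetE)
  finally show ?thesis .
qed

text \<open>A union bound over at most \<open>2 ^ m\<close> dominating sets of indices of size at
  most \<open>m / 2\<close>, two indices being adjacent when their arcs meet.\<close>

lemma card_isolation_free_tuples:
  fixes E :: "('a \<times> 'a) set" and \<Delta> :: nat
  assumes fin: "finite E" "E \<noteq> {}" and \<Delta>: "\<Delta> \<ge> 1"
    and deg: "\<And>v. card {p \<in> E. v \<in> ends p} \<le> \<Delta>"
  shows "card {e \<in> {..<m} \<rightarrow>\<^sub>E E. \<forall>i<m. \<exists>j<m. j \<noteq> i \<and> ends (e i) \<inter> ends (e j) \<noteq> {}}
    \<le> (2 * m * \<Delta>) ^ m * card E ^ (m div 2)"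
\<comment> \<open>Split off because enlarging the exponent of \<open>m * \<Delta>\<close> below
  requires a base of at least 1.\<close>
proof (cases "m = 0")
  case True
  then show ?thesis by simp
next
  case False
  let ?X = "{e \<in> {..<m} \<rightarrow>\<^sub>E E. \<forall>i<m. \<exists>j<m. j \<noteq> i \<and> ends (e i) \<inter> ends (e j) \<noteq> {}}"
  let ?Y = "\<lambda>D. {e \<in> {..<m} \<rightarrow>\<^sub>E E. \<forall>i\<in>{..<m} - D. \<exists>j\<in>D. ends (e i) \<inter> ends (e j) \<noteq> {}}"
  let ?DD = "{D \<in> Pow {..<m}. 2 * card D \<le> m}"
  have "?X \<subseteq> (\<Union>D\<in>?DD. ?Y D)"
  proof
    fix e assume e: "e \<in> ?X"
    then have "\<exists>D\<subseteq>{..<m}. 2 * card D \<le> card {..<m} \<and> (\<forall>i\<in>{..<m} - D. \<exists>j\<in>D. ends (e i) \<inter> ends (e j) \<noteq> {})"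
      by (intro half_dominating_set) (auto simp: Int_commute Bex_def)
    then show "e \<in> (\<Union>D\<in>?DD. ?Y D)" using e by auto
  qed
  then have "card ?X \<le> card (\<Union>D\<in>?DD. ?Y D)"
    using fin by (intro card_mono) (auto simp: finite_PiE)
  also have "\<dots> \<le> (\<Sum>D\<in>?DD. card (?Y D))" by (rule card_UN_le) simp
  also have "\<dots> \<le> (\<Sum>D\<in>?DD. (m * \<Delta>) ^ m * card E ^ (m div 2))"
  proof (rule sum_mono)
    fix D assume "D \<in> ?DD"
    then have D: "D \<subseteq> {..<m}" "2 * card D \<le> m" by auto
    have E1: "card E \<ge> 1" using fin by (simp add: Suc_leI card_gt_0_iff)
    have "card (?Y D) \<le> card E ^ card D * (2 * card D * \<Delta>) ^ (m - card D)"
      using card_dominated_tuples[OF fin(1) _ D(1) deg] by simp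
    also have "\<dots> \<le> card E ^ (m div 2) * (m * \<Delta>) ^ m"
    proof (rule mult_le_mono)
      show "card E ^ card D \<le> card E ^ (m div 2)" using E1 D(2) by (intro power_increasing) auto
      have "(2 * card D * \<Delta>) ^ (m - card D) \<le> (m * \<Delta>) ^ (m - card D)"
        using D(2) by (intro power_mono mult_le_mono1) auto
      also have "\<dots> \<le> (m * \<Delta>) ^ m" using False \<Delta> by (intro power_increasing) auto
      finally show "(2 * card D * \<Delta>) ^ (m - card D) \<le> (m * \<Delta>) ^ m" .
    qed
    finally show "card (?Y D) \<le> (m * \<Delta>) ^ m * card E ^ (m div 2)" by (simp add: mult.commute)
  qed
  also have "\<dots> = card ?DD * ((m * \<Delta>) ^ m * card E ^ (m div 2))" by simp
  also have "\<dots> \<le> 2 ^ m * ((m * \<Delta>) ^ m * card E ^ (m div 2))"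
  proof (rule mult_le_mono1)
    have "card ?DD \<le> card (Pow {..<m})" by (intro card_mono) auto
    then show "card ?DD \<le> 2 ^ m" by (simp add: card_Pow)
  qed
  finally show ?thesis by (simp add: power_mult_distrib mult_ac)
qed

text \<open>Only tuples without an isolated arc contribute, each at most the number
  \<open>2 ^ m\<close> of index subsets; this factor turns the 2 in the base of the counting bound
  into 4.\<close>

lemma good_cumulant_bound:
  fixes E :: "('a \<times> 'a) set" and \<Delta> :: nat
  assumes fin: "finite E" "E \<noteq> {}" and loopfree: "\<And>p. p \<in> E \<Longrightarrow> fst p \<noteq> snd p" and \<Delta>: "\<Delta> \<ge> 1"
    and deg: "\<And>v. card {p \<in> E. v \<in> ends p} \<le> \<Delta>"
  shows "\<bar>good_cumulant E m\<bar> \<le> real (4 * m * \<Delta>) ^ m * real (card E) ^ (m div 2)"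
proof -
  let ?g = "\<lambda>e. \<Sum>A\<in>Pow {..<m}. (-1) ^ (m - card A) * of_bool (good e A) :: real"
  let ?X = "{e \<in> {..<m} \<rightarrow>\<^sub>E E. \<forall>i<m. \<exists>j<m. j \<noteq> i \<and> ends (e i) \<inter> ends (e j) \<noteq> {}}"
  have zero: "?g e = 0" if eX: "e \<in> ({..<m} \<rightarrow>\<^sub>E E) - ?X" for e
  proof -
    have e: "e \<in> {..<m} \<rightarrow>\<^sub>E E" using eX by blast
    obtain i where i: "i < m" "\<forall>j<m. j \<noteq> i \<longrightarrow> ends (e i) \<inter> ends (e j) = {}"
    proof -
      have "\<not> (\<forall>i<m. \<exists>j<m. j \<noteq> i \<and> ends (e i) \<inter> ends (e j) \<noteq> {})" using eX by simp
      then show thesis using that by auto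
    qed
    show ?thesis
      using moebius_good_isolated[of "{..<m}" i e] i e loopfree[of "e i"] by auto
  qed
  have "good_cumulant E m = (\<Sum>e\<in>?X. ?g e)"
    unfolding good_cumulant_eq[OF fin(1)]
    by (rule sum.mono_neutral_right) (use fin zero in \<open>auto simp: finite_PiE\<close>)
  also have "\<bar>\<dots>\<bar> \<le> (\<Sum>e\<in>?X. \<bar>?g e\<bar>)" by (rule sum_abs)
  also have "\<dots> \<le> (\<Sum>e\<in>?X. 2 ^ m)"
  proof (rule sum_mono)
    fix e
    have "\<bar>?g e\<bar> \<le> (\<Sum>A\<in>Pow {..<m}. \<bar>(-1) ^ (m - card A) * of_bool (good e A)\<bar>)" by (rule sum_abs)
    also have "\<dots> \<le> (\<Sum>A\<in>Pow {..<m}. 1)" by (rule sum_mono) (simp add: abs_mult)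
    also have "\<dots> = 2 ^ m" by (simp add: card_Pow)
    finally show "\<bar>?g e\<bar> \<le> 2 ^ m" .
  qed
  also have "\<dots> = 2 ^ m * real (card ?X)" by simp
  also have "\<dots> \<le> 2 ^ m * real ((2 * m * \<Delta>) ^ m * card E ^ (m div 2))"
    by (intro mult_left_mono of_nat_mono card_isolation_free_tuples fin \<Delta> deg) simp
  also have "\<dots> = (2 * real (2 * m * \<Delta>)) ^ m * real (card E) ^ (m div 2)"
    by (simp only: of_nat_mult of_nat_power power_mult_distrib mult.assoc)
  also have "2 * real (2 * m * \<Delta>) = real (4 * m * \<Delta>)" by simp
  finally show ?thesis .
qed

lemma card_short_edges_at: "card {p \<in> short_edges d V. v \<in> ends p} \<le> 4 * d"
proof -
  let ?W = "{v - d..v + d} - {v}"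
  have W: "card ?W \<le> 2 * d"
  proof -
    have "card ?W = card {v - d..v + d} - 1" by (rule card_Diff_singleton) auto
    then show ?thesis by simp
  qed
  have "{p \<in> short_edges d V. v \<in> ends p} \<subseteq> {v} \<times> ?W \<union> ?W \<times> {v}"
    by (auto simp: short_edges_def ends_def)
  then have "card {p \<in> short_edges d V. v \<in> ends p} \<le> card ({v} \<times> ?W \<union> ?W \<times> {v})"
    by (intro card_mono) auto
  also have "\<dots> \<le> card ({v} \<times> ?W) + card (?W \<times> {v})" by (rule card_Un_le)
  also have "\<dots> \<le> 4 * d" using W by (simp add: card_cartesian_product)
  finally show ?thesis .
qed

section \<open>Expansion of the factorial moments\<close>

abbreviation edge_count :: "nat \<Rightarrow> nat \<Rightarrow> real" where
  "edge_count d n \<equiv> real (card (short_edges d {..<n}))"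

lemma edge_count_ge:
  assumes "d < n" "1 \<le> d"
  shows "edge_count d n \<ge> real d * real n" "edge_count d n \<ge> 1"
proof -
  have "real d * real n \<le> real d * (2 * real n - real d - 1)"
    using assms by (intro mult_left_mono) auto
  then show "edge_count d n \<ge> real d * real n" using card_short_edges_real[of d n] assms by simp
  moreover have "1 * 1 \<le> real d * real n" using assms by (intro mult_mono) auto
  ultimately show "edge_count d n \<ge> 1" by simp
qed

text \<open>For \<open>1 \<le> d < n\<close> and \<open>k \<le> n\<close> this is the product of
  \<open>(n - (d + 1) / 2) / (n - j)\<close> over \<open>j < k\<close>.\<close>

definition falling_ratio :: "nat \<Rightarrow> nat \<Rightarrow> nat \<Rightarrow> real" where
  "falling_ratio k d n = edge_count d n ^ k * fact (n - k) / (fact n * (2 * real d) ^ k)"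

lemma falling_ratio_0 [simp]: "falling_ratio 0 d n = 1"
  by (simp add: falling_ratio_def)

lemma falling_ratio_Suc:
  assumes "d < n" "1 \<le> d" "k < n"
  shows "(real n - real k) * falling_ratio (Suc k) d n = (real n - (real d + 1) / 2) * falling_ratio k d n"
proof -
  have "fact (n - k) = (real n - real k) * fact (n - Suc k)"
    using assms by (metis Suc_diff_Suc fact_Suc of_nat_diff less_imp_le)
  then have "falling_ratio k d n = (real n - real k) * (edge_count d n ^ k * fact (n - Suc k) / (fact n * (2 * real d) ^ k))"
    by (simp add: falling_ratio_def)
  moreover have "edge_count d n / (2 * real d) = real n - (real d + 1) / 2"
    using card_short_edges_real[of d n] assms by (simp add: field_simps)
  moreover have "falling_ratio (Suc k) d n =
      edge_count d n / (2 * real d) * (edge_count d n ^ k * fact (n - Suc k) / (fact n * (2 * real d) ^ k))"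
    by (simp add: falling_ratio_def mult_ac)
  ultimately show ?thesis by simp
qed

lemma falling_ratio_nonneg: "falling_ratio k d n \<ge> 0"
  by (simp add: falling_ratio_def)

text \<open>Multiplied out in this way the estimate passes through the induction, because
  \<open>n * (n - (k + 1) ^ 2) \<le> (n - k) * (n - k ^ 2)\<close>. It yields the bound 2 as soon as
  \<open>2 * k ^ 2 < n\<close>.\<close>

lemma falling_ratio_bound:
  assumes "d < n" "1 \<le> d" "k ^ 2 < n"
  shows "falling_ratio k d n * (real n - real k ^ 2) \<le> real n"
  using assms(3)
proof (induction k)
  case (Suc k)
  have k2: "k ^ 2 < n" using Suc.prems by (auto simp: power2_eq_square)
  have "Suc k \<le> Suc k ^ 2" by (simp add: power2_eq_square)
  then have kn: "k < n" using Suc.prems by linarith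
  have Suc2: "real (Suc k) ^ 2 < real n" using Suc.prems by (metis of_nat_less_iff of_nat_power)
  have nk2: "real k ^ 2 < real n" using k2 by (metis of_nat_less_iff of_nat_power)
  let ?z = "falling_ratio k d n" and ?z' = "falling_ratio (Suc k) d n"
  have nk: "real n - real k > 0" using kn by simp
  have "(real n - real k) * ?z' \<le> real n * ?z"
    unfolding falling_ratio_Suc[OF assms(1,2) kn] using falling_ratio_nonneg[of k d n]
    by (intro mult_right_mono) auto
  then have "((real n - real k) * ?z') * (real n - real (Suc k) ^ 2) \<le> (real n * ?z) * (real n - real (Suc k) ^ 2)"
    using Suc2 by (intro mult_right_mono) auto
  also have "\<dots> = ?z * (real n * (real n - real (Suc k) ^ 2))" by simp
  also have "\<dots> \<le> ?z * ((real n - real k) * (real n - real k ^ 2))"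
  proof (rule mult_left_mono)
    have "(real n - real k) * (real n - real k ^ 2) - real n * (real n - real (Suc k) ^ 2) =
        real k * real k ^ 2 + real n * real k + real n"
      by (simp add: power2_eq_square algebra_simps)
    also have "\<dots> \<ge> 0" by simp
    finally show "real n * (real n - real (Suc k) ^ 2) \<le> (real n - real k) * (real n - real k ^ 2)" by simp
  qed (rule falling_ratio_nonneg)
  also have "\<dots> = (real n - real k) * (?z * (real n - real k ^ 2))" by simp
  also have "\<dots> \<le> (real n - real k) * real n"
    using Suc.IH[OF k2] nk by (intro mult_left_mono) auto
  finally have "(real n - real k) * (?z' * (real n - real (Suc k) ^ 2)) \<le> (real n - real k) * real n"
    by (simp only: mult.assoc)
  then show ?case using nk by (simp only: mult_le_cancel_left_pos)
qed simp

text \<open>With \<open>z\<close> for the ratio, this sums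
  \<open>n * (z (k + 1) - z k) = k * z (k + 1) - (d + 1) / 2 * z k\<close> and shifts the index in
  the first part; the separate \<open>+ 1\<close> compensates the spurious \<open>- 1\<close> that
  the shift produces at index 0. The factor \<open>1 / n\<close> gives the shape needed for
  bootstrapping.\<close>

lemma falling_ratio_recurrence:
  assumes "d < n" "1 \<le> d" "k < n"
  shows "falling_ratio k d n = 1 +
    ((\<Sum>j<k. (real j - 1 - (real d + 1) / 2) * falling_ratio j d n) + (real k - 1) * falling_ratio k d n + 1) / real n"
  using assms(3)
proof (induction k)
  case (Suc k)
  have "real n * (falling_ratio (Suc k) d n - falling_ratio k d n) =
     real k * falling_ratio (Suc k) d n - (real d + 1) / 2 * falling_ratio k d n"
    using falling_ratio_Suc[OF assms(1,2), of k] Suc.prems by (simp add: algebra_simps)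
  moreover have "real n * (falling_ratio k d n - 1) =
    (\<Sum>j<k. (real j - 1 - (real d + 1) / 2) * falling_ratio j d n) + (real k - 1) * falling_ratio k d n + 1"
    using Suc.IH Suc.prems by (simp add: field_simps)
  ultimately have "real n * (falling_ratio (Suc k) d n - 1) =
    (\<Sum>j<Suc k. (real j - 1 - (real d + 1) / 2) * falling_ratio j d n) + (real (Suc k) - 1) * falling_ratio (Suc k) d n + 1"
    by (simp add: algebra_simps)
  then show ?case using Suc.prems by (simp add: field_simps del: sum.lessThan_Suc)
qed simp

lemma expandable_falling_ratio: "expandable t falling_ratio"
proof (induction t)
  case 0
  show ?case
  proof (rule expandable_0I[of 2 2 _ 0])
    fix k d n assume r: "in_range 2 k d n"
    have "(k + d + 1) ^ 2 \<le> (k + d + 1) ^ 5" by (rule power_increasing) auto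
    moreover have "k ^ 2 < (k + d + 1) ^ 2" by (rule power_strict_mono) auto
    ultimately have k2: "2 * k ^ 2 < n" using r unfolding in_range_def by linarith
    then have "2 * real k ^ 2 < real n"
      by (metis of_nat_less_iff of_nat_mult of_nat_numeral of_nat_power)
    then have half: "real n / 2 \<le> real n - real k ^ 2" by linarith
    have n: "d < n" "n > 0" "1 \<le> d" using in_range_imp_ge[OF r] r by (auto simp: in_range_def)
    have "falling_ratio k d n * (real n / 2) \<le> falling_ratio k d n * (real n - real k ^ 2)"
      using half falling_ratio_nonneg by (rule mult_left_mono)
    also have "\<dots> \<le> real n" using falling_ratio_bound[of d n k] n k2 by simp
    finally have "falling_ratio k d n \<le> 2" using n(2) by (simp add: field_simps)
    then show "\<bar>falling_ratio k d n\<bar> \<le> 2 * real (k + d + 1) ^ 0" using falling_ratio_nonneg[of k d n] by simp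
  qed auto
next
  case (Suc t)
  let ?g = "\<lambda>k d n. ((\<Sum>j<k. (real j - 1 - (real d + 1) / 2) * falling_ratio j d n) + (real k - 1) * falling_ratio k d n + 1)"
  have lin: "expandable t (\<lambda>k d n. a + b * real k + c * real d)" for a b c
    by (intro expandable_newton_poly newton_poly_add newton_poly_mult newton_poly_coeff newton_poly_arg
        poly_growth_const poly_growth_mult poly_growth_of_nat)
  have "expandable t (\<lambda>k d n. real k - 1 - (real d + 1) / 2)"
  proof -
    have "(\<lambda>k d n. real k - 1 - (real d + 1) / 2) = (\<lambda>k d (n::nat). -3/2 + 1 * real k + (-1/2) * real d)"
      by (intro ext) (simp add: field_simps)
    then show ?thesis using lin[of "-3/2" 1 "-1/2"] by (simp only:)
  qed
  moreover have "expandable t (\<lambda>k d n. real k - 1)"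
    using lin[of "-1" 1 0] by simp
  ultimately have "expandable t ?g"
    by (intro expandable_add expandable_mult expandable_const Suc
        expandable_cumsum[where f = "\<lambda>j d n. (real j - 1 - (real d + 1) / 2) * falling_ratio j d n"])
  moreover have "falling_ratio k d n = 1 + ?g k d n / real n" if "in_range 1 k d n" for k d n
    using falling_ratio_recurrence[of d n k] in_range_imp_ge[OF that] that by (simp add: in_range_def)
  ultimately show ?case
    by (intro expandable_SucI[where r = "\<lambda>_ _. 1" and g = ?g and D = 1] newton_poly_coeff) auto
qed

text \<open>Bootstrapping again: \<open>y = 2 * n / (2 * n - d - 1)\<close> satisfies
  \<open>y = 1 + (1 + d) / 2 * y / n\<close>, so its boundedness yields every order, and the ratio
  in question is \<open>y / (2 * d)\<close>.\<close>

lemma expandable_n_over_edge_count: "expandable t (\<lambda>k d n. real n / edge_count d n)"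
proof -
  let ?y = "\<lambda>k d n. 2 * real n / (2 * real n - real d - 1)"
  have y: "expandable t ?y"
  proof (induction t)
    case 0
    have "\<bar>?y k d n\<bar> \<le> 2 * real (k + d + 1) ^ 0" if "in_range 1 k d n" for k d n
      using in_range_imp_ge[OF that] by (simp add: field_simps)
    then show ?case by (intro expandable_0I[of 2 1 _ 0]) auto
  next
    case (Suc t)
    have eq: "?y k d n = 1 + ((1 + real d) / 2 * ?y k d n) / real n" if "in_range 1 k d n" for k d n
    proof -
      have pos: "2 * real n - real d - 1 > 0" "n > 0" using in_range_imp_ge[OF that] by auto
      then have "((1 + real d) / 2 * ?y k d n) / real n = (1 + real d) / (2 * real n - real d - 1)" by simp
      also have "1 + \<dots> = ?y k d n" using pos by (simp add: add_divide_eq_iff)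
      finally show ?thesis by simp
    qed
    have ex: "expandable t (\<lambda>k d n. (1 + real d) / 2 * ?y k d n)"
    proof (intro expandable_mult Suc expandable_coeff)
      have "poly_growth (\<lambda>d. (1 / 2) * (1 + real d))"
        by (intro poly_growth_mult poly_growth_add poly_growth_const poly_growth_of_nat)
      then show "poly_growth (\<lambda>d. (1 + real d) / 2)" by simp
    qed
    show ?case
      by (rule expandable_SucI[OF newton_poly_coeff[OF poly_growth_const[of 1]] ex zero_less_one eq])
  qed
  have "poly_growth (\<lambda>d. 1 / (2 * real d))"
  proof (rule poly_growthI[of _ 1 0])
    fix d show "\<bar>1 / (2 * real d)\<bar> \<le> 1 * (1 + real d) ^ 0" by (cases d) auto
  qed
  then have "expandable t (\<lambda>k d n. 1 / (2 * real d) * ?y k d n)"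
    using y by (intro expandable_mult expandable_coeff)
  then show ?thesis
  proof (rule expandable_cong[where D = 1])
    fix k d n assume r: "in_range 1 k d n"
    then have "d < n" "1 \<le> d" using in_range_imp_ge[OF r] by (auto simp: in_range_def)
    then show "real n / edge_count d n = 1 / (2 * real d) * ?y k d n"
      using card_short_edges_real[of d n] by simp
  qed simp
qed

lemma good_tuples_short_edges: "good_tuples (short_edges d V) a = fact a * card (forests d a V)"
  by (simp add: good_tuples_def forests_def)

text \<open>Beyond the threshold each binomial of order \<open>j\<close> is \<open>n ^ j\<close>
  times a polynomial in \<open>1 / n\<close>. Since \<open>j \<le> a\<close>, division by
  \<open>n ^ a\<close> leaves only nonnegative powers of \<open>1 / n\<close>; what remains is the
  \<open>a\<close>-th power of \<open>n\<close> over the number of edges.\<close>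

lemma expandable_good_ratio_fixed:
  "expandable t (\<lambda>k d n. real (good_tuples (short_edges d {..<n}) a) / edge_count d n ^ a)"
proof -
  obtain c where c: "\<And>j. poly_growth (c j)"
    "\<And>d m. real (card (forests d a {..<2 * a * (d + 1) + m})) = (\<Sum>j\<le>a. c j d * real (m choose j))"
    by (rule card_forests_newton[of a]) blast
  let ?N = "\<lambda>d. 2 * a * (d + 1)"
  let ?B = "\<lambda>j d n. (1 / fact j) * (\<Prod>i<j. 1 + (- (real (?N d) + real i)) * (1 / real n))"
  have prodI: "expandable t (\<lambda>k d n. \<Prod>i<j. f i k d n)" if "\<And>i. expandable t (f i)" for f and j :: nat
    using that by (induction j) auto
  have B: "expandable t (\<lambda>k. ?B j)" for j
  proof -
    have "poly_growth (\<lambda>d. - (real (?N d) + real i))" for i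
      unfolding of_nat_mult of_nat_add
      by (intro poly_growth_minus poly_growth_add poly_growth_mult poly_growth_const poly_growth_of_nat)
    then show ?thesis
      by (intro expandable_mult expandable_const prodI expandable_add expandable_inverse_n expandable_coeff)
  qed
  have binom: "real ((n - ?N d) choose j) = real n ^ j * ?B j d n" if "n \<ge> ?N d" "n > 0" for n d j
  proof -
    have "real ((n - ?N d) choose j) = (\<Prod>i<j. real (n - ?N d) - real i) / fact j"
      by (simp add: binomial_gbinomial gbinomial_prod_rev atLeast0LessThan)
    also have "(\<Prod>i<j. real (n - ?N d) - real i) = (\<Prod>i<j. real n * (1 + (- (real (?N d) + real i)) * (1 / real n)))"
      using that by (intro prod.cong) (auto simp: field_simps of_nat_diff)
    finally show ?thesis by (simp add: prod.distrib)
  qed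
  have alg: "x * (u * b) = v * (x * (b * y))" if "v * y = u" for x u b v y :: real
    unfolding that[symmetric] by (simp only: mult_ac)
  have "expandable t (\<lambda>k d n. fact a * (real n / edge_count d n) ^ a * (\<Sum>j\<le>a. c j d * (?B j d n * (1 / real n) ^ (a - j))))"
    by (intro expandable_mult expandable_const expandable_power expandable_n_over_edge_count
        expandable_sum expandable_coeff c(1) B expandable_inverse_n)
  then show ?thesis
  \<comment> \<open>This constant ensures \<open>n \<ge> 2 * a * (d + 1)\<close>, where the
    polynomial formula holds.\<close>
  proof (rule expandable_cong[where D = "2 * a + 1"])
    fix k d n assume r: "in_range (2 * a + 1) k d n"
    have "?N d \<le> (2 * a + 1) * (k + d + 1)" by (intro mult_le_mono) auto
    then have n: "?N d \<le> n" "n > 0" using in_range_imp_ge[OF r] by auto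
    have "real (card (forests d a {..<n})) = (\<Sum>j\<le>a. c j d * real ((n - ?N d) choose j))"
      using c(2)[of d "n - ?N d"] n by simp
    also have "\<dots> = (\<Sum>j\<le>a. c j d * (real n ^ j * ?B j d n))"
      by (intro sum.cong refl) (simp only: binom[OF n])
    also have "\<dots> = real n ^ a * (\<Sum>j\<le>a. c j d * (?B j d n * (1 / real n) ^ (a - j)))"
      unfolding sum_distrib_left
    proof (rule sum.cong[OF refl])
      fix j assume "j \<in> {..a}"
      then have "real n ^ a = real n ^ j * real n ^ (a - j)" by (simp flip: power_add)
      then have "real n ^ a * (1 / real n) ^ (a - j) = real n ^ j"
        using n(2) by (simp add: power_one_over)
      then show "c j d * (real n ^ j * ?B j d n) = real n ^ a * (c j d * (?B j d n * (1 / real n) ^ (a - j)))"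
        by (rule alg)
    qed
    finally show "real (good_tuples (short_edges d {..<n}) a) / edge_count d n ^ a =
      fact a * (real n / edge_count d n) ^ a * (\<Sum>j\<le>a. c j d * (?B j d n * (1 / real n) ^ (a - j)))"
      unfolding good_tuples_short_edges by (simp add: power_divide)
  qed simp
qed

section \<open>The normalised cumulants and the forest probability for growing
  \<open>k\<close>\<close>

definition cumulant_ratio :: "nat \<Rightarrow> nat \<Rightarrow> nat \<Rightarrow> real" where
  "cumulant_ratio m d n = good_cumulant (short_edges d {..<n}) m / edge_count d n ^ m"

lemma expandable_cumulant_ratio: "expandable t (\<lambda>k. cumulant_ratio m)"
proof -
  have "expandable t (\<lambda>k d n. \<Sum>a\<le>m. (real (m choose a) * (-1) ^ (m - a)) *
      (real (good_tuples (short_edges d {..<n}) a) / edge_count d n ^ a))"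
    by (intro expandable_sum expandable_mult[OF expandable_const] expandable_good_ratio_fixed)
  then show ?thesis
  proof (rule expandable_cong[where D = 1])
    fix k d n assume r: "in_range 1 k d n"
    then have "edge_count d n \<ge> 1"
      using in_range_imp_ge[OF r] by (intro edge_count_ge) (auto simp: in_range_def)
    then have M: "edge_count d n > 0" by linarith
    show "cumulant_ratio m d n = (\<Sum>a\<le>m. (real (m choose a) * (-1) ^ (m - a)) *
      (real (good_tuples (short_edges d {..<n}) a) / edge_count d n ^ a))"
      unfolding cumulant_ratio_def good_cumulant_def sum_divide_distrib
    proof (rule sum.cong[OF refl])
      fix a assume "a \<in> {..m}"
      then have "edge_count d n ^ m = edge_count d n ^ (m - a) * edge_count d n ^ a" by (simp flip: power_add)
      then show "real (m choose a) * (- edge_count d n) ^ (m - a) * real (good_tuples (short_edges d {..<n}) a) / edge_count d n ^ m =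
        (real (m choose a) * (-1) ^ (m - a)) * (real (good_tuples (short_edges d {..<n}) a) / edge_count d n ^ a)"
        using M by (auto simp: power_minus[of "edge_count d n"])
    qed
  qed simp
qed

definition good_ratio :: "nat \<Rightarrow> nat \<Rightarrow> nat \<Rightarrow> real" where
  "good_ratio k d n = real (good_tuples (short_edges d {..<n}) k) / edge_count d n ^ k"

lemma good_ratio_eq_sum:
  assumes "edge_count d n > 0"
  shows "good_ratio k d n = (\<Sum>m\<le>k. real (k choose m) * cumulant_ratio m d n)"
  unfolding good_ratio_def good_tuples_eq_cumulants[of _ k] sum_divide_distrib cumulant_ratio_def
proof (rule sum.cong[OF refl])
  fix m assume "m \<in> {..k}"
  then have "edge_count d n ^ k = edge_count d n ^ (k - m) * edge_count d n ^ m" by (simp flip: power_add)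
  then show "real (k choose m) * edge_count d n ^ (k - m) * good_cumulant (short_edges d {..<n}) m / edge_count d n ^ k =
    real (k choose m) * (good_cumulant (short_edges d {..<n}) m / edge_count d n ^ m)"
    using assms by auto
qed

lemma cumulant_ratio_0: "cumulant_ratio 0 d n = 1"
proof -
  have "{R. R \<subseteq> short_edges d {..<n} \<and> card R = 0 \<and> linear_forest R} = {{}}"
    using finite_subset[OF _ finite_short_edges[of "{..<n}" d]]
    by (auto simp: linear_forest_def acyclic_def)
  then show ?thesis
    by (simp add: cumulant_ratio_def good_cumulant_def good_tuples_def del: card_eq_0_iff)
qed

text \<open>The degree bound \<open>4 * d\<close> and \<open>m \<le> k\<close> give the base
  \<open>16 * k * d\<close> in the cumulant estimate, the binomial coefficient adds another factor
  \<open>k\<close>, and dividing by \<open>M ^ m\<close> leaves \<open>sqrt M\<close> in the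
  denominator. Squaring and using \<open>M \<ge> d * n\<close> gives
  \<open>256 * k ^ 4 * d / n\<close>, whence the fifth power. The constant 1024 makes
  \<open>\<rho>\<close> at most \<open>1 / 2\<close>, so that the geometric sum costs a factor
  2.\<close>

lemma cumulant_tail_bound:
  assumes r: "in_range 1024 k d n"
  shows "\<bar>\<Sum>m=s..k. real (k choose m) * cumulant_ratio m d n\<bar> \<le> 2 * (sqrt (256 * real (k + d + 1) ^ 5 / real n)) ^ s"
proof -
  define \<rho> where "\<rho> = sqrt (256 * real (k + d + 1) ^ 5 / real n)"
  have n: "d < n" "n > 0" "1 \<le> d" using in_range_imp_ge[OF r] r by (auto simp: in_range_def)
  define M where "M = edge_count d n"
  have M: "M \<ge> real d * real n" "M \<ge> 1" using edge_count_ge n by (auto simp: M_def)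
  have \<rho>0: "\<rho> \<ge> 0" by (simp add: \<rho>_def)
  have "real (1024 * (k + d + 1) ^ 5) \<le> real n" using r unfolding in_range_def of_nat_le_iff by simp
  then have "1024 * real (k + d + 1) ^ 5 \<le> real n" by (simp only: of_nat_mult of_nat_power of_nat_numeral)
  then have "256 * real (k + d + 1) ^ 5 / real n \<le> (1 / 2) ^ 2" using n(2) by (simp add: field_simps del: of_nat_add)
  then have "\<rho> \<le> sqrt ((1 / 2) ^ 2)" unfolding \<rho>_def by (rule real_sqrt_le_mono)
  also have "\<dots> = 1 / 2" by (rule real_sqrt_unique) auto
  finally have \<rho>half: "\<rho> \<le> 1 / 2" .
  have step: "16 * real k ^ 2 * real d / sqrt M \<le> \<rho>"
  proof -
    have "(16 * real k ^ 2 * real d / sqrt M) ^ 2 = 256 * real k ^ 4 * real d ^ 2 / M"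
      using M(2) by (simp add: power_divide power_mult_distrib flip: power_mult)
    also have "\<dots> \<le> 256 * real k ^ 4 * real d ^ 2 / (real d * real n)"
      using M n by (intro divide_left_mono mult_pos_pos) auto
    also have "\<dots> = 256 * (real k ^ 4 * real d) / real n"
      using n by (simp add: power2_eq_square)
    also have "\<dots> \<le> 256 * real (k + d + 1) ^ 5 / real n"
    proof (intro divide_right_mono mult_left_mono)
      have "real k ^ 4 * real d \<le> real (k + d + 1) ^ 4 * real (k + d + 1)"
        by (intro mult_mono power_mono) auto
      also have "\<dots> = real (k + d + 1) ^ 5" by (simp only: power_Suc2[symmetric]) simp
      finally show "real k ^ 4 * real d \<le> real (k + d + 1) ^ 5" .
    qed auto
    finally show ?thesis unfolding \<rho>_def by (rule real_le_rsqrt)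
  qed
  have term_bound: "\<bar>real (k choose m) * cumulant_ratio m d n\<bar> \<le> \<rho> ^ m" if mk: "m \<le> k" for m
  proof -
    have "short_edges d {..<n} \<noteq> {}" using M(2) unfolding M_def by (metis card.empty not_one_le_zero of_nat_0 not_one_le_zero)
    then have "\<bar>good_cumulant (short_edges d {..<n}) m\<bar> \<le> real (4 * m * (4 * d)) ^ m * M ^ (m div 2)"
      unfolding M_def using n
      by (intro good_cumulant_bound card_short_edges_at finite_short_edges) (auto simp: short_edges_def)
    also have "\<dots> \<le> (16 * real k * real d) ^ m * sqrt M ^ m"
    proof (rule mult_mono)
      show "real (4 * m * (4 * d)) ^ m \<le> (16 * real k * real d) ^ m"
        using mk by (intro power_mono) (auto intro: mult_right_mono)
      have "M ^ (m div 2) = sqrt M ^ (2 * (m div 2))" using M(2) by (simp add: power_mult)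
      also have "\<dots> \<le> sqrt M ^ m" using M(2) by (intro power_increasing) auto
      finally show "M ^ (m div 2) \<le> sqrt M ^ m" .
    qed (use M in auto)
    finally have G: "\<bar>good_cumulant (short_edges d {..<n}) m\<bar> \<le> (16 * real k * real d) ^ m * sqrt M ^ m" .
    have "real (k choose m) \<le> real k ^ m"
      using mk by (metis binomial_le_pow of_nat_le_iff of_nat_power)
    then have "\<bar>real (k choose m) * cumulant_ratio m d n\<bar> \<le> real k ^ m * (((16 * real k * real d) ^ m * sqrt M ^ m) / M ^ m)"
      unfolding abs_mult cumulant_ratio_def abs_divide using G M
      by (intro mult_mono divide_mono) (auto simp: M_def)
    also have "M ^ m = sqrt M ^ m * sqrt M ^ m" using M(2) by (simp flip: power_mult_distrib)
    also have "real k ^ m * (((16 * real k * real d) ^ m * sqrt M ^ m) / (sqrt M ^ m * sqrt M ^ m)) = (16 * real k ^ 2 * real d / sqrt M) ^ m"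
      using M(2) by (simp add: power_divide power_mult_distrib power2_eq_square)
    also have "\<dots> \<le> \<rho> ^ m" using step M(2) by (intro power_mono) auto
    finally show ?thesis .
  qed
  have "\<bar>\<Sum>m=s..k. real (k choose m) * cumulant_ratio m d n\<bar> \<le> (\<Sum>m=s..k. \<rho> ^ m)"
    by (rule order_trans[OF sum_abs], rule sum_mono) (use term_bound in auto)
  also have "\<dots> \<le> (\<Sum>m\<in>{s..<s + Suc k}. \<rho> ^ m)" using \<rho>0 by (intro sum_mono2) auto
  also have "\<dots> = (\<Sum>i<Suc k. \<rho> ^ (i + s))"
    using sum.shift_bounds_nat_ivl[of "\<lambda>m. \<rho> ^ m" 0 s "Suc k"] by (simp add: atLeast0LessThan add.commute)
  also have "\<dots> = (\<Sum>i<Suc k. \<rho> ^ i) * \<rho> ^ s" unfolding power_add sum_distrib_right ..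
  also have "\<dots> \<le> 2 * \<rho> ^ s"
  proof (rule mult_right_mono)
    have "(\<Sum>i<Suc k. \<rho> ^ i) \<le> (\<Sum>i<Suc k. (1 / 2) ^ i)" using \<rho>0 \<rho>half by (intro sum_mono power_mono)
    also have "\<dots> \<le> 2" unfolding geometric_sum[of "1/2 :: real" "Suc k", simplified] 
      by (simp add: sum_gp_strict)
    finally show "(\<Sum>i<Suc k. \<rho> ^ i) \<le> 2" .
  qed (use \<rho>0 in simp)
  finally show ?thesis unfolding \<rho>_def .
qed

text \<open>Each order of a cumulant is worth a factor of size \<open>1 / sqrt n\<close>, so the
  orders from \<open>2 * t\<close> on contribute only a multiple of \<open>1 / n ^ t\<close>. In the
  finitely many remaining terms \<open>k\<close> occurs only in the binomial coefficient.\<close>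

lemma expandable_good_ratio: "expandable t good_ratio"
proof -
  let ?T = "\<lambda>k d n. \<Sum>m=2*t..k. real (k choose m) * cumulant_ratio m d n"
  have tail: "expandable t ?T"
  proof (rule expandable_small[of "2 * 256 ^ t" 1024 _ "5 * t"])
    fix k d n assume r: "in_range 1024 k d n"
    have "(sqrt (256 * real (k + d + 1) ^ 5 / real n)) ^ (2 * t) = (256 * real (k + d + 1) ^ 5 / real n) ^ t"
      by (simp only: power_mult) simp
    also have "\<dots> = 256 ^ t * real (k + d + 1) ^ (5 * t) / real n ^ t"
      by (simp only: power_divide power_mult_distrib power_mult)
    finally show "\<bar>?T k d n\<bar> \<le> 2 * 256 ^ t * real (k + d + 1) ^ (5 * t) / real n ^ t"
      using cumulant_tail_bound[OF r, of "2 * t"] by simp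
  qed auto
  have "newton_poly (\<lambda>k d. real (k choose m))" for m
    using newton_poly_binomial[of "\<lambda>_. 1" m] by simp
  then have "expandable t (\<lambda>k d n. (\<Sum>m<2*t. real (k choose m) * cumulant_ratio m d n) + ?T k d n)"
    by (intro expandable_add tail expandable_sum expandable_mult expandable_cumulant_ratio expandable_newton_poly)
  then show ?thesis
  proof (rule expandable_cong[where D = 1])
    fix k d n assume r: "in_range 1 k d n"
    then have "edge_count d n \<ge> 1"
      using in_range_imp_ge[OF r] by (intro edge_count_ge) (auto simp: in_range_def)
    then have "good_ratio k d n = (\<Sum>m\<le>k. real (k choose m) * cumulant_ratio m d n)"
      by (intro good_ratio_eq_sum) linarith
    \<comment> \<open>The first range may reach beyond \<open>k\<close>, where the binomials vanish;
      so its length does not depend on \<open>k\<close>.\<close>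
    also have "\<dots> = (\<Sum>m\<in>{..<2*t} \<union> {2*t..k}. real (k choose m) * cumulant_ratio m d n)"
      by (rule sum.mono_neutral_left) (auto simp: binomial_eq_0)
    also have "\<dots> = (\<Sum>m<2*t. real (k choose m) * cumulant_ratio m d n) + ?T k d n"
      by (rule sum.union_disjoint) auto
    finally show "good_ratio k d n = (\<Sum>m<2*t. real (k choose m) * cumulant_ratio m d n) + ?T k d n" .
  qed simp
qed

text \<open>The limits at fixed \<open>k\<close> and \<open>d\<close> identify the leading
  coefficient of the expansion as 1, which the closure properties of \<open>expandable\<close> do
  not reveal.\<close>

lemma falling_ratio_tendsto:
  assumes "1 \<le> d" shows "(\<lambda>n. falling_ratio k d n) \<longlonglongrightarrow> 1"
proof -
  show ?thesis
  proof (induction k)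
    case (Suc k)
    have "(\<lambda>n. (real n - (real d + 1) / 2) / (real n - real k) * falling_ratio k d n) \<longlonglongrightarrow> 1 * 1"
      by (rule tendsto_mult[OF _ Suc]) real_asymp
    moreover have "eventually (\<lambda>n. (real n - (real d + 1) / 2) / (real n - real k) * falling_ratio k d n =
        falling_ratio (Suc k) d n) sequentially"
      using eventually_gt_at_top[of "k + d"]
    proof eventually_elim
      case (elim n)
      then show ?case using falling_ratio_Suc[of d n k] assms by (simp add: field_simps)
    qed
    ultimately show ?case using Lim_transform_eventually by force
  qed simp
qed

lemma good_ratio_tendsto:
  assumes "1 \<le> d" shows "(\<lambda>n. good_ratio k d n) \<longlonglongrightarrow> 1"
proof -
  have ev: "eventually (\<lambda>n. norm (good_ratio k d n - 1) \<le> 2 * sqrt (256 * real (k + d + 1) ^ 5 / real n)) sequentially"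
    using eventually_ge_at_top[of "1024 * (k + d + 1) ^ 5"]
  proof eventually_elim
    case (elim n)
    then have r: "in_range 1024 k d n" using assms by (simp add: in_range_def)
    then have "edge_count d n \<ge> 1"
      using in_range_imp_ge[OF r] assms by (intro edge_count_ge) auto
    then have "good_ratio k d n = (\<Sum>m\<le>k. real (k choose m) * cumulant_ratio m d n)"
      by (intro good_ratio_eq_sum) linarith
    also have "{..k} = insert 0 {1..k}" by auto
    finally have "good_ratio k d n - 1 = (\<Sum>m=1..k. real (k choose m) * cumulant_ratio m d n)"
      by (simp add: cumulant_ratio_0)
    then show ?case using cumulant_tail_bound[OF r, of 1] by simp
  qed
  have lim: "(\<lambda>n. 2 * sqrt (256 * real (k + d + 1) ^ 5 / real n)) \<longlonglongrightarrow> 0"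
  proof -
    have "(\<lambda>n. 2 * sqrt (a / real n)) \<longlonglongrightarrow> 0" if "a > 0" for a :: real using that by real_asymp
    then show ?thesis by simp
  qed
  have "(\<lambda>n. norm (good_ratio k d n - 1)) \<longlonglongrightarrow> 0"
    by (rule tendsto_sandwich[OF always_eventually ev tendsto_const lim]) simp
  then have "(\<lambda>n. good_ratio k d n - 1) \<longlonglongrightarrow> 0" by (rule tendsto_norm_zero_cancel)
  then show ?thesis by (simp add: LIM_zero_iff)
qed

text \<open>Separates the Poisson moment from two corrections that tend to 1: the falling factorial
  of \<open>n\<close> and the forest condition.\<close>

lemma factorial_moment_eq:
  assumes "1 \<le> d" "d < n"
  shows "real (card (forests d k {1..n})) * fact (n - k) / fact n =
    (2 * real d) ^ k / fact k * (falling_ratio k d n * good_ratio k d n)"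
proof -
  have "bij_betw (\<lambda>R. map_prod Suc Suc ` R) (forests d k {..<n}) (forests d k (Suc ` {..<n}))"
    by (rule forests_relabel) auto
  then have "card (forests d k {1..n}) = card (forests d k {..<n})"
    using bij_betw_same_card by (metis image_Suc_lessThan)
  moreover have "edge_count d n \<ge> 1" using assms by (intro edge_count_ge) auto
  ultimately show ?thesis using assms
    by (auto simp: falling_ratio_def good_ratio_def good_tuples_short_edges field_simps)
qed

section \<open>Expansion of the probability\<close>

lemma newton_poly_poisson_sums:
  assumes "newton_poly f"
  obtains b where "poly_growth b"
    "\<And>d. (\<lambda>k. (a * real d) ^ k / fact k * f k d) sums (b d * exp (a * real d))"
proof -
  obtain J c where c: "\<And>j. poly_growth (c j)"
    "\<And>d x. (\<lambda>k. x ^ k / fact k * f k d) sums ((\<Sum>j\<le>J. c j d * x ^ j) * exp (x::real))"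
    by (rule newton_poly_exp_sums[OF assms]) blast
  show thesis
  proof (rule that)
    show "poly_growth (\<lambda>d. \<Sum>j\<le>J. c j d * (a * real d) ^ j)"
      by (intro poly_growth_sum poly_growth_mult poly_growth_power c(1) poly_growth_const poly_growth_of_nat)
  qed (rule c(2))
qed

lemma tendsto_power_series_n:
  "(\<lambda>n. \<Sum>i<Suc s. r i / real n ^ i) \<longlonglongrightarrow> (r 0 :: real)"
proof -
  have "(\<lambda>n. r 0 + (\<Sum>i<s. r (Suc i) * (1 / real n) ^ Suc i)) \<longlonglongrightarrow> r 0 + (\<Sum>i<s. r (Suc i) * 0 ^ Suc i)"
    by (intro tendsto_intros lim_1_over_n)
  moreover have "(\<lambda>n. \<Sum>i<Suc s. r i / real n ^ i) = (\<lambda>n. r 0 + (\<Sum>i<s. r (Suc i) * (1 / real n) ^ Suc i))"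
    unfolding sum.lessThan_Suc_shift by (simp add: power_one_over divide_inverse power_inverse)
  ultimately show ?thesis by simp
qed

text \<open>\<open>K\<close> is the order of truncation: the lower bound on it pushes the tail of
  the exponential series down to order \<open>1 / n ^ t\<close>, while the range condition allows
  all moments up to order \<open>K\<close> to be expanded. Three errors arise: the Bonferroni
  remainder, the errors of the moments below \<open>K\<close>, and the part of the limiting series
  from \<open>K\<close> on.\<close>

lemma prob_mj_ge_expansion:
  assumes "t > 0"
  obtains c q D where "\<And>i. poly_growth (c i)" "\<And>d. d \<ge> 1 \<Longrightarrow> c 0 d = 1" "poly_growth q" "D > 0"
    "\<And>d n K. in_range D K d n \<Longrightarrow> real t * ln (real n) + 2 * exp 1 * real d \<le> real K \<Longrightarrow>
       \<bar>prob_mj_ge n (d + 1) - (\<Sum>i<t. c i d / real n ^ i) * exp (- 2 * real d)\<bar>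
         \<le> q d * exp (2 * real d) / real n ^ t"
proof -
  define w where "w = (\<lambda>k d n. falling_ratio k d n * good_ratio k d n)"
  have "expandable t w"
    unfolding w_def by (intro expandable_mult expandable_falling_ratio expandable_good_ratio)
  then obtain r C \<kappa> D where r: "\<And>i. newton_poly (r i)" and C: "C \<ge> 0" and D: "D > 0"
    and w: "\<And>k d n. in_range D k d n \<Longrightarrow>
       \<bar>w k d n - (\<Sum>i<t. r i k d / real n ^ i)\<bar> \<le> C * real (k + d + 1) ^ \<kappa> / real n ^ t"
    by (rule expandable_expansion) blast
  have r0: "r 0 k d = 1" if d: "d \<ge> 1" for k d
  proof -
    obtain s where s: "t = Suc s" using assms by (cases t) auto
    let ?S = "\<lambda>n. \<Sum>i<t. r i k d / real n ^ i"
    have "w k d \<longlonglongrightarrow> 1 * 1"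
      unfolding w_def by (intro tendsto_mult falling_ratio_tendsto good_ratio_tendsto d)
    moreover have "?S \<longlonglongrightarrow> r 0 k d" unfolding s by (rule tendsto_power_series_n)
    ultimately have lim: "(\<lambda>n. w k d n - ?S n) \<longlonglongrightarrow> 1 * 1 - r 0 k d" by (rule tendsto_diff)
    have "(\<lambda>n. C * real (k + d + 1) ^ \<kappa> * (1 / real n) ^ t) \<longlonglongrightarrow> C * real (k + d + 1) ^ \<kappa> * 0 ^ t"
      by (intro tendsto_intros lim_1_over_n)
    then have lim0: "(\<lambda>n. C * real (k + d + 1) ^ \<kappa> / real n ^ t) \<longlonglongrightarrow> 0"
      using assms by (simp add: power_one_over zero_power)
    have ev: "eventually (\<lambda>n. norm (w k d n - ?S n) \<le> C * real (k + d + 1) ^ \<kappa> / real n ^ t) sequentially"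
      using eventually_ge_at_top[of "D * (k + d + 1) ^ 5"]
      by eventually_elim (use w d in \<open>auto simp: in_range_def simp del: of_nat_add\<close>)
    have "(\<lambda>n. norm (w k d n - ?S n)) \<longlonglongrightarrow> 0"
      by (rule tendsto_sandwich[OF always_eventually ev tendsto_const lim0]) simp
    then have "(\<lambda>n. w k d n - ?S n) \<longlonglongrightarrow> 0" by (rule tendsto_norm_zero_cancel)
    from LIMSEQ_unique[OF lim this] show ?thesis by simp
  qed
  have "\<exists>b. poly_growth b \<and> (\<forall>d. (\<lambda>k. (- 2 * real d) ^ k / fact k * r i k d) sums (b d * exp (- 2 * real d)))"
    (is "\<exists>b. ?P i b") for i
    by (rule newton_poly_poisson_sums[OF r[of i], of "- 2"]) blast
  then have "\<forall>i. \<exists>b. ?P i b" by (rule allI)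
  from choice[OF this] obtain c where c': "\<forall>i. ?P i (c i)" by (rule exE)
  have c: "\<And>i. poly_growth (c i)"
    "\<And>i d. (\<lambda>k. (- 2 * real d) ^ k / fact k * r i k d) sums (c i d * exp (- 2 * real d))"
    using c' by blast+
  have c0: "c 0 d = 1" if d: "d \<ge> 1" for d
  proof -
    have "(\<lambda>k. (- 2 * real d) ^ k / fact k) sums exp (- 2 * real d)"
      using exp_converges[of "- 2 * real d"] by (simp add: divide_inverse mult.commute)
    then have "c 0 d * exp (- 2 * real d) = exp (- 2 * real d)"
      using sums_unique2[OF c(2)[of d 0]] by (simp only: r0[OF d] mult_1_right)
    then show ?thesis by simp
  qed
  \<comment> \<open>The squares only serve to dominate \<open>\<bar>r i k d\<bar>\<close> by something polynomial in \<open>k\<close>.\<close>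
  define B where "B = (\<lambda>k d. (\<Sum>i<t. r i k d ^ 2 + 1) + C * real (k + d + 1) ^ \<kappa>)"
  have B: "newton_poly B"
  proof -
    have "newton_poly (\<lambda>k d. real k + (real d + 1))"
      by (rule newton_poly_add[OF newton_poly_arg newton_poly_coeff[OF poly_growth_add[OF poly_growth_of_nat poly_growth_const]]])
    then have "newton_poly (\<lambda>k d. real (k + d + 1))" by (simp add: add_ac)
    from newton_poly_coeff_times[OF poly_growth_const newton_poly_power[OF this]]
    have 1: "newton_poly (\<lambda>k d. C * real (k + d + 1) ^ \<kappa>)" .
    have "newton_poly (\<lambda>k d. r i k d ^ 2 + 1)" for i
      by (rule newton_poly_add[OF newton_poly_power[OF r] newton_poly_coeff[OF poly_growth_const]])
    then have "newton_poly (\<lambda>k d. \<Sum>i<t. r i k d ^ 2 + 1)" by (rule newton_poly_sum)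
    from newton_poly_add[OF this 1] show ?thesis unfolding B_def .
  qed
  obtain b1 where b1: "poly_growth b1" "\<And>d. (\<lambda>k. (2 * real d) ^ k / fact k * B k d) sums (b1 d * exp (2 * real d))"
    by (rule newton_poly_poisson_sums[OF B, of 2]) blast
  \<comment> \<open>The same series with an extra factor \<open>exp k\<close> in each term, kept for
    the exponential estimate of the tail.\<close>
  obtain b2 where b2: "poly_growth b2"
    "\<And>d. (\<lambda>k. (2 * exp 1 * real d) ^ k / fact k * B k d) sums (b2 d * exp (2 * exp 1 * real d))"
    by (rule newton_poly_poisson_sums[OF B, of "2 * exp 1"]) blast
  have B0: "B k d \<ge> 0" for k d unfolding B_def using C by (intro add_nonneg_nonneg sum_nonneg) auto
  have rB: "(\<Sum>i<t. \<bar>r i k d\<bar>) + C * real (k + d + 1) ^ \<kappa> \<le> B k d" for k d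
  proof -
    have "\<bar>x\<bar> \<le> x ^ 2 + 1" for x :: real
    proof -
      have "0 \<le> (\<bar>x\<bar> - 1) ^ 2" by simp
      then have "2 * \<bar>x\<bar> \<le> x ^ 2 + 1" by (simp add: power2_eq_square algebra_simps)
      then show ?thesis by linarith
    qed
    then show ?thesis unfolding B_def by (intro add_mono sum_mono) auto
  qed
  have b2_nonneg: "b2 d \<ge> 0" for d
  proof -
    have "0 \<le> b2 d * exp (2 * exp 1 * real d)"
      by (rule sums_le[OF _ sums_zero b2(2)]) (simp add: B0)
    then show ?thesis by (simp add: zero_le_mult_iff)
  qed
  show thesis
  proof (rule that[of c "\<lambda>d. b1 d + 2 * b2 d" D])
    show "poly_growth (\<lambda>d. b1 d + 2 * b2 d)"
      by (rule poly_growth_add[OF b1(1) poly_growth_mult[OF poly_growth_const b2(1)]])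
    fix d n K
    assume rng: "in_range D K d n" and K: "real t * ln (real n) + 2 * exp 1 * real d \<le> real K"
    have n: "d < n" "n \<ge> 2" "1 \<le> d" using in_range_imp_ge[OF rng D] rng by (auto simp: in_range_def)
    define a where "a = (\<lambda>k. (- 2 * real d) ^ k / fact k)"
    define A where "A = (\<lambda>k. (2 * real d) ^ k / fact k * B k d)"
    define S where "S = (\<lambda>k. \<Sum>i<t. r i k d / real n ^ i)"
    have a: "a k = (-1) ^ k * ((2 * real d) ^ k / fact k)" "\<bar>a k\<bar> = (2 * real d) ^ k / fact k" for k
    proof -
      show "a k = (-1) ^ k * ((2 * real d) ^ k / fact k)"
        using power_minus[of "2 * real d" k] by (simp add: a_def)
      then show "\<bar>a k\<bar> = (2 * real d) ^ k / fact k" by (simp add: abs_mult power_mult_distrib)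
    qed
    have S_le: "\<bar>S k\<bar> \<le> (\<Sum>i<t. \<bar>r i k d\<bar>)" for k
    proof -
      have "\<bar>r i k d / real n ^ i\<bar> \<le> \<bar>r i k d\<bar>" for i
        using n(2) by (simp add: divide_le_eq mult_le_cancel_left1 not_less_iff_gr_or_eq)
      then show ?thesis unfolding S_def by (intro order_trans[OF sum_abs] sum_mono)
    qed
    have S_B: "\<bar>S k\<bar> \<le> B k d" for k
      using S_le[of k] rB[of k d] C mult_nonneg_nonneg[OF C zero_le_power[of "real (k + d + 1)" \<kappa>]] by linarith
    have nt: "real n ^ t \<ge> 1" using n(2) by simp
    have w_S: "\<bar>w k d n - S k\<bar> \<le> C * real (k + d + 1) ^ \<kappa> / real n ^ t" if "k \<le> K" for k
      using w[OF in_range_mono[OF rng, of D k]] that by (simp add: S_def)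
    have err_B: "C * real (k + d + 1) ^ \<kappa> \<le> B k d" for k
    proof -
      have "(\<Sum>i<t. \<bar>r i k d\<bar>) \<ge> 0" by (rule sum_nonneg) simp
      then show ?thesis using rB[of k d] by linarith
    qed
    have A_nonneg: "A k \<ge> 0" for k unfolding A_def using B0 by simp
    have A_sums: "A sums (b1 d * exp (2 * real d))" unfolding A_def by (rule b1(2))
    have A_summable: "summable A" "summable (\<lambda>k. A (k + K))"
      using sums_summable[OF A_sums] by (simp_all add: summable_iff_shift)
    define T where "T = (\<Sum>k. A (k + K))"
    have T: "T \<le> b2 d / real n ^ t"
    proof -
      let ?g = "\<lambda>k. (2 * exp 1 * real d) ^ k / fact k * B k d"
      have g_summable: "summable ?g" using b2(2) by (rule sums_summable)
      then have g_shift: "summable (\<lambda>k. ?g (k + K))" by (rule summable_ignore_initial_segment)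
      \<comment> \<open>Chernoff's trick: at index \<open>k + K\<close> the weight
        \<open>exp k\<close>, which is at least 1, is inserted; in the series it turns
        \<open>2 * d\<close> into \<open>2 * exp 1 * d\<close>.\<close>
      have le: "A (k + K) \<le> exp (- real K) * ?g (k + K)" for k
      proof -
        have "(1::real) \<le> exp (real k)" by simp
        also have "exp (real k) = exp (- real K) * exp 1 ^ (k + K)"
          by (simp flip: exp_of_nat_mult exp_add)
        finally have "A (k + K) * 1 \<le> A (k + K) * (exp (- real K) * exp 1 ^ (k + K))"
          using A_nonneg by (rule mult_left_mono)
        also have "\<dots> = exp (- real K) * ?g (k + K)"
          unfolding A_def power_mult_distrib by (simp add: mult_ac)
        finally show ?thesis by simp
      qed
      have "T \<le> (\<Sum>k. exp (- real K) * ?g (k + K))"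
        unfolding T_def by (rule suminf_le[OF le A_summable(2) summable_mult[OF g_shift]])
      also have "\<dots> = exp (- real K) * (\<Sum>k. ?g (k + K))"
        by (rule suminf_mult[OF g_shift])
      also have "\<dots> \<le> exp (- real K) * (b2 d * exp (2 * exp 1 * real d))"
      proof (rule mult_left_mono)
        have "(\<Sum>k. ?g k) = (\<Sum>k. ?g (k + K)) + (\<Sum>k<K. ?g k)"
          by (rule suminf_split_initial_segment[OF g_summable])
        moreover have "(\<Sum>k<K. ?g k) \<ge> 0" using B0 by (intro sum_nonneg) simp
        ultimately show "(\<Sum>k. ?g (k + K)) \<le> b2 d * exp (2 * exp 1 * real d)"
          using sums_unique[OF b2(2)[of d]] by linarith
      qed simp
      also have "\<dots> = b2 d * exp (2 * exp 1 * real d - real K)" by (simp add: exp_diff exp_minus field_simps)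
      also have "\<dots> \<le> b2 d * exp (- (real t * ln (real n)))"
        using K b2_nonneg by (intro mult_left_mono) auto
      also have "\<dots> = b2 d / real n ^ t"
        using n by (simp add: exp_minus exp_of_nat_mult field_simps)
      finally show ?thesis .
    qed
    \<comment> \<open>The Bonferroni remainder is bounded by the term of index \<open>K\<close>
      alone, the first one of the tail.\<close>
    have T_ge: "A K \<le> T"
    proof -
      have "(\<Sum>k<1. A (k + K)) \<le> T" unfolding T_def using A_nonneg
        by (intro sum_le_suminf A_summable) auto
      then show ?thesis by simp
    qed
    let ?V = "(\<Sum>i<t. c i d / real n ^ i) * exp (- 2 * real d)"
    have V_sums: "(\<lambda>k. a k * S k) sums ?V"
    proof -
      have "(\<lambda>k. \<Sum>i<t. (a k * r i k d) / real n ^ i) sums (\<Sum>i<t. (c i d * exp (- 2 * real d)) / real n ^ i)"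
        unfolding a_def by (intro sums_sum sums_divide c(2))
      then show ?thesis by (simp add: S_def sum_distrib_left sum_distrib_right)
    qed
    have V: "?V = (\<Sum>k. a (k + K) * S (k + K)) + (\<Sum>k<K. a k * S k)"
      using suminf_split_initial_segment[OF sums_summable[OF V_sums], of K] sums_unique[OF V_sums] by simp
    have tail: "\<bar>\<Sum>k. a (k + K) * S (k + K)\<bar> \<le> T"
    proof -
      have le: "norm (a (k + K) * S (k + K)) \<le> A (k + K)" for k
        unfolding A_def real_norm_def abs_mult a(2) by (intro mult_left_mono S_B) simp
      have nf: "summable (\<lambda>k. norm (a (k + K) * S (k + K)))"
        by (rule summable_comparison_test'[OF A_summable(2), of 0]) (use le in simp)
      have "norm (\<Sum>k. a (k + K) * S (k + K)) \<le> (\<Sum>k. norm (a (k + K) * S (k + K)))"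
        by (rule summable_norm[OF nf])
      also have "\<dots> \<le> T" unfolding T_def by (rule suminf_le[OF le nf A_summable(2)])
      finally show ?thesis by simp
    qed
    have mid: "\<bar>\<Sum>k<K. a k * (w k d n - S k)\<bar> \<le> b1 d * exp (2 * real d) / real n ^ t"
    proof -
      have "\<bar>\<Sum>k<K. a k * (w k d n - S k)\<bar> \<le> (\<Sum>k<K. A k / real n ^ t)"
      proof (rule order_trans[OF sum_abs], rule sum_mono)
        fix k assume "k \<in> {..<K}"
        then have "\<bar>w k d n - S k\<bar> \<le> B k d / real n ^ t"
          using w_S[of k] err_B[of k] divide_right_mono[OF err_B, of "real n ^ t" k] nt by simp
        then have "\<bar>a k\<bar> * \<bar>w k d n - S k\<bar> \<le> \<bar>a k\<bar> * (B k d / real n ^ t)" by (rule mult_left_mono) simp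
        then show "\<bar>a k * (w k d n - S k)\<bar> \<le> A k / real n ^ t" by (simp add: A_def a(2) abs_mult)
      qed
      also have "\<dots> = (\<Sum>k<K. A k) / real n ^ t" by (simp add: sum_divide_distrib)
      also have "(\<Sum>k<K. A k) \<le> b1 d * exp (2 * real d)"
        unfolding sums_unique[OF A_sums] using A_nonneg A_summable(1) by (intro sum_le_suminf) auto
      finally show ?thesis using nt by (simp add: divide_right_mono)
    qed
    have moment: "real (card (forests d k {1..n})) * fact (n - k) / fact n = (2 * real d) ^ k / fact k * w k d n" for k
      unfolding w_def using factorial_moment_eq n by blast
    have first: "\<bar>prob_mj_ge n (d + 1) - (\<Sum>k<K. a k * w k d n)\<bar> \<le> T"
    proof -
      have "\<bar>prob_mj_ge n (d + 1) - (\<Sum>k<K. a k * w k d n)\<bar> \<le> (2 * real d) ^ K / fact K * w K d n"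
        using prob_mj_ge_bonferroni[OF n(2), of d K] unfolding moment a(1) by (simp only: mult.assoc)
      also have "\<dots> \<le> (2 * real d) ^ K / fact K * B K d"
      proof (rule mult_left_mono)
        have "C * real (K + d + 1) ^ \<kappa> / real n ^ t \<le> C * real (K + d + 1) ^ \<kappa>"
          using divide_left_mono[OF nt mult_nonneg_nonneg[OF C zero_le_power[of "real (K + d + 1)" \<kappa>]]] n(2) by simp
        then show "w K d n \<le> B K d" using w_S[of K] S_le[of K] rB[of K d] by linarith
      qed simp
      finally show ?thesis using T_ge unfolding A_def by linarith
    qed
    have "prob_mj_ge n (d + 1) - ?V = (prob_mj_ge n (d + 1) - (\<Sum>k<K. a k * w k d n)) +
        (\<Sum>k<K. a k * (w k d n - S k)) - (\<Sum>k. a (k + K) * S (k + K))"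
      unfolding V by (simp add: right_diff_distrib sum_subtractf)
    then have "\<bar>prob_mj_ge n (d + 1) - ?V\<bar> \<le> T + b1 d * exp (2 * real d) / real n ^ t + T"
      using first mid tail by linarith
    also have "\<dots> \<le> b1 d * exp (2 * real d) / real n ^ t + 2 * (b2 d / real n ^ t)" using T by linarith
    also have "\<dots> \<le> b1 d * exp (2 * real d) / real n ^ t + 2 * (b2 d * exp (2 * real d) / real n ^ t)"
    proof -
      have "b2 d * 1 \<le> b2 d * exp (2 * real d)" using b2_nonneg by (intro mult_left_mono) auto
      then show ?thesis using nt by (simp add: divide_right_mono)
    qed
    also have "\<dots> = (b1 d + 2 * b2 d) * exp (2 * real d) / real n ^ t"
      by (simp add: distrib_right add_divide_distrib)
    finally show "\<bar>prob_mj_ge n (d + 1) - ?V\<bar> \<le> (b1 d + 2 * b2 d) * exp (2 * real d) / real n ^ t" .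
  qed (use c c0 D in auto)
qed

text \<open>Without short edges there is no forest of size 1, so Bonferroni cut at order 1 is exact.
  This settles \<open>d = 0\<close>, which the expansion excludes.\<close>

lemma prob_mj_ge_1: "n \<ge> 2 \<Longrightarrow> prob_mj_ge n 1 = 1"
proof -
  assume n: "n \<ge> 2"
  have E: "short_edges 0 {1..n} = {}" by (auto simp: short_edges_def)
  have "forests 0 0 {1..n} = {{}}" "forests 0 1 {1..n} = {}"
    unfolding forests_def E by (auto simp: linear_forest_def acyclic_def)
  then show ?thesis using prob_mj_ge_bonferroni[OF n, of 0 1] by simp
qed

lemma poly_growth_poly_bound:
  assumes "poly_growth c"
  obtains P where "\<And>x. poly P x \<ge> (0::real)" "\<And>d. \<bar>c d\<bar> \<le> poly P (real d)"
proof -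
  obtain C K where C: "C \<ge> 0" "\<And>d. \<bar>c d\<bar> \<le> C * (1 + real d) ^ K"
    by (rule poly_growthE[OF assms]) blast
  show thesis
  \<comment> \<open>\<open>2 + x ^ 2\<close> dominates \<open>1 + x\<close> at the natural numbers
    and is positive on the whole real line, as a bound for functions of a real variable
    requires.\<close>
  proof (rule that[of "smult C ([:2, 0, 1:] ^ K)"])
    show "poly (smult C ([:2, 0, 1:] ^ K)) x \<ge> 0" for x
      using C(1) by (simp add: poly_power)
    fix d
    have "(1 + real d) ^ K \<le> (2 + real d * real d) ^ K"
    proof (rule power_mono)
      have "real d \<le> real d * real d" by (cases d) auto
      then show "1 + real d \<le> 2 + real d * real d" by simp
    qed simp
    then have "C * (1 + real d) ^ K \<le> C * (2 + real d * real d) ^ K" using C(1) by (rule mult_left_mono)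
    with C(2)[of d] have "\<bar>c d\<bar> \<le> C * (2 + real d * real d) ^ K" by (rule order_trans)
    then show "\<bar>c d\<bar> \<le> poly (smult C ([:2, 0, 1:] ^ K)) (real d)" by (simp add: poly_power)
  qed
qed

theorem theorem2:
  fixes t :: nat
  assumes "t > 0"
  shows "\<exists>(p :: nat \<Rightarrow> real \<Rightarrow> real) (q :: real \<Rightarrow> real).
           (\<forall>i\<in>{1..t-1}. poly_bounded (p i)) \<and> poly_bounded q \<and>
           (\<forall>d :: nat \<Rightarrow> nat.
              (\<lambda>n. real (d n)) \<in> O(\<lambda>n. ln (real n)) \<longrightarrow>
              (\<lambda>n. prob_mj_ge n (d n + 1)
                    - (1 + (\<Sum>i=1..t-1. p i (real (d n)) / real n ^ i)) * exp (- 2 * real (d n)))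
              \<in> O(\<lambda>n. q (real (d n)) * exp (2 * real (d n)) / real n ^ t))"
proof -
  obtain c q0 D where c: "\<And>i. poly_growth (c i)" "\<And>d. d \<ge> 1 \<Longrightarrow> c 0 d = 1"
    and q0: "poly_growth q0" and D: "D > 0"
    and main: "\<And>d n K. in_range D K d n \<Longrightarrow> real t * ln (real n) + 2 * exp 1 * real d \<le> real K \<Longrightarrow>
       \<bar>prob_mj_ge n (d + 1) - (\<Sum>i<t. c i d / real n ^ i) * exp (- 2 * real d)\<bar>
         \<le> q0 d * exp (2 * real d) / real n ^ t"
    using prob_mj_ge_expansion[OF assms] by blast
  \<comment> \<open>The coefficients live on the positive integers and are continued by 0. This
    includes \<open>x = 0\<close>, where the main term then equals the exact probability 1.\<close>
  define p where "p = (\<lambda>i x. if \<exists>d\<ge>1. x = real d then c i (nat \<lfloor>x\<rfloor>) else 0)"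
  have p: "p i (real d) = (if d \<ge> 1 then c i d else 0)" for i d by (auto simp: p_def)
  obtain Q where Q: "\<And>x. poly Q x \<ge> (0::real)" "\<And>d. \<bar>q0 d\<bar> \<le> poly Q (real d)"
    by (rule poly_growth_poly_bound[OF q0]) blast
  have "poly_bounded (p i)" for i
  proof -
    obtain P where P: "\<And>x. poly P x \<ge> (0::real)" "\<And>d. \<bar>c i d\<bar> \<le> poly P (real d)"
      by (rule poly_growth_poly_bound[OF c(1)[of i]]) blast
    have "\<bar>p i x\<bar> \<le> poly P x" for x
      using P by (cases "\<exists>d\<ge>1. x = real d") (auto simp: p_def)
    then show ?thesis unfolding poly_bounded_def by blast
  qed
  moreover have "poly_bounded (poly Q)"
    unfolding poly_bounded_def by (rule exI[of _ Q]) (use Q(1) in simp)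
  moreover have "(\<lambda>n. prob_mj_ge n (d n + 1)
        - (1 + (\<Sum>i=1..t-1. p i (real (d n)) / real n ^ i)) * exp (- 2 * real (d n)))
      \<in> O(\<lambda>n. poly Q (real (d n)) * exp (2 * real (d n)) / real n ^ t)"
    if dO: "(\<lambda>n. real (d n)) \<in> O(\<lambda>n. ln (real n))" for d :: "nat \<Rightarrow> nat"
  proof -
    from dO obtain C where C: "C > 0" "eventually (\<lambda>n. norm (real (d n)) \<le> C * norm (ln (real n))) sequentially"
      by (rule landau_o.bigE)
    \<comment> \<open>Chosen such that \<open>d \<le> C * ln n\<close> gives
      \<open>K + d + 1 \<le> A * ln n + 2\<close> for the cutoff \<open>K\<close> below;
      \<open>D\<close> times the fifth power of this is eventually at most \<open>n\<close>, which
      is the range condition.\<close>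
    define A where "A = real t + 2 * exp 1 * C + C"
    have A: "A > 0" unfolding A_def using C(1) by (intro add_nonneg_pos) auto
    have Dr: "real D > 0" using D by simp
    have "eventually (\<lambda>n. real D * (A * ln (real n) + 2) ^ 5 \<le> real n) sequentially"
      using A Dr by real_asymp
    with C(2) have "eventually (\<lambda>n. norm (prob_mj_ge n (d n + 1)
        - (1 + (\<Sum>i=1..t-1. p i (real (d n)) / real n ^ i)) * exp (- 2 * real (d n)))
      \<le> 1 * norm (poly Q (real (d n)) * exp (2 * real (d n)) / real n ^ t)) sequentially"
      using eventually_ge_at_top[of 2]
    proof eventually_elim
      case (elim n)
      have ln0: "ln (real n) \<ge> 0" using elim(3) by simp
      have dn: "real (d n) \<le> C * ln (real n)" using elim(1) ln0 by simp
      show ?case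
      proof (cases "d n = 0")
        case True
        have "(\<Sum>i=1..t-1. p i (real (d n)) / real n ^ i) = 0"
          by (rule sum.neutral) (simp only: p True, simp)
        then show ?thesis using True prob_mj_ge_1[OF elim(3)] Q(1) by simp
      next
        case False
        define K where "K = nat \<lceil>real t * ln (real n) + 2 * exp 1 * real (d n)\<rceil>"
        have K: "real t * ln (real n) + 2 * exp 1 * real (d n) \<le> real K"
          unfolding K_def by (rule real_nat_ceiling_ge)
        have arg0: "0 \<le> real t * ln (real n) + 2 * exp 1 * real (d n)" using ln0 by simp
        then have "real K < real t * ln (real n) + 2 * exp 1 * real (d n) + 1"
          unfolding K_def by linarith
        also have "\<dots> \<le> real t * ln (real n) + 2 * exp 1 * (C * ln (real n)) + 1"
          using dn by simp
        finally have "real (K + d n + 1) \<le> A * ln (real n) + 2"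
          unfolding A_def using dn by (simp add: algebra_simps)
        then have "real D * real (K + d n + 1) ^ 5 \<le> real D * (A * ln (real n) + 2) ^ 5"
          by (intro mult_left_mono power_mono) auto
        also have "\<dots> \<le> real n" by (rule elim(2))
        finally have "real (D * (K + d n + 1) ^ 5) \<le> real n" by (simp only: of_nat_mult of_nat_power)
        then have "in_range D K (d n) n" using False unfolding in_range_def of_nat_le_iff by simp
        from main[OF this K] have "\<bar>prob_mj_ge n (d n + 1) - (\<Sum>i<t. c i (d n) / real n ^ i) * exp (- 2 * real (d n))\<bar>
            \<le> q0 (d n) * exp (2 * real (d n)) / real n ^ t" .
        also have "(\<Sum>i<t. c i (d n) / real n ^ i) = 1 + (\<Sum>i=1..t-1. p i (real (d n)) / real n ^ i)"
        proof -
          have "{..<t} = insert 0 {1..t-1}" using assms by auto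
          then show ?thesis using False c(2)[of "d n"] by (simp add: p)
        qed
        also have "q0 (d n) * exp (2 * real (d n)) / real n ^ t \<le> poly Q (real (d n)) * exp (2 * real (d n)) / real n ^ t"
          using Q(2)[of "d n"] by (intro divide_right_mono mult_right_mono) auto
        finally show ?thesis using Q(1) by (simp add: abs_mult)
      qed
    qed
    then show ?thesis by (rule landau_o.bigI[rotated]) simp
  qed
  ultimately show ?thesis by (intro exI[of _ p] exI[of _ "poly Q"]) blast
qed

end
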